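(* Let $\Lambda$ be a semiperfect ring, and let $t$ be the number of isomorphism classes of indecomposable projective right $\Lambda$-modules. Then: (i) The canonical isomorphism between $V_r(\Lambda)\cong\mathbb{N}_0^t$ and $V_\ell(\Lambda)$ extends to an isomorphism between $V_r^*(\Lambda)\cong(\mathbb{N}_0^* )^t$ and $V_\ell^*(\Lambda)$. (ii) Let $P$ be a projective right $\Lambda$-module. Then there exists a two-sided ideal $I$ of $\Lambda$ that is minimal with respect to the property that $P/PI$ is finitely generated. Moreover, $I$ is the trace of a finitely generated projective right $\Lambda$-module. (iii) Every countably generated projective right $\Lambda$-module is relatively big, so that $V_r^*(\Lambda)=V_r(\Lambda)\sqcup B_r(\Lambda)$.
   Context: Rings are associative with $1$. $\mathbb{N}_0^*=\mathbb{N}_0\cup\{\infty\}$ is the additive monoid extending $\mathbb{N}_0=\{0,1,2,\dots\}$ with $x+\infty=\infty+x=\infty$ for all $x$. $V_r(\Lambda)$ (resp. $V_r^*(\Lambda)$) is the set of isomorphism classes $[P]$ of finitely generated (resp. countably generated) projective right $\Lambda$-modules, a commutative monoid under $[P]+[P']=[P\oplus P']$. $V_\ell(\Lambda)$, $V^*_\ell(\Lambda)$ are the analogous monoids for left modules. The canonical isomorphism $V_r(\Lambda)\to V_\ell(\Lambda)$ is $[P]\mapsto[\mathrm{Hom}_\Lambda(P,\Lambda)]$. The trace of a right $\Lambda$-module $M$ is the two-sided ideal $\mathrm{Tr}_\Lambda(M)=\sum_{f\in\mathrm{Hom}_\Lambda(M,\Lambda)}f(M)$. A countably generated projective right $\Lambda$-module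 $P$ is relatively big if there is a countably generated projective right $\Lambda$-module $P'$ with trace ideal $J$ such that $P\oplus P'^{(\omega)}\cong P$ and $P/PJ$ is finitely generated. $B_r(\Lambda)\subseteq V_r^*(\Lambda)$ is the set of isomorphism classes of relatively big projective right modules that are not finitely generated. *)

theory Defs
  imports "HOL-Algebra.Module" "HOL-Algebra.QuotRing" "HOL-Algebra.Product_Groups"
    "HOL-Library.Extended_Nat" "HOL-Library.Countable_Set"
begin

section \<open>Right modules over a ring that need not be commutative\<close>

text \<open>
  Right modules reuse the record of \<^locale>\<open>module\<close>; the element \<open>a \<odot>\<^bsub>M\<^esub> x\<close> is
  to be read as \<open>x \<cdot> a\<close>, which explains the order of the factors in \<open>smult_assoc\<close>.
  The record inherits the ring fields \<^const>\<open>mult\<close> and \<^const>\<open>one\<close>. They have no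
  meaning for a module, no notion below refers to them for a module, and module constructions
  leave them \<^const>\<open>undefined\<close>.
\<close>

locale right_module = R?: ring R + M?: abelian_group M
  for R :: "('a, 'r) ring_scheme" (structure) and M :: "('a, 'm, 's) module_scheme" (structure) +
  assumes smult_closed [simp, intro]:
      "\<lbrakk>a \<in> carrier R; x \<in> carrier M\<rbrakk> \<Longrightarrow> a \<odot>\<^bsub>M\<^esub> x \<in> carrier M"
    and smult_l_distr:
      "\<lbrakk>a \<in> carrier R; b \<in> carrier R; x \<in> carrier M\<rbrakk> \<Longrightarrow>
        (a \<oplus> b) \<odot>\<^bsub>M\<^esub> x = a \<odot>\<^bsub>M\<^esub> x \<oplus>\<^bsub>M\<^esub> b \<odot>\<^bsub>M\<^esub> x"
    and smult_r_distr:
      "\<lbrakk>a \<in> carrier R; x \<in> carrier M; y \<in> carrier M\<rbrakk> \<Longrightarrow>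
        a \<odot>\<^bsub>M\<^esub> (x \<oplus>\<^bsub>M\<^esub> y) = a \<odot>\<^bsub>M\<^esub> x \<oplus>\<^bsub>M\<^esub> a \<odot>\<^bsub>M\<^esub> y"
    and smult_assoc:
      "\<lbrakk>a \<in> carrier R; b \<in> carrier R; x \<in> carrier M\<rbrakk> \<Longrightarrow>
        (a \<otimes> b) \<odot>\<^bsub>M\<^esub> x = b \<odot>\<^bsub>M\<^esub> (a \<odot>\<^bsub>M\<^esub> x)"
    and smult_one [simp]:
      "x \<in> carrier M \<Longrightarrow> \<one> \<odot>\<^bsub>M\<^esub> x = x"

definition opp_ring :: "('a, 'r) ring_scheme \<Rightarrow> ('a, 'r) ring_scheme"
  where "opp_ring R = R\<lparr>monoid.mult := (\<lambda>a b. b \<otimes>\<^bsub>R\<^esub> a)\<rparr>"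

lemma opp_ring_simps [simp]:
  "carrier (opp_ring R) = carrier R"
  "a \<otimes>\<^bsub>opp_ring R\<^esub> b = b \<otimes>\<^bsub>R\<^esub> a"
  "\<one>\<^bsub>opp_ring R\<^esub> = \<one>\<^bsub>R\<^esub>"
  "\<zero>\<^bsub>opp_ring R\<^esub> = \<zero>\<^bsub>R\<^esub>"
  "a \<oplus>\<^bsub>opp_ring R\<^esub> b = a \<oplus>\<^bsub>R\<^esub> b"
  by (simp_all add: opp_ring_def)

lemma ring_opp_ring:
  assumes "ring R"
  shows "ring (opp_ring R)"
proof -
  interpret ring R by fact
  have "abelian_group (opp_ring R)"
    by (rule abelian_groupI) (auto simp: a_ac intro: l_neg a_inv_closed)
  moreover have "monoid (opp_ring R)"
    by (rule monoidI) (auto simp: m_assoc)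
  ultimately show ?thesis
    by (intro ringI) (auto simp: l_distr r_distr)
qed

text \<open>
  Left modules over \<open>R\<close> are taken to be right modules over the opposite ring:
\<close>

lemma right_module_opp_ring_iff:
  assumes "ring R" "abelian_group M"
  shows "right_module (opp_ring R) M \<longleftrightarrow>
    (\<forall>a \<in> carrier R. \<forall>x \<in> carrier M. a \<odot>\<^bsub>M\<^esub> x \<in> carrier M) \<and>
    (\<forall>a \<in> carrier R. \<forall>b \<in> carrier R. \<forall>x \<in> carrier M.
      (a \<oplus>\<^bsub>R\<^esub> b) \<odot>\<^bsub>M\<^esub> x = a \<odot>\<^bsub>M\<^esub> x \<oplus>\<^bsub>M\<^esub> b \<odot>\<^bsub>M\<^esub> x) \<and>
    (\<forall>a \<in> carrier R. \<forall>x \<in> carrier M. \<forall>y \<in> carrier M.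
      a \<odot>\<^bsub>M\<^esub> (x \<oplus>\<^bsub>M\<^esub> y) = a \<odot>\<^bsub>M\<^esub> x \<oplus>\<^bsub>M\<^esub> a \<odot>\<^bsub>M\<^esub> y) \<and>
    (\<forall>a \<in> carrier R. \<forall>b \<in> carrier R. \<forall>x \<in> carrier M.
      (a \<otimes>\<^bsub>R\<^esub> b) \<odot>\<^bsub>M\<^esub> x = a \<odot>\<^bsub>M\<^esub> (b \<odot>\<^bsub>M\<^esub> x)) \<and>
    (\<forall>x \<in> carrier M. \<one>\<^bsub>R\<^esub> \<odot>\<^bsub>M\<^esub> x = x)"
  using ring_opp_ring[OF assms(1)] assms(2)
  by (auto simp: right_module_def right_module_axioms_def)


section \<open>Homomorphisms and constructions\<close>

definition module_hom ::
    "('a, 'r) ring_scheme \<Rightarrow> ('a, 'm, 's) module_scheme \<Rightarrow> ('a, 'n, 'u) module_scheme \<Rightarrow> ('m \<Rightarrow> 'n) set"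
  where "module_hom R M N =
    {f \<in> carrier M \<rightarrow> carrier N.
      (\<forall>x \<in> carrier M. \<forall>y \<in> carrier M. f (x \<oplus>\<^bsub>M\<^esub> y) = f x \<oplus>\<^bsub>N\<^esub> f y) \<and>
      (\<forall>a \<in> carrier R. \<forall>x \<in> carrier M. f (a \<odot>\<^bsub>M\<^esub> x) = a \<odot>\<^bsub>N\<^esub> f x)}"

definition module_isomorphic ::
    "('a, 'r) ring_scheme \<Rightarrow> ('a, 'm, 's) module_scheme \<Rightarrow> ('a, 'n, 'u) module_scheme \<Rightarrow> bool"
  where "module_isomorphic R M N \<longleftrightarrow>
    (\<exists>f \<in> module_hom R M N. bij_betw f (carrier M) (carrier N))"

definition regular_module :: "('a, 'r) ring_scheme \<Rightarrow> ('a, 'a) module"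
  where "regular_module R =
    \<lparr>carrier = carrier R, monoid.mult = undefined, monoid.one = undefined,
     ring.zero = \<zero>\<^bsub>R\<^esub>, add = add R, smult = (\<lambda>a x. x \<otimes>\<^bsub>R\<^esub> a)\<rparr>"

definition module_sum ::
    "('a, 'm, 's) module_scheme \<Rightarrow> ('a, 'n, 'u) module_scheme \<Rightarrow> ('a, 'm \<times> 'n) module"
  where "module_sum M N =
    \<lparr>carrier = carrier M \<times> carrier N, monoid.mult = undefined, monoid.one = undefined,
     ring.zero = (\<zero>\<^bsub>M\<^esub>, \<zero>\<^bsub>N\<^esub>),
     add = (\<lambda>(x, y) (x', y'). (x \<oplus>\<^bsub>M\<^esub> x', y \<oplus>\<^bsub>N\<^esub> y')),
     smult = (\<lambda>a (x, y). (a \<odot>\<^bsub>M\<^esub> x, a \<odot>\<^bsub>N\<^esub> y))\<rparr>"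

text \<open>The direct sum \<open>M\<^sup>(\<^sup>I\<^sup>)\<close> of copies of \<open>M\<close> indexed by \<open>I\<close>.\<close>

definition module_power :: "'i set \<Rightarrow> ('a, 'm, 's) module_scheme \<Rightarrow> ('a, 'i \<Rightarrow> 'm) module"
  where "module_power I M =
    \<lparr>carrier = {x \<in> I \<rightarrow>\<^sub>E carrier M. finite {i \<in> I. x i \<noteq> \<zero>\<^bsub>M\<^esub>}},
     monoid.mult = undefined, monoid.one = undefined,
     ring.zero = (\<lambda>i\<in>I. \<zero>\<^bsub>M\<^esub>),
     add = (\<lambda>x y. \<lambda>i\<in>I. x i \<oplus>\<^bsub>M\<^esub> y i),
     smult = (\<lambda>a x. \<lambda>i\<in>I. a \<odot>\<^bsub>M\<^esub> x i)\<rparr>"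

definition quotient_module :: "('a, 'm, 's) module_scheme \<Rightarrow> 'm set \<Rightarrow> ('a, 'm set) module"
  where "quotient_module M N =
    \<lparr>carrier = a_rcosets\<^bsub>M\<^esub> N, monoid.mult = undefined, monoid.one = undefined,
     ring.zero = N, add = set_add M,
     smult = (\<lambda>a X. \<Union>x\<in>X. N +>\<^bsub>M\<^esub> (a \<odot>\<^bsub>M\<^esub> x))\<rparr>"

text \<open>
  For a right module \<open>M\<close>, the left module \<open>Hom(M, R)\<close> with \<open>(a f)(x) = a f(x)\<close>, as a right
  module over \<^term>\<open>opp_ring R\<close>. Its elements are made extensional, so that a homomorphism is
  determined by its values on \<^term>\<open>carrier M\<close>.
\<close>

definition dual_module ::
    "('a, 'r) ring_scheme \<Rightarrow> ('a, 'm, 's) module_scheme \<Rightarrow> ('a, 'm \<Rightarrow> 'a) module"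
  where "dual_module R M =
    \<lparr>carrier = module_hom R M (regular_module R) \<inter> extensional (carrier M),
     monoid.mult = undefined, monoid.one = undefined,
     ring.zero = (\<lambda>x\<in>carrier M. \<zero>\<^bsub>R\<^esub>),
     add = (\<lambda>f g. \<lambda>x\<in>carrier M. f x \<oplus>\<^bsub>R\<^esub> g x),
     smult = (\<lambda>a f. \<lambda>x\<in>carrier M. a \<otimes>\<^bsub>R\<^esub> f x)\<rparr>"


section \<open>Generation, projectivity, trace\<close>

definition module_span ::
    "('a, 'r) ring_scheme \<Rightarrow> ('a, 'm) module \<Rightarrow> 'm set \<Rightarrow> 'm set"
  where "module_span R M S = (\<lambda>N. submodule N R M) hull S"

definition finitely_generated :: "('a, 'r) ring_scheme \<Rightarrow> ('a, 'm) module \<Rightarrow> bool"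
  where "finitely_generated R M \<longleftrightarrow>
    (\<exists>S. S \<subseteq> carrier M \<and> finite S \<and> module_span R M S = carrier M)"

definition countably_generated :: "('a, 'r) ring_scheme \<Rightarrow> ('a, 'm) module \<Rightarrow> bool"
  where "countably_generated R M \<longleftrightarrow>
    (\<exists>S. S \<subseteq> carrier M \<and> countable S \<and> module_span R M S = carrier M)"

text \<open>
  Projective modules are the direct summands of free modules. The types of the basis \<open>X\<close> and of
  the complement \<open>Q\<close> are no restriction: if \<open>P\<close> is a direct summand of some free module then
  the canonical epimorphism \<open>R\<^sup>(\<^sup>P\<^sup>) \<rightarrow> P\<close> splits.
\<close>

definition projective :: "('a, 'r) ring_scheme \<Rightarrow> ('a, 'm) module \<Rightarrow> bool"
  where "projective R P \<longleftrightarrow> right_module R P \<and>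
    (\<exists>(X :: 'm set) (Q :: ('a, 'm \<Rightarrow> 'a) module). right_module R Q \<and>
      module_isomorphic R (module_sum P Q) (module_power X (regular_module R)))"

text \<open>
  A sum of submodules is the submodule generated by their union; for the trace this is taken in
  the right module \<open>R\<close>.
\<close>

definition trace_ideal :: "('a, 'r) ring_scheme \<Rightarrow> ('a, 'm) module \<Rightarrow> 'a set"
  where "trace_ideal R M =
    module_span R (regular_module R) (\<Union>f \<in> module_hom R M (regular_module R). f ` carrier M)"

definition module_mult_ideal ::
    "('a, 'r) ring_scheme \<Rightarrow> ('a, 'm) module \<Rightarrow> 'a set \<Rightarrow> 'm set"
  where "module_mult_ideal R M I = module_span R M {a \<odot>\<^bsub>M\<^esub> x | a x. a \<in> I \<and> x \<in> carrier M}"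

definition internal_direct_sum ::
    "('a, 'r) ring_scheme \<Rightarrow> ('a, 'm) module \<Rightarrow> 'm set \<Rightarrow> 'm set \<Rightarrow> bool"
  where "internal_direct_sum R M A B \<longleftrightarrow>
    submodule A R M \<and> submodule B R M \<and> A \<inter> B = {\<zero>\<^bsub>M\<^esub>} \<and> A <+>\<^bsub>M\<^esub> B = carrier M"

definition indecomposable :: "('a, 'r) ring_scheme \<Rightarrow> ('a, 'm) module \<Rightarrow> bool"
  where "indecomposable R M \<longleftrightarrow> carrier M \<noteq> {\<zero>\<^bsub>M\<^esub>} \<and>
    (\<forall>A B. internal_direct_sum R M A B \<longrightarrow> A = {\<zero>\<^bsub>M\<^esub>} \<or> B = {\<zero>\<^bsub>M\<^esub>})"


section \<open>Semiperfect rings\<close>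

definition maximal_right_ideal :: "('a, 'r) ring_scheme \<Rightarrow> 'a set \<Rightarrow> bool"
  where "maximal_right_ideal R m \<longleftrightarrow>
    submodule m R (regular_module R) \<and> m \<noteq> carrier R \<and>
    (\<forall>K. submodule K R (regular_module R) \<and> m \<subseteq> K \<and> K \<noteq> carrier R \<longrightarrow> K = m)"

definition jacobson_radical :: "('a, 'r) ring_scheme \<Rightarrow> 'a set"
  where "jacobson_radical R = carrier R \<inter> \<Inter>{m. maximal_right_ideal R m}"

definition semisimple_module :: "('a, 'r) ring_scheme \<Rightarrow> ('a, 'm) module \<Rightarrow> bool"
  where "semisimple_module R M \<longleftrightarrow>
    (\<forall>A. submodule A R M \<longrightarrow> (\<exists>B. internal_direct_sum R M A B))"

definition semiperfect :: "('a, 'r) ring_scheme \<Rightarrow> bool"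
  where "semiperfect R \<longleftrightarrow> ring R \<and>
    (let Q = R Quot (jacobson_radical R) in
      semisimple_module Q (regular_module Q) \<and>
      (\<forall>x \<in> carrier Q. x \<otimes>\<^bsub>Q\<^esub> x = x \<longrightarrow>
        (\<exists>e \<in> carrier R. e \<otimes>\<^bsub>R\<^esub> e = e \<and> jacobson_radical R +>\<^bsub>R\<^esub> e = x)))"


section \<open>Monoids of isomorphism classes\<close>

text \<open>
  A countably generated right module is a quotient, and a projective one even isomorphic to a
  submodule, of \<open>R\<^sup>(\<^sup>\<nat>\<^sup>)\<close>. Hence modules whose carrier has type \<^typ>\<open>nat \<Rightarrow> 'a\<close> represent all
  isomorphism classes of countably generated projective modules. The class of a module \<open>M\<close> with
  carrier of any type is the set of its isomorphic copies in that type.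
\<close>

definition iso_class ::
    "('a, 'r) ring_scheme \<Rightarrow> ('a, 'm) module \<Rightarrow> ('a, nat \<Rightarrow> 'a) module set"
  where "iso_class R M = {N. right_module R N \<and> module_isomorphic R M N}"

text \<open>\<open>V_cg R\<close> is the monoid of countably generated projectives, \<open>V_fg R\<close> the submonoid of
  finitely generated ones. The left versions are \<open>V_cg (opp_ring R)\<close> and \<open>V_fg (opp_ring R)\<close>.\<close>

definition V_cg :: "('a, 'r) ring_scheme \<Rightarrow> ('a, nat \<Rightarrow> 'a) module set monoid"
  where "V_cg R =
    \<lparr>carrier = {iso_class R P | P :: ('a, nat \<Rightarrow> 'a) module.
                  projective R P \<and> countably_generated R P},
     monoid.mult = (\<lambda>X Y. iso_class R (module_sum (SOME P. P \<in> X) (SOME Q. Q \<in> Y))),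
     one = iso_class R (module_power ({} :: nat set) (regular_module R))\<rparr>"

definition V_fg :: "('a, 'r) ring_scheme \<Rightarrow> ('a, nat \<Rightarrow> 'a) module set monoid"
  where "V_fg R = (V_cg R)
    \<lparr>carrier := {iso_class R P | P :: ('a, nat \<Rightarrow> 'a) module.
                  projective R P \<and> finitely_generated R P}\<rparr>"

text \<open>Indecomposable projective modules are countably generated by Kaplansky's theorem, so that
  no isomorphism class is missing here either.\<close>

definition indecomposable_projectives ::
    "('a, 'r) ring_scheme \<Rightarrow> ('a, nat \<Rightarrow> 'a) module set set"
  where "indecomposable_projectives R =
    {iso_class R P | P :: ('a, nat \<Rightarrow> 'a) module. projective R P \<and> indecomposable R P}"

definition relatively_big :: "('a, 'r) ring_scheme \<Rightarrow> ('a, 'm) module \<Rightarrow> bool"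
  where "relatively_big R P \<longleftrightarrow> projective R P \<and> countably_generated R P \<and>
    (\<exists>P' :: ('a, nat \<Rightarrow> 'a) module. projective R P' \<and> countably_generated R P' \<and>
      module_isomorphic R (module_sum P (module_power (UNIV :: nat set) P')) P \<and>
      finitely_generated R (quotient_module P (module_mult_ideal R P (trace_ideal R P'))))"

definition B_big :: "('a, 'r) ring_scheme \<Rightarrow> ('a, nat \<Rightarrow> 'a) module set set"
  where "B_big R = {iso_class R P | P :: ('a, nat \<Rightarrow> 'a) module.
    relatively_big R P \<and> \<not> finitely_generated R P}"

definition fg_mod_ideal :: "('a, 'r) ring_scheme \<Rightarrow> ('a, 'm) module \<Rightarrow> 'a set \<Rightarrow> bool"
  where "fg_mod_ideal R P I \<longleftrightarrow>
    ideal I R \<and> finitely_generated R (quotient_module P (module_mult_ideal R P I))"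

definition additive_monoid :: "'b::comm_monoid_add monoid"
  where "additive_monoid = \<lparr>carrier = UNIV, monoid.mult = (+), one = 0\<rparr>"

end

theory Submission
  imports Defs
begin

text \<open>
  Let \<open>R\<close> be semiperfect. A \<^emph>\<open>basic set\<close> \<open>E\<close> consists of finitely many local idempotents \<open>e\<close>
  whose modules \<open>e R\<close> are pairwise non-isomorphic and for which \<open>1\<close> lies in \<open>\<Sum> R e R\<close>. It exists
  because a maximal right ideal containing all \<open>R e R\<close> with \<open>e\<close> local would have a complement modulo
  the radical, generated by an idempotent that lifts to a local one (\<open>semiperfect_basic_set\<close>).
  The conditions on \<open>E\<close> are left-right symmetric, so the same \<open>E\<close> serves left modules.

  For a projective module \<open>P\<close> consider families of elements \<open>y s \<in> P e\<^sub>s\<close> and homomorphisms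
  \<open>g s : P \<rightarrow> e\<^sub>s R\<close> that are biorthogonal, \<open>g s (y t) = \<delta> e\<^sub>s\<close>. A finite one splits off the direct
  sum of the \<open>e\<^sub>s R\<close>. Everything rests on one theorem: each element \<open>x\<close> of \<open>P\<close> lies in the span of
  a finite biorthogonal family, which may be chosen to extend a given one
  (\<open>biorthogonal_set_extend_spanning\<close>). This is Kaplansky's argument: among all expressions
  \<open>x = \<Sum> y\<^sub>k f\<^sub>k(x)\<close> of this type a shortest one has a matrix \<open>f\<^sub>k(y\<^sub>j)\<close> that is the identity
  modulo the radical, since any other entry would let one summand be expressed by the others;
  a Gram-Schmidt process then makes it biorthogonal.

  Exhausting a countable generating set shows that a countably generated \<open>P\<close> has a \<^emph>\<open>frame\<close>, that
  is, \<open>P\<close> is a direct sum of modules \<open>e\<^sub>s R\<close>. How often \<open>e\<close> occurs is determined by \<open>P\<close>: it is the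
  largest number of copies of \<open>e R\<close> that split off, by a rank inequality for matrices over the
  local ring \<open>e R e\<close> (\<open>multiplicity_frame\<close>). Hence the multiplicities \<open>E \<rightarrow> {0,1,...,\<infinity>}\<close> classify
  countably generated projectives, they are additive, and they are finite exactly for the finitely
  generated ones. The dual of a module with a finite frame has the frame in which the elements and
  the functionals are exchanged, over the opposite ring and with the same idempotents; therefore
  matching multiplicities on both sides extends the duality of finitely generated projectives.

  For an arbitrary projective \<open>P\<close> let \<open>D\<close> be the set of \<open>e \<in> E\<close> of infinite multiplicity, and let
  \<open>I\<close> be the trace of the direct sum of the \<open>e R\<close> with \<open>e \<in> D\<close>. A biorthogonal family of maximal
  size with idempotents outside \<open>D\<close> generates \<open>P\<close> modulo \<open>P I\<close>. If conversely \<open>P/P J\<close> is finitely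
  generated, then for \<open>e \<in> D\<close> there are enough copies of \<open>e R\<close> in \<open>P\<close> to find one such that the
  projection onto it kills the finitely many generators, which forces \<open>e \<in> J\<close>. So \<open>I\<close> is the least ideal with
  finitely generated quotient. Since adding infinitely many copies of the \<open>e R\<close> with \<open>e \<in> D\<close> does not
  change the multiplicities of \<open>P\<close>, a countably generated \<open>P\<close> is relatively big.
\<close>


section \<open>Right modules and their homomorphisms\<close>

context right_module
begin

lemma smult_l_null [simp]:
  assumes "x \<in> carrier M" shows "\<zero> \<odot>\<^bsub>M\<^esub> x = \<zero>\<^bsub>M\<^esub>"
proof -
  have "\<zero> \<odot>\<^bsub>M\<^esub> x \<oplus>\<^bsub>M\<^esub> \<zero> \<odot>\<^bsub>M\<^esub> x = \<zero> \<odot>\<^bsub>M\<^esub> x"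
    using assms by (simp flip: smult_l_distr)
  then show ?thesis
    using M.add.l_cancel_one[of "\<zero> \<odot>\<^bsub>M\<^esub> x" "\<zero> \<odot>\<^bsub>M\<^esub> x"] assms by simp
qed

lemma smult_r_null [simp]:
  assumes "a \<in> carrier R" shows "a \<odot>\<^bsub>M\<^esub> \<zero>\<^bsub>M\<^esub> = \<zero>\<^bsub>M\<^esub>"
proof -
  have "a \<odot>\<^bsub>M\<^esub> \<zero>\<^bsub>M\<^esub> \<oplus>\<^bsub>M\<^esub> a \<odot>\<^bsub>M\<^esub> \<zero>\<^bsub>M\<^esub> = a \<odot>\<^bsub>M\<^esub> \<zero>\<^bsub>M\<^esub>"
    using assms by (simp flip: smult_r_distr)
  then show ?thesis
    using M.add.l_cancel_one[of "a \<odot>\<^bsub>M\<^esub> \<zero>\<^bsub>M\<^esub>" "a \<odot>\<^bsub>M\<^esub> \<zero>\<^bsub>M\<^esub>"] assms by simp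
qed

lemma smult_l_minus:
  assumes "a \<in> carrier R" "x \<in> carrier M"
  shows "(\<ominus> a) \<odot>\<^bsub>M\<^esub> x = \<ominus>\<^bsub>M\<^esub> (a \<odot>\<^bsub>M\<^esub> x)"
proof -
  have "(\<ominus> a) \<odot>\<^bsub>M\<^esub> x \<oplus>\<^bsub>M\<^esub> a \<odot>\<^bsub>M\<^esub> x = \<zero>\<^bsub>M\<^esub>"
    using assms by (simp flip: smult_l_distr add: R.l_neg)
  then show ?thesis using assms M.minus_equality[of "(\<ominus> a) \<odot>\<^bsub>M\<^esub> x" "a \<odot>\<^bsub>M\<^esub> x"] by simp
qed

lemma smult_r_minus:
  assumes "a \<in> carrier R" "x \<in> carrier M"
  shows "a \<odot>\<^bsub>M\<^esub> (\<ominus>\<^bsub>M\<^esub> x) = \<ominus>\<^bsub>M\<^esub> (a \<odot>\<^bsub>M\<^esub> x)"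
proof -
  have "a \<odot>\<^bsub>M\<^esub> (\<ominus>\<^bsub>M\<^esub> x) \<oplus>\<^bsub>M\<^esub> a \<odot>\<^bsub>M\<^esub> x = \<zero>\<^bsub>M\<^esub>"
    using assms by (simp flip: smult_r_distr add: M.l_neg)
  then show ?thesis using assms M.minus_equality[of "a \<odot>\<^bsub>M\<^esub> (\<ominus>\<^bsub>M\<^esub> x)" "a \<odot>\<^bsub>M\<^esub> x"] by simp
qed

lemma smult_finsum:
  assumes "a \<in> carrier R" "f \<in> F \<rightarrow> carrier M"
  shows "a \<odot>\<^bsub>M\<^esub> (\<Oplus>\<^bsub>M\<^esub>i\<in>F. f i) = (\<Oplus>\<^bsub>M\<^esub>i\<in>F. a \<odot>\<^bsub>M\<^esub> f i)"
  using assms(2)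
proof (induction F rule: infinite_finite_induct)
  case (insert i F)
  then have "f i \<in> carrier M" "f \<in> F \<rightarrow> carrier M" by auto
  with insert assms(1) show ?case
    by (simp add: smult_r_distr Pi_iff)
qed (use assms in simp_all)

lemma finsum_smult:
  assumes "x \<in> carrier M" "f \<in> F \<rightarrow> carrier R"
  shows "(\<Oplus>i\<in>F. f i) \<odot>\<^bsub>M\<^esub> x = (\<Oplus>\<^bsub>M\<^esub>i\<in>F. f i \<odot>\<^bsub>M\<^esub> x)"
  using assms(2)
proof (induction F rule: infinite_finite_induct)
  case (insert i F)
  then have "f i \<in> carrier R" "f \<in> F \<rightarrow> carrier R" by auto
  with insert assms(1) show ?case
    by (simp add: smult_l_distr Pi_iff)
qed (use assms in simp_all)

text \<open>
  Closure under negatives comes from scalar multiplication by \<open>- 1\<close>.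
\<close>

lemma submodule_iff:
  "submodule H R M \<longleftrightarrow> H \<subseteq> carrier M \<and> \<zero>\<^bsub>M\<^esub> \<in> H \<and>
     (\<forall>x\<in>H. \<forall>y\<in>H. x \<oplus>\<^bsub>M\<^esub> y \<in> H) \<and> (\<forall>a\<in>carrier R. \<forall>x\<in>H. a \<odot>\<^bsub>M\<^esub> x \<in> H)"
proof
  assume "submodule H R M"
  then interpret submodule H R M .
  show "H \<subseteq> carrier M \<and> \<zero>\<^bsub>M\<^esub> \<in> H \<and>
     (\<forall>x\<in>H. \<forall>y\<in>H. x \<oplus>\<^bsub>M\<^esub> y \<in> H) \<and> (\<forall>a\<in>carrier R. \<forall>x\<in>H. a \<odot>\<^bsub>M\<^esub> x \<in> H)"
    using subset m_closed one_closed smult_closed by auto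
next
  assume *: "H \<subseteq> carrier M \<and> \<zero>\<^bsub>M\<^esub> \<in> H \<and>
     (\<forall>x\<in>H. \<forall>y\<in>H. x \<oplus>\<^bsub>M\<^esub> y \<in> H) \<and> (\<forall>a\<in>carrier R. \<forall>x\<in>H. a \<odot>\<^bsub>M\<^esub> x \<in> H)"
  have "\<ominus>\<^bsub>M\<^esub> x \<in> H" if "x \<in> H" for x
  proof -
    have "(\<ominus> \<one>) \<odot>\<^bsub>M\<^esub> x \<in> H" "x \<in> carrier M" using * that by auto
    then show ?thesis by (simp add: smult_l_minus)
  qed
  with * show "submodule H R M"
    by (intro submodule.intro subgroup.intro submodule_axioms.intro) (auto simp: a_inv_def)
qed

lemma submodule_carrier: "submodule (carrier M) R M"
  by (auto simp: submodule_iff)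

lemma submodule_minus_closed:
  assumes "submodule H R M" "x \<in> H" "y \<in> H" shows "x \<ominus>\<^bsub>M\<^esub> y \<in> H"
proof -
  have "(\<ominus> \<one>) \<odot>\<^bsub>M\<^esub> y \<in> H" "y \<in> carrier M" using assms unfolding submodule_iff by auto
  then have "\<ominus>\<^bsub>M\<^esub> y \<in> H" by (simp add: smult_l_minus)
  then show ?thesis using assms unfolding submodule_iff a_minus_def by auto
qed

lemma submodule_finsum_closed:
  assumes "submodule H R M" "f \<in> F \<rightarrow> H" shows "(\<Oplus>\<^bsub>M\<^esub>i\<in>F. f i) \<in> H"
  using assms(2)
proof (induction F rule: infinite_finite_induct)
  case (insert i F)
  have "f \<in> F \<rightarrow> carrier M" "f i \<in> carrier M" "f i \<in> H"
    using insert.prems assms(1) unfolding submodule_iff by auto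
  then show ?case using insert assms(1) unfolding submodule_iff by auto
qed (use assms(1) in \<open>simp_all add: submodule_iff\<close>)

end

lemma module_span_minimal:
  "S \<subseteq> H \<Longrightarrow> submodule H R M \<Longrightarrow> module_span R M S \<subseteq> H"
  unfolding module_span_def by (rule hull_minimal)

lemma module_span_superset: "S \<subseteq> module_span R M S"
  unfolding module_span_def by (rule hull_subset)

lemma submodule_module_span:
  fixes M :: "('a, 'm) module"
  assumes "right_module R M" "S \<subseteq> carrier M"
  shows "submodule (module_span R M S) R M"
proof -
  interpret right_module R M by fact
  have "module_span R M S \<subseteq> carrier M"
    by (rule module_span_minimal[OF assms(2) submodule_carrier])
  moreover have "module_span R M S = \<Inter>{H. submodule H R M \<and> S \<subseteq> H}"
    by (simp add: module_span_def hull_def)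
  ultimately show ?thesis by (simp add: submodule_iff)
qed

lemma module_span_eq_carrier_iff:
  fixes M :: "('a, 'm) module"
  assumes "right_module R M" "S \<subseteq> carrier M"
  shows "module_span R M S = carrier M \<longleftrightarrow>
    (\<forall>H. submodule H R M \<longrightarrow> S \<subseteq> H \<longrightarrow> H = carrier M)" (is "?L = ?R")
proof -
  interpret right_module R M by fact
  have sub: "submodule (module_span R M S) R M" using assms by (rule submodule_module_span)
  show ?thesis
  proof
    assume L: ?L
    show ?R
    proof (intro allI impI)
      fix H assume "submodule H R M" "S \<subseteq> H"
      then have "carrier M \<subseteq> H" "H \<subseteq> carrier M"
        using module_span_minimal[of S H R M] L by (simp_all add: submodule_iff)
      then show "H = carrier M" by simp
    qed
  next
    assume ?R
    then show ?L using sub module_span_superset[of S R M] by simp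
  qed
qed

lemma module_homI:
  assumes "\<And>x. x \<in> carrier M \<Longrightarrow> f x \<in> carrier N"
    and "\<And>x y. x \<in> carrier M \<Longrightarrow> y \<in> carrier M \<Longrightarrow> f (x \<oplus>\<^bsub>M\<^esub> y) = f x \<oplus>\<^bsub>N\<^esub> f y"
    and "\<And>a x. a \<in> carrier R \<Longrightarrow> x \<in> carrier M \<Longrightarrow> f (a \<odot>\<^bsub>M\<^esub> x) = a \<odot>\<^bsub>N\<^esub> f x"
  shows "f \<in> module_hom R M N"
  using assms unfolding module_hom_def by auto

lemma module_hom_closed: "f \<in> module_hom R M N \<Longrightarrow> x \<in> carrier M \<Longrightarrow> f x \<in> carrier N"
  and module_hom_add: "f \<in> module_hom R M N \<Longrightarrow> x \<in> carrier M \<Longrightarrow> y \<in> carrier M \<Longrightarrow>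
    f (x \<oplus>\<^bsub>M\<^esub> y) = f x \<oplus>\<^bsub>N\<^esub> f y"
  and module_hom_smult: "f \<in> module_hom R M N \<Longrightarrow> a \<in> carrier R \<Longrightarrow> x \<in> carrier M \<Longrightarrow>
    f (a \<odot>\<^bsub>M\<^esub> x) = a \<odot>\<^bsub>N\<^esub> f x"
  unfolding module_hom_def by auto

lemma module_hom_zero:
  assumes "right_module R M" "right_module R N" "f \<in> module_hom R M N"
  shows "f \<zero>\<^bsub>M\<^esub> = \<zero>\<^bsub>N\<^esub>"
proof -
  interpret M: right_module R M by fact
  interpret N: right_module R N by fact
  have "f \<zero>\<^bsub>M\<^esub> = f (\<zero>\<^bsub>R\<^esub> \<odot>\<^bsub>M\<^esub> \<zero>\<^bsub>M\<^esub>)" by simp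
  also have "\<dots> = \<zero>\<^bsub>R\<^esub> \<odot>\<^bsub>N\<^esub> f \<zero>\<^bsub>M\<^esub>"
    by (rule module_hom_smult[OF assms(3)]) auto
  finally show ?thesis using module_hom_closed[OF assms(3)] by simp
qed

lemma module_hom_comp:
  "f \<in> module_hom R L M \<Longrightarrow> g \<in> module_hom R M N \<Longrightarrow> (\<lambda>x. g (f x)) \<in> module_hom R L N"
  by (intro module_homI) (simp_all add: module_hom_closed module_hom_add module_hom_smult)

lemma module_isomorphic_refl: "module_isomorphic R M M"
  unfolding module_isomorphic_def
  by (rule bexI[of _ "\<lambda>x. x"]) (auto simp: module_hom_def bij_betw_def)

lemma module_isomorphic_trans:
  assumes "module_isomorphic R L M" "module_isomorphic R M N"
  shows "module_isomorphic R L N"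
proof -
  obtain f g where fg: "f \<in> module_hom R L M" "bij_betw f (carrier L) (carrier M)"
    "g \<in> module_hom R M N" "bij_betw g (carrier M) (carrier N)"
    using assms unfolding module_isomorphic_def by blast
  then have "bij_betw (\<lambda>x. g (f x)) (carrier L) (carrier N)"
    using bij_betw_trans[of f "carrier L" "carrier M" g] by (simp add: comp_def)
  with module_hom_comp[OF fg(1,3)] show ?thesis
    unfolding module_isomorphic_def by blast
qed

lemma module_hom_inverse:
  assumes "right_module R M" "f \<in> module_hom R M N" "bij_betw f (carrier M) (carrier N)"
  shows "inv_into (carrier M) f \<in> module_hom R N M"
    and "bij_betw (inv_into (carrier M) f) (carrier N) (carrier M)"
proof -
  interpret M: right_module R M by fact
  let ?g = "inv_into (carrier M) f"
  have inj: "inj_on f (carrier M)" and surj: "f ` carrier M = carrier N"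
    using assms(3) by (auto simp: bij_betw_def)
  have fg: "f (?g y) = y" "?g y \<in> carrier M" if "y \<in> carrier N" for y
    using that surj by (auto simp: f_inv_into_f inv_into_into)
  show "?g \<in> module_hom R N M"
  proof (rule module_homI)
    fix x y assume "x \<in> carrier N" "y \<in> carrier N"
    then show "?g (x \<oplus>\<^bsub>N\<^esub> y) = ?g x \<oplus>\<^bsub>M\<^esub> ?g y"
      by (intro inv_into_f_eq[OF inj]) (simp_all add: fg module_hom_add[OF assms(2)])
  next
    fix a y assume "a \<in> carrier R" "y \<in> carrier N"
    then show "?g (a \<odot>\<^bsub>N\<^esub> y) = a \<odot>\<^bsub>M\<^esub> ?g y"
      by (intro inv_into_f_eq[OF inj]) (simp_all add: fg module_hom_smult[OF assms(2)])
  qed (rule fg)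
  show "bij_betw ?g (carrier N) (carrier M)" using assms(3) by (rule bij_betw_inv_into)
qed

lemma module_isomorphic_sym:
  "right_module R M \<Longrightarrow> module_isomorphic R M N \<Longrightarrow> module_isomorphic R N M"
  unfolding module_isomorphic_def by (meson module_hom_inverse)

lemma right_moduleI:
  assumes "ring R" "abelian_group M"
    and "\<And>a x. a \<in> carrier R \<Longrightarrow> x \<in> carrier M \<Longrightarrow> a \<odot>\<^bsub>M\<^esub> x \<in> carrier M"
    and "\<And>a b x. a \<in> carrier R \<Longrightarrow> b \<in> carrier R \<Longrightarrow> x \<in> carrier M \<Longrightarrow>
        (a \<oplus>\<^bsub>R\<^esub> b) \<odot>\<^bsub>M\<^esub> x = a \<odot>\<^bsub>M\<^esub> x \<oplus>\<^bsub>M\<^esub> b \<odot>\<^bsub>M\<^esub> x"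
    and "\<And>a x y. a \<in> carrier R \<Longrightarrow> x \<in> carrier M \<Longrightarrow> y \<in> carrier M \<Longrightarrow>
        a \<odot>\<^bsub>M\<^esub> (x \<oplus>\<^bsub>M\<^esub> y) = a \<odot>\<^bsub>M\<^esub> x \<oplus>\<^bsub>M\<^esub> a \<odot>\<^bsub>M\<^esub> y"
    and "\<And>a b x. a \<in> carrier R \<Longrightarrow> b \<in> carrier R \<Longrightarrow> x \<in> carrier M \<Longrightarrow>
        (a \<otimes>\<^bsub>R\<^esub> b) \<odot>\<^bsub>M\<^esub> x = b \<odot>\<^bsub>M\<^esub> (a \<odot>\<^bsub>M\<^esub> x)"
    and "\<And>x. x \<in> carrier M \<Longrightarrow> \<one>\<^bsub>R\<^esub> \<odot>\<^bsub>M\<^esub> x = x"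
  shows "right_module R M"
  using assms by (simp add: right_module_def right_module_axioms_def)

lemma regular_module_simps [simp]:
  "carrier (regular_module R) = carrier R"
  "\<zero>\<^bsub>regular_module R\<^esub> = \<zero>\<^bsub>R\<^esub>"
  "x \<oplus>\<^bsub>regular_module R\<^esub> y = x \<oplus>\<^bsub>R\<^esub> y"
  "a \<odot>\<^bsub>regular_module R\<^esub> x = x \<otimes>\<^bsub>R\<^esub> a"
  by (simp_all add: regular_module_def)

lemma right_module_regular_module:
  assumes "ring R" shows "right_module R (regular_module R)"
proof -
  interpret ring R by fact
  show ?thesis
    by (intro right_moduleI assms abelian_groupI)
      (auto simp: a_ac l_distr r_distr m_assoc intro: l_neg a_inv_closed)
qed

abbreviation functionals :: "('a, 'r) ring_scheme \<Rightarrow> ('a, 'm, 's) module_scheme \<Rightarrow> ('m \<Rightarrow> 'a) set"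
  where "functionals R M \<equiv> module_hom R M (regular_module R)"

context right_module
begin

lemma functional_closed [simp]: "f \<in> functionals R M \<Longrightarrow> x \<in> carrier M \<Longrightarrow> f x \<in> carrier R"
  using module_hom_closed[of f R M "regular_module R" x] by simp

lemma functional_add:
  "f \<in> functionals R M \<Longrightarrow> x \<in> carrier M \<Longrightarrow> y \<in> carrier M \<Longrightarrow> f (x \<oplus>\<^bsub>M\<^esub> y) = f x \<oplus> f y"
  using module_hom_add[of f R M "regular_module R"] by simp

lemma functional_smult:
  "f \<in> functionals R M \<Longrightarrow> a \<in> carrier R \<Longrightarrow> x \<in> carrier M \<Longrightarrow> f (a \<odot>\<^bsub>M\<^esub> x) = f x \<otimes> a"
  using module_hom_smult[of f R M "regular_module R"] by simp

lemma functional_zero: "f \<in> functionals R M \<Longrightarrow> f \<zero>\<^bsub>M\<^esub> = \<zero>"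
  using module_hom_zero[of R M "regular_module R" f] right_module_regular_module[OF R.ring_axioms]
    right_module_axioms by simp

lemma functional_minus:
  assumes "f \<in> functionals R M" "x \<in> carrier M" "y \<in> carrier M"
  shows "f (x \<ominus>\<^bsub>M\<^esub> y) = f x \<ominus> f y"
proof -
  have "f (\<ominus>\<^bsub>M\<^esub> y) = f ((\<ominus> \<one>) \<odot>\<^bsub>M\<^esub> y)" using assms by (simp add: smult_l_minus)
  also have "\<dots> = \<ominus> f y" using assms by (simp add: functional_smult R.r_minus)
  finally show ?thesis using assms by (simp add: a_minus_def functional_add)
qed

lemma functional_finsum:
  assumes "f \<in> functionals R M" "h \<in> F \<rightarrow> carrier M"
  shows "f (\<Oplus>\<^bsub>M\<^esub>i\<in>F. h i) = (\<Oplus>i\<in>F. f (h i))"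
  using assms(2)
proof (induction F rule: infinite_finite_induct)
  case (insert i F)
  have "h \<in> F \<rightarrow> carrier M" "h i \<in> carrier M" using insert.prems by auto
  then show ?case using insert assms(1) by (simp add: functional_add Pi_iff)
qed (use assms(1) in \<open>simp_all add: functional_zero\<close>)

lemma functionalI:
  assumes "\<And>x. x \<in> carrier M \<Longrightarrow> f x \<in> carrier R"
    and "\<And>x y. x \<in> carrier M \<Longrightarrow> y \<in> carrier M \<Longrightarrow> f (x \<oplus>\<^bsub>M\<^esub> y) = f x \<oplus> f y"
    and "\<And>a x. a \<in> carrier R \<Longrightarrow> x \<in> carrier M \<Longrightarrow> f (a \<odot>\<^bsub>M\<^esub> x) = f x \<otimes> a"
  shows "f \<in> functionals R M"
  using assms by (intro module_homI) auto

lemma functional_scale: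
  assumes "f \<in> functionals R M" "a \<in> carrier R"
  shows "(\<lambda>x. a \<otimes> f x) \<in> functionals R M"
  using assms by (intro functionalI) (auto simp: functional_add functional_smult r_distr m_assoc)

end


section \<open>Biorthogonal families\<close>

text \<open>
  The pair \<open>y s\<close>, \<open>g s\<close> amounts to homomorphisms \<open>e\<^sub>s R \<rightarrow> M\<close> and \<open>M \<rightarrow> e\<^sub>s R\<close>. That their composites
  form the identity matrix makes the direct sum of the \<open>e\<^sub>s R\<close>, for a finite family, a direct
  summand of \<open>M\<close>.
\<close>

locale biorthogonal = right_module R M
  for R :: "('a, 'r) ring_scheme" (structure) and M :: "('a, 'm) module" +
  fixes A :: "'i set" and e :: "'i \<Rightarrow> 'a" and y :: "'i \<Rightarrow> 'm" and g :: "'i \<Rightarrow> 'm \<Rightarrow> 'a"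
  assumes e_closed [simp]: "s \<in> A \<Longrightarrow> e s \<in> carrier R"
    and y_closed [simp]: "s \<in> A \<Longrightarrow> y s \<in> carrier M"
    and smult_e_y: "s \<in> A \<Longrightarrow> e s \<odot>\<^bsub>M\<^esub> y s = y s"
    and functional_g: "s \<in> A \<Longrightarrow> g s \<in> functionals R M"
    and mult_e_g: "s \<in> A \<Longrightarrow> x \<in> carrier M \<Longrightarrow> e s \<otimes> g s x = g s x"
    and g_y_same: "s \<in> A \<Longrightarrow> g s (y s) = e s"
    and g_y_other: "s \<in> A \<Longrightarrow> t \<in> A \<Longrightarrow> s \<noteq> t \<Longrightarrow> g s (y t) = \<zero>"
begin

lemma g_closed [simp]: "s \<in> A \<Longrightarrow> x \<in> carrier M \<Longrightarrow> g s x \<in> carrier R"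
  using functional_g functional_closed by blast

lemma e_idem: "s \<in> A \<Longrightarrow> e s \<otimes> e s = e s"
  using mult_e_g[of s "y s"] g_y_same[of s] by simp

lemma g_y: "s \<in> A \<Longrightarrow> t \<in> A \<Longrightarrow> g s (y t) = (if s = t then e s else \<zero>)"
  using g_y_same g_y_other by auto

definition component :: "'i set \<Rightarrow> 'm \<Rightarrow> 'm"
  where "component F x = (\<Oplus>\<^bsub>M\<^esub>s\<in>F. g s x \<odot>\<^bsub>M\<^esub> y s)"

lemma component_closed [simp]: "F \<subseteq> A \<Longrightarrow> x \<in> carrier M \<Longrightarrow> component F x \<in> carrier M"
  unfolding component_def by (intro M.finsum_closed) auto

lemma component_add:
  assumes "F \<subseteq> A" "x \<in> carrier M" "x' \<in> carrier M"
  shows "component F (x \<oplus>\<^bsub>M\<^esub> x') = component F x \<oplus>\<^bsub>M\<^esub> component F x'"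
proof -
  have "component F (x \<oplus>\<^bsub>M\<^esub> x') = (\<Oplus>\<^bsub>M\<^esub>s\<in>F. g s x \<odot>\<^bsub>M\<^esub> y s \<oplus>\<^bsub>M\<^esub> g s x' \<odot>\<^bsub>M\<^esub> y s)"
    unfolding component_def using assms
    by (intro M.finsum_cong') (auto simp: functional_g functional_add smult_l_distr subset_iff)
  then show ?thesis unfolding component_def using assms
    by (subst M.finsum_addf[symmetric]) (auto simp: subset_iff)
qed

lemma component_smult:
  assumes "F \<subseteq> A" "a \<in> carrier R" "x \<in> carrier M"
  shows "component F (a \<odot>\<^bsub>M\<^esub> x) = a \<odot>\<^bsub>M\<^esub> component F x"
  unfolding component_def using assms
  by (subst smult_finsum)
     (auto intro!: M.finsum_cong' simp: functional_g functional_smult smult_assoc subset_iff)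

lemma g_sum:
  assumes "finite F" "F \<subseteq> A" "t \<in> A" "c \<in> F \<rightarrow> carrier R"
  shows "g t (\<Oplus>\<^bsub>M\<^esub>s\<in>F. c s \<odot>\<^bsub>M\<^esub> y s) = (if t \<in> F then e t \<otimes> c t else \<zero>)"
proof -
  have "g t (\<Oplus>\<^bsub>M\<^esub>s\<in>F. c s \<odot>\<^bsub>M\<^esub> y s) = (\<Oplus>s\<in>F. g t (c s \<odot>\<^bsub>M\<^esub> y s))"
    using assms by (intro functional_finsum functional_g) (auto simp: Pi_iff subset_iff)
  also have "\<dots> = (\<Oplus>s\<in>F. if t = s then e s \<otimes> c s else \<zero>)"
    using assms by (intro R.finsum_cong') (auto simp: functional_g functional_smult g_y subset_iff Pi_iff)
  also have "\<dots> = (if t \<in> F then e t \<otimes> c t else \<zero>)"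
  proof (cases "t \<in> F")
    case True
    then show ?thesis
      using assms R.finsum_singleton[of t F "\<lambda>s. e s \<otimes> c s"] by (auto simp: Pi_iff subset_iff)
  next
    case False
    then have "(\<Oplus>s\<in>F. if t = s then e s \<otimes> c s else \<zero>) = (\<Oplus>s\<in>F. \<zero>)"
      by (intro R.finsum_cong') auto
    with False show ?thesis by simp
  qed
  finally show ?thesis .
qed

lemma g_component:
  assumes "finite F" "F \<subseteq> A" "t \<in> A" "x \<in> carrier M"
  shows "g t (component F x) = (if t \<in> F then g t x else \<zero>)"
  unfolding component_def using assms by (subst g_sum) (auto simp: mult_e_g)

text \<open>
  A functional \<open>g s\<close> with \<open>s \<notin> F\<close> kills every \<open>y t\<close> with \<open>t \<in> F\<close>, hence kills \<open>x\<close>.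
\<close>

lemma component_mono:
  assumes "finite F'" "F \<subseteq> F'" "F' \<subseteq> A" "x \<in> carrier M" "component F x = x"
  shows "component F' x = x"
proof -
  have F: "finite F" "F \<subseteq> A" using assms finite_subset by auto
  have "g s x \<odot>\<^bsub>M\<^esub> y s = \<zero>\<^bsub>M\<^esub>" if "s \<in> F' - F" for s
    using g_component[OF F, of s x] that assms by auto
  then have "component F' x = component F x"
    unfolding component_def using assms
    by (intro M.add.finprod_mono_neutral_cong_right) auto
  with assms show ?thesis by simp
qed

definition spanned :: "'m set"
  where "spanned = {x \<in> carrier M. \<exists>F. finite F \<and> F \<subseteq> A \<and> component F x = x}"

lemma submodule_spanned: "submodule spanned R M"
proof -
  have "component {} \<zero>\<^bsub>M\<^esub> = \<zero>\<^bsub>M\<^esub>" by (simp add: component_def)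
  then have "\<zero>\<^bsub>M\<^esub> \<in> spanned" unfolding spanned_def by fastforce
  moreover have "x \<oplus>\<^bsub>M\<^esub> x' \<in> spanned" if "x \<in> spanned" "x' \<in> spanned" for x x'
  proof -
    obtain F F' where F: "finite F" "F \<subseteq> A" "component F x = x" "x \<in> carrier M"
      "finite F'" "F' \<subseteq> A" "component F' x' = x'" "x' \<in> carrier M"
      using \<open>x \<in> spanned\<close> \<open>x' \<in> spanned\<close> unfolding spanned_def by blast
    then have "component (F \<union> F') x = x" "component (F \<union> F') x' = x'"
      using component_mono[of "F \<union> F'" F x] component_mono[of "F \<union> F'" F' x'] by auto
    then have "component (F \<union> F') (x \<oplus>\<^bsub>M\<^esub> x') = x \<oplus>\<^bsub>M\<^esub> x'"
      using F by (simp add: component_add)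
    then show ?thesis unfolding spanned_def using F by (auto intro!: exI[of _ "F \<union> F'"])
  qed
  moreover have "a \<odot>\<^bsub>M\<^esub> x \<in> spanned" if "a \<in> carrier R" "x \<in> spanned" for a x
    using that unfolding spanned_def by (auto simp: component_smult)
  ultimately show ?thesis unfolding submodule_iff spanned_def by auto
qed

lemma y_in_spanned: "s \<in> A \<Longrightarrow> y s \<in> spanned"
proof -
  assume s: "s \<in> A"
  then have "component {s} (y s) = y s" by (simp add: component_def g_y_same smult_e_y)
  with s show ?thesis unfolding spanned_def by (auto intro!: exI[of _ "{s}"])
qed

end


section \<open>Local idempotents\<close>

text \<open>
  The Peirce component \<open>e R f\<close>, which is \<open>Hom(f R, e R)\<close>.
\<close>

definition corner :: "('a, 'r) ring_scheme \<Rightarrow> 'a \<Rightarrow> 'a \<Rightarrow> 'a set"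
  where "corner R e f = {a \<in> carrier R. e \<otimes>\<^bsub>R\<^esub> a = a \<and> a \<otimes>\<^bsub>R\<^esub> f = a}"

text \<open>
  For local idempotents these are the non-isomorphisms \<open>f R \<rightarrow> e R\<close>, the elements of \<open>e J f\<close> with
  \<open>J\<close> the Jacobson radical. The definition by inverses refers to \<open>e\<close> and \<open>f\<close> alone and can be
  compared directly with the one for the opposite ring.
\<close>

definition corner_radical :: "('a, 'r) ring_scheme \<Rightarrow> 'a \<Rightarrow> 'a \<Rightarrow> 'a set"
  where "corner_radical R e f = {a \<in> corner R e f. \<forall>b \<in> corner R f e. a \<otimes>\<^bsub>R\<^esub> b \<noteq> e}"

text \<open>
  The last clause says that the ring \<open>e R e\<close> is local: of two elements with sum \<open>e\<close> one is a unit.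
\<close>

definition local_idempotent :: "('a, 'r) ring_scheme \<Rightarrow> 'a \<Rightarrow> bool"
  where "local_idempotent R e \<longleftrightarrow> e \<in> carrier R \<and> e \<otimes>\<^bsub>R\<^esub> e = e \<and> e \<noteq> \<zero>\<^bsub>R\<^esub> \<and>
    (\<forall>a \<in> corner R e e. \<exists>b \<in> corner R e e.
       a \<otimes>\<^bsub>R\<^esub> b = e \<and> b \<otimes>\<^bsub>R\<^esub> a = e \<or> (e \<ominus>\<^bsub>R\<^esub> a) \<otimes>\<^bsub>R\<^esub> b = e \<and> b \<otimes>\<^bsub>R\<^esub> (e \<ominus>\<^bsub>R\<^esub> a) = e)"

context ring
begin

lemma cornerI: "a \<in> carrier R \<Longrightarrow> e \<otimes> a = a \<Longrightarrow> a \<otimes> f = a \<Longrightarrow> a \<in> corner R e f"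
  by (simp add: corner_def)

lemma corner_closed: "a \<in> corner R e f \<Longrightarrow> a \<in> carrier R"
  by (simp add: corner_def)

lemma corner_mult:
  assumes "e \<in> carrier R" "h \<in> carrier R" "a \<in> corner R e f" "b \<in> corner R f' h"
  shows "a \<otimes> b \<in> corner R e h"
  using assms by (auto simp: corner_def m_assoc simp flip: m_assoc[of e a b])

lemma corner_add:
  "e \<in> carrier R \<Longrightarrow> f \<in> carrier R \<Longrightarrow> a \<in> corner R e f \<Longrightarrow> b \<in> corner R e f \<Longrightarrow> a \<oplus> b \<in> corner R e f"
  by (simp add: corner_def l_distr r_distr)

lemma corner_uminus:
  "e \<in> carrier R \<Longrightarrow> f \<in> carrier R \<Longrightarrow> a \<in> corner R e f \<Longrightarrow> \<ominus> a \<in> corner R e f"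
  by (simp add: corner_def l_minus r_minus)

lemma corner_minus:
  "e \<in> carrier R \<Longrightarrow> f \<in> carrier R \<Longrightarrow> a \<in> corner R e f \<Longrightarrow> b \<in> corner R e f \<Longrightarrow> a \<ominus> b \<in> corner R e f"
  by (simp add: a_minus_def corner_add corner_uminus)

lemma corner_zero: "e \<in> carrier R \<Longrightarrow> f \<in> carrier R \<Longrightarrow> \<zero> \<in> corner R e f"
  by (simp add: corner_def)

lemma local_idempotentD:
  assumes "local_idempotent R e"
  shows "e \<in> carrier R" "e \<otimes> e = e" "e \<noteq> \<zero>" "e \<in> corner R e e"
  using assms by (auto simp: local_idempotent_def corner_def)

lemma corner_radical_corner: "a \<in> corner_radical R e f \<Longrightarrow> a \<in> corner R e f"
  by (simp add: corner_radical_def)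

lemma corner_radical_closed: "a \<in> corner_radical R e f \<Longrightarrow> a \<in> carrier R"
  by (simp add: corner_radical_def corner_def)

lemma corner_radical_zero:
  "local_idempotent R e \<Longrightarrow> f \<in> carrier R \<Longrightarrow> \<zero> \<in> corner_radical R e f"
  using local_idempotentD[of e] corner_closed[of _ f e]
  by (auto simp: corner_radical_def corner_zero)

text \<open>
  The product \<open>b \<otimes> a\<close> is an idempotent of the local ring \<open>f R f\<close>, hence \<open>0\<close> or \<open>f\<close>, and it is not
  \<open>0\<close> because \<open>e = (a \<otimes> b) \<otimes> (a \<otimes> b)\<close> is not.
\<close>

lemma local_idempotent_right_inverse_is_left_inverse:
  assumes e: "local_idempotent R e" and f: "local_idempotent R f"
    and a: "a \<in> corner R e f" and b: "b \<in> corner R f e" and ab: "a \<otimes> b = e"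
  shows "b \<otimes> a = f"
proof -
  note ef = local_idempotentD[OF e] local_idempotentD[OF f]
  define c where "c = b \<otimes> a"
  have ac: "a \<in> carrier R" "b \<in> carrier R" "b \<otimes> e = b" "f \<otimes> b = b" "a \<otimes> f = a" "e \<otimes> a = a"
    using a b by (auto simp: corner_def)
  have cc: "c \<in> corner R f f" unfolding c_def using a b ef by (intro corner_mult) auto
  then have c: "c \<in> carrier R" "f \<otimes> c = c" "c \<otimes> f = c" by (auto simp: corner_def)
  have "c \<otimes> c = b \<otimes> (a \<otimes> b) \<otimes> a" unfolding c_def using ac by (simp add: m_assoc)
  also have "\<dots> = c" unfolding c_def using ac ab by simp
  finally have idem: "c \<otimes> c = c" .
  have "c \<noteq> \<zero>"
  proof
    assume c0: "c = \<zero>"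
    have "e = (a \<otimes> b) \<otimes> (a \<otimes> b)" using ab ef by simp
    also have "\<dots> = a \<otimes> c \<otimes> b" unfolding c_def using ac by (simp add: m_assoc)
    finally show False using c0 ac ef by simp
  qed
  obtain u where u: "u \<in> corner R f f" "c \<otimes> u = f \<or> (f \<ominus> c) \<otimes> u = f"
    using f cc unfolding local_idempotent_def by blast
  then have uc: "u \<in> carrier R" by (simp add: corner_def)
  show ?thesis using u(2)
  proof
    assume "c \<otimes> u = f"
    then have "c = c \<otimes> (c \<otimes> u)" using c by simp
    also have "\<dots> = c \<otimes> u" using c uc idem by (simp flip: m_assoc)
    finally show ?thesis using \<open>c \<otimes> u = f\<close> by (simp add: c_def)
  next
    assume "(f \<ominus> c) \<otimes> u = f"
    then have "c = c \<otimes> ((f \<ominus> c) \<otimes> u)" using c by simp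
    also have "\<dots> = (c \<otimes> f \<ominus> c \<otimes> c) \<otimes> u"
      using c uc ef by (simp add: a_minus_def m_assoc r_distr r_minus flip: m_assoc[of c "f \<oplus> \<ominus> c" u])
    also have "\<dots> = \<zero>" using c uc idem by (simp add: a_minus_def r_neg)
    finally show ?thesis using \<open>c \<noteq> \<zero>\<close> by simp
  qed
qed

lemma corner_iso_if_not_radical:
  assumes "local_idempotent R e" "local_idempotent R f" "a \<in> corner R e f" "a \<notin> corner_radical R e f"
  obtains b where "b \<in> corner R f e" "a \<otimes> b = e" "b \<otimes> a = f"
  using assms local_idempotent_right_inverse_is_left_inverse[OF assms(1,2,3)]
  unfolding corner_radical_def by auto

lemma corner_radical_mult_right:
  assumes "e \<in> carrier R" "h \<in> carrier R" "f \<in> carrier R" "a \<in> corner_radical R e f" "b \<in> corner R f h"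
  shows "a \<otimes> b \<in> corner_radical R e h"
proof -
  have "a \<otimes> b \<otimes> c \<noteq> e" if "c \<in> corner R h e" for c
  proof -
    have "b \<otimes> c \<in> corner R f e" using assms that by (intro corner_mult) auto
    then have "a \<otimes> (b \<otimes> c) \<noteq> e" using assms(4) by (simp add: corner_radical_def)
    then show ?thesis using assms that corner_radical_closed corner_closed by (simp add: m_assoc)
  qed
  moreover have "a \<otimes> b \<in> corner R e h"
    using assms corner_mult[of e h a f b f] corner_radical_corner by auto
  ultimately show ?thesis by (simp add: corner_radical_def)
qed

text \<open>
  A right inverse of \<open>a \<otimes> b\<close> yields a right inverse of \<open>a\<close>; as that is also a left inverse, it can
  be moved around to give a right inverse of \<open>b\<close>.
\<close>

lemma corner_radical_mult_left:
  assumes e: "local_idempotent R e" and f: "local_idempotent R f" and h: "h \<in> carrier R"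
    and a: "a \<in> corner R e f" and b: "b \<in> corner_radical R f h"
  shows "a \<otimes> b \<in> corner_radical R e h"
proof -
  note ef = local_idempotentD[OF e] local_idempotentD[OF f]
  have b': "b \<in> corner R f h" using b by (rule corner_radical_corner)
  have "a \<otimes> b \<otimes> c \<noteq> e" if c: "c \<in> corner R h e" for c
  proof
    assume *: "a \<otimes> b \<otimes> c = e"
    have bc: "b \<otimes> c \<in> corner R f e" and ca: "c \<otimes> a \<in> corner R h f"
      using a b' c ef h by (auto intro!: corner_mult)
    have cl: "a \<in> carrier R" "b \<in> carrier R" "c \<in> carrier R" using a b' c corner_closed by auto
    have "a \<otimes> (b \<otimes> c) = e" using * cl by (simp add: m_assoc)
    then have "b \<otimes> c \<otimes> a = f"
      by (rule local_idempotent_right_inverse_is_left_inverse[OF e f a bc])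
    then have "b \<otimes> (c \<otimes> a) = f" using cl by (simp add: m_assoc)
    then show False using b ca by (simp add: corner_radical_def)
  qed
  moreover have "a \<otimes> b \<in> corner R e h" using a b' ef h by (intro corner_mult) auto
  ultimately show ?thesis by (simp add: corner_radical_def)
qed

text \<open>
  If \<open>(a \<oplus> b) \<otimes> c = e\<close> then \<open>a \<otimes> c\<close> or \<open>e \<ominus> a \<otimes> c = b \<otimes> c\<close> is a unit of the local ring \<open>e R e\<close>.
\<close>

lemma corner_radical_add:
  assumes e: "local_idempotent R e" and f: "f \<in> carrier R"
    and a: "a \<in> corner_radical R e f" and b: "b \<in> corner_radical R e f"
  shows "a \<oplus> b \<in> corner_radical R e f"
proof -
  note ee = local_idempotentD[OF e]
  have ab: "a \<in> corner R e f" "b \<in> corner R e f" using a b corner_radical_corner by auto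
  have "(a \<oplus> b) \<otimes> c \<noteq> e" if c: "c \<in> corner R f e" for c
  proof
    assume *: "(a \<oplus> b) \<otimes> c = e"
    have cl: "a \<in> carrier R" "b \<in> carrier R" "c \<in> carrier R" using ab c corner_closed by auto
    have sum: "a \<otimes> c \<oplus> b \<otimes> c = e" using * cl by (simp add: l_distr)
    have "b \<otimes> c = (a \<otimes> c \<oplus> b \<otimes> c) \<ominus> a \<otimes> c"
      using cl by (simp add: a_minus_def a_comm[of "a \<otimes> c"] a_assoc r_neg)
    then have bc: "e \<ominus> a \<otimes> c = b \<otimes> c" using sum by simp
    have "a \<otimes> c \<in> corner R e e" using ab c ee by (intro corner_mult) auto
    then obtain u where u: "u \<in> corner R e e" "a \<otimes> c \<otimes> u = e \<or> b \<otimes> c \<otimes> u = e"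
      using e bc unfolding local_idempotent_def by metis
    have "c \<otimes> u \<in> corner R f e" using c u ee f by (intro corner_mult) auto
    then have "a \<otimes> (c \<otimes> u) \<noteq> e" "b \<otimes> (c \<otimes> u) \<noteq> e" using a b by (auto simp: corner_radical_def)
    then show False using u cl corner_closed[OF u(1)] by (simp add: m_assoc)
  qed
  then show ?thesis using corner_add[OF ee(1) f ab] by (simp add: corner_radical_def)
qed

lemma corner_radical_uminus:
  assumes "e \<in> carrier R" "f \<in> carrier R" "a \<in> corner_radical R e f"
  shows "\<ominus> a \<in> corner_radical R e f"
proof -
  have a: "a \<in> corner R e f" using assms corner_radical_corner by auto
  have "(\<ominus> a) \<otimes> c \<noteq> e" if c: "c \<in> corner R f e" for c
  proof -
    have "a \<otimes> (\<ominus> c) \<noteq> e" using assms corner_uminus[OF _ _ c] by (auto simp: corner_radical_def)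
    then show ?thesis using corner_closed[OF a] corner_closed[OF c] by (simp add: l_minus r_minus)
  qed
  then show ?thesis using corner_uminus[OF assms(1,2) a] by (simp add: corner_radical_def)
qed

lemma corner_radical_minus:
  assumes "local_idempotent R e" "f \<in> carrier R" "a \<in> corner_radical R e f" "b \<in> corner_radical R e f"
  shows "a \<ominus> b \<in> corner_radical R e f"
  using assms by (auto simp: a_minus_def intro!: corner_radical_add corner_radical_uminus dest: local_idempotentD)

lemma corner_radical_finsum:
  assumes "local_idempotent R e" "f \<in> carrier R" "\<And>i. i \<in> F \<Longrightarrow> h i \<in> corner_radical R e f"
  shows "(\<Oplus>i\<in>F. h i) \<in> corner_radical R e f"
  using assms(3)
proof (induction F rule: infinite_finite_induct)
  case (insert i F)
  then show ?case using assms
    by (subst finsum_insert) (auto intro!: corner_radical_add dest: corner_radical_closed)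
qed (use assms in \<open>simp_all add: corner_radical_zero\<close>)

lemma local_idempotent_not_radical: "local_idempotent R e \<Longrightarrow> e \<notin> corner_radical R e e"
  using local_idempotentD[of e] by (auto simp: corner_radical_def)

lemma not_radical_if_radical_minus_idempotent:
  assumes "local_idempotent R e" "a \<in> carrier R" "a \<ominus> e \<in> corner_radical R e e"
  shows "a \<notin> corner_radical R e e"
proof
  assume "a \<in> corner_radical R e e"
  then have "a \<ominus> (a \<ominus> e) \<in> corner_radical R e e"
    using corner_radical_minus[OF assms(1) _ _ assms(3), of a] local_idempotentD[OF assms(1)] by simp
  moreover have "a \<ominus> (a \<ominus> e) = e"
    using assms local_idempotentD[OF assms(1)]
    by (simp add: a_minus_def minus_add minus_minus r_neg2)
  ultimately show False using local_idempotent_not_radical[OF assms(1)] by simp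
qed

text \<open>
  The rank inequality over the local ring \<open>e R e\<close>. Row \<open>k0\<close> of the left factor has an invertible entry,
  for otherwise the diagonal entry of the product would lie in the radical. Subtracting multiples of
  this row clears the column of that entry in the other rows, so that both the row and the column can
  be dropped.
\<close>

lemma card_le_if_identity_factors_modulo_radical:
  fixes a :: "'k \<Rightarrow> 'l \<Rightarrow> 'a" and b :: "'l \<Rightarrow> 'k \<Rightarrow> 'a"
  assumes e: "local_idempotent R e" and K: "finite K" and L: "finite L"
    and a: "\<And>k l. k \<in> K \<Longrightarrow> l \<in> L \<Longrightarrow> a k l \<in> corner R e e"
    and b: "\<And>l j. l \<in> L \<Longrightarrow> j \<in> K \<Longrightarrow> b l j \<in> corner R e e"
    and prod: "\<And>k j. k \<in> K \<Longrightarrow> j \<in> K \<Longrightarrow>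
      (\<Oplus>l\<in>L. a k l \<otimes> b l j) \<ominus> (if k = j then e else \<zero>) \<in> corner_radical R e e"
  shows "card K \<le> card L"
  using K L a b prod
proof (induction K arbitrary: L a rule: finite_induct)
  case (insert k0 K)
  note ee = local_idempotentD[OF e]
  note a = insert.prems(2) and b = insert.prems(3) and prod = insert.prems(4)
  have ac: "a k l \<in> carrier R" if "k \<in> insert k0 K" "l \<in> L" for k l
    using a[OF that] by (rule corner_closed)
  have bc: "b l j \<in> carrier R" if "j \<in> insert k0 K" "l \<in> L" for l j
    using b[OF that(2,1)] by (rule corner_closed)
  have "\<exists>l0\<in>L. a k0 l0 \<notin> corner_radical R e e"
  proof (rule ccontr)
    assume "\<not> ?thesis"
    then have "(\<Oplus>l\<in>L. a k0 l \<otimes> b l k0) \<in> corner_radical R e e"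
      using b ee by (intro corner_radical_finsum[OF e] corner_radical_mult_right[where f=e]) auto
    moreover have "(\<Oplus>l\<in>L. a k0 l \<otimes> b l k0) \<in> carrier R"
      using ac bc by (intro finsum_closed) auto
    ultimately show False
      using prod[of k0 k0] not_radical_if_radical_minus_idempotent[OF e] by auto
  qed
  then obtain l0 where l0: "l0 \<in> L" "a k0 l0 \<notin> corner_radical R e e" by blast
  moreover have "a k0 l0 \<in> corner R e e" using a l0 by simp
  ultimately obtain u where u: "u \<in> corner R e e" "u \<otimes> a k0 l0 = e"
    using corner_iso_if_not_radical[OF e e] by metis
  have uc: "u \<in> carrier R" using u corner_closed by auto
  define c where "c k = a k l0 \<otimes> u" for k
  define a' where "a' k l = a k l \<ominus> c k \<otimes> a k0 l" for k l
  have c: "c k \<in> corner R e e" if "k \<in> K" for k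
    unfolding c_def using a that l0 u ee by (intro corner_mult) auto
  have cc: "c k \<in> carrier R" if "k \<in> K" for k using c[OF that] by (rule corner_closed)
  have a': "a' k l \<in> corner R e e" if "k \<in> K" "l \<in> L" for k l
    unfolding a'_def using a c that ee by (intro corner_minus corner_mult) auto
  have a'c: "a' k l \<in> carrier R" if "k \<in> K" "l \<in> L" for k l
    using a'[OF that] by (rule corner_closed)
  have "card K \<le> card (L - {l0})"
  proof (rule insert.IH[where a = a'])
    fix k j assume kj: "k \<in> K" "j \<in> K"
    \<comment> \<open>Row \<open>k\<close> minus \<open>c k\<close> times row \<open>k0\<close> has zero entry in column \<open>l0\<close>.\<close>
    have "c k \<otimes> a k0 l0 = a k l0 \<otimes> (u \<otimes> a k0 l0)"
      unfolding c_def using ac l0 kj uc by (simp add: m_assoc)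
    also have "\<dots> = a k l0" using u(2) a[of k l0] kj l0 by (simp add: corner_def)
    finally have "a' k l0 = \<zero>" unfolding a'_def using ac l0 kj by (simp add: a_minus_def r_neg)
    then have "a' k l0 \<otimes> b l0 j = \<zero>" using bc l0 kj by simp
    then have "(\<Oplus>l\<in>L - {l0}. a' k l \<otimes> b l j) = (\<Oplus>l\<in>L. a' k l \<otimes> b l j)"
      using a'c bc kj insert.prems(1) by (intro add.finprod_mono_neutral_cong_left) auto
    also have "\<dots> = (\<Oplus>l\<in>L. a k l \<otimes> b l j \<oplus> (\<ominus> c k) \<otimes> (a k0 l \<otimes> b l j))"
      using ac bc cc kj
      by (intro finsum_cong') (auto simp: a'_def a_minus_def l_distr l_minus m_assoc)
    also have "\<dots> = (\<Oplus>l\<in>L. a k l \<otimes> b l j) \<oplus> (\<Oplus>l\<in>L. (\<ominus> c k) \<otimes> (a k0 l \<otimes> b l j))"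
      using ac bc cc kj by (intro finsum_addf) auto
    also have "(\<Oplus>l\<in>L. (\<ominus> c k) \<otimes> (a k0 l \<otimes> b l j)) = (\<ominus> c k) \<otimes> (\<Oplus>l\<in>L. a k0 l \<otimes> b l j)"
      using ac bc cc kj insert.prems(1) by (intro finsum_rdistr[symmetric]) auto
    finally have eq: "(\<Oplus>l\<in>L - {l0}. a' k l \<otimes> b l j)
      = (\<Oplus>l\<in>L. a k l \<otimes> b l j) \<oplus> (\<ominus> c k) \<otimes> (\<Oplus>l\<in>L. a k0 l \<otimes> b l j)" .
    have s: "(\<Oplus>l\<in>L. a k l \<otimes> b l j) \<in> carrier R" "(\<Oplus>l\<in>L. a k0 l \<otimes> b l j) \<in> carrier R"
      using ac bc kj by (auto intro!: finsum_closed)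
    have "k0 \<noteq> j" using insert.hyps kj by auto
    then have "(\<Oplus>l\<in>L. a k0 l \<otimes> b l j) \<in> corner_radical R e e"
      using prod[of k0 j] kj s by (simp add: a_minus_def)
    then have "(\<ominus> c k) \<otimes> (\<Oplus>l\<in>L. a k0 l \<otimes> b l j) \<in> corner_radical R e e"
      using c kj ee by (intro corner_radical_mult_left[OF e e] corner_uminus) auto
    moreover have "(\<Oplus>l\<in>L. a k l \<otimes> b l j) \<ominus> (if k = j then e else \<zero>) \<in> corner_radical R e e"
      using prod kj by auto
    ultimately have "((\<Oplus>l\<in>L. a k l \<otimes> b l j) \<ominus> (if k = j then e else \<zero>))
      \<oplus> (\<ominus> c k) \<otimes> (\<Oplus>l\<in>L. a k0 l \<otimes> b l j) \<in> corner_radical R e e"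
      using ee by (intro corner_radical_add[OF e]) auto
    moreover have "((\<Oplus>l\<in>L. a k l \<otimes> b l j) \<ominus> (if k = j then e else \<zero>))
      \<oplus> (\<ominus> c k) \<otimes> (\<Oplus>l\<in>L. a k0 l \<otimes> b l j)
      = (\<Oplus>l\<in>L - {l0}. a' k l \<otimes> b l j) \<ominus> (if k = j then e else \<zero>)"
      unfolding eq using s cc kj ee by (simp add: a_minus_def a_ac)
    ultimately show "(\<Oplus>l\<in>L - {l0}. a' k l \<otimes> b l j) \<ominus> (if k = j then e else \<zero>) \<in> corner_radical R e e"
      by simp
  qed (use insert.prems(1) a' b in auto)
  then show ?case using insert.hyps insert.prems(1) l0 
    by (metis Suc_le_mono card.insert card_Suc_Diff1)
qed simp

end


section \<open>Extending finite biorthogonal families\<close>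

context biorthogonal
begin

definition residual :: "'i set \<Rightarrow> 'm \<Rightarrow> 'm"
  where "residual F x = x \<ominus>\<^bsub>M\<^esub> component F x"

context
  fixes F assumes F: "finite F" "F \<subseteq> A"
begin

lemma residual_closed [simp]: "x \<in> carrier M \<Longrightarrow> residual F x \<in> carrier M"
  using F by (simp add: residual_def)

lemma g_residual: "t \<in> F \<Longrightarrow> x \<in> carrier M \<Longrightarrow> g t (residual F x) = \<zero>"
  using F by (simp add: residual_def functional_g functional_minus g_component subset_iff)
    (simp add: a_minus_def R.r_neg subset_iff)

lemma residual_residual: "x \<in> carrier M \<Longrightarrow> residual F (residual F x) = residual F x"
proof -
  assume x: "x \<in> carrier M"
  have "component F (residual F x) = (\<Oplus>\<^bsub>M\<^esub>s\<in>F. \<zero>\<^bsub>M\<^esub>)"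
    unfolding component_def using x F by (intro M.finsum_cong') (auto simp: g_residual subset_iff)
  then show ?thesis using x by (simp add: residual_def[of F "residual F x"] a_minus_def)
qed

lemma residual_y: "t \<in> F \<Longrightarrow> residual F (y t) = \<zero>\<^bsub>M\<^esub>"
proof -
  assume t: "t \<in> F"
  have "component {t} (y t) = y t" using t F by (simp add: component_def g_y_same smult_e_y subset_iff)
  then have "component F (y t) = y t"
    using t F component_mono[of F "{t}" "y t"] by (auto simp: subset_iff)
  then show ?thesis using t F by (simp add: residual_def a_minus_def M.r_neg subset_iff)
qed

lemma residual_add:
  assumes "x \<in> carrier M" "x' \<in> carrier M"
  shows "residual F (x \<oplus>\<^bsub>M\<^esub> x') = residual F x \<oplus>\<^bsub>M\<^esub> residual F x'"
  using F assms by (simp add: residual_def component_add a_minus_def M.minus_add M.a_ac)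

lemma residual_smult:
  assumes "a \<in> carrier R" "x \<in> carrier M"
  shows "residual F (a \<odot>\<^bsub>M\<^esub> x) = a \<odot>\<^bsub>M\<^esub> residual F x"
  using F assms
  by (simp add: residual_def component_smult a_minus_def smult_r_distr smult_r_minus)

lemma residual_hom: "residual F \<in> module_hom R M M"
  by (intro module_homI) (simp_all add: residual_add residual_smult)

lemma residual_finsum:
  assumes "h \<in> K \<rightarrow> carrier M"
  shows "residual F (\<Oplus>\<^bsub>M\<^esub>k\<in>K. h k) = (\<Oplus>\<^bsub>M\<^esub>k\<in>K. residual F (h k))"
  using assms
proof (induction K rule: infinite_finite_induct)
  case (insert i K)
  then have "h i \<in> carrier M" "h \<in> K \<rightarrow> carrier M" by auto
  with insert show ?case by (simp add: residual_add Pi_iff)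
qed (use module_hom_zero[OF _ _ residual_hom] right_module_axioms in simp_all)

lemma component_plus_residual: "x \<in> carrier M \<Longrightarrow> component F x \<oplus>\<^bsub>M\<^esub> residual F x = x"
  using F by (simp add: residual_def a_minus_def M.a_ac M.r_neg2 M.r_neg1 M.r_neg)

end

lemma spanned_iff_component:
  "finite A \<Longrightarrow> x \<in> spanned \<longleftrightarrow> x \<in> carrier M \<and> component A x = x"
  using component_mono[of A _ x] unfolding spanned_def by auto

end

text \<open>
  A family is indexed here by its own members, triples of an idempotent, an element and a functional.
  Extending a family is then inclusion of sets, and the union of a chain of families is a family.
\<close>

abbreviation biorthogonal_set ::
    "('a, 'r) ring_scheme \<Rightarrow> ('a, 'm) module \<Rightarrow> ('a \<times> 'm \<times> ('m \<Rightarrow> 'a)) set \<Rightarrow> bool"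
  where "biorthogonal_set R M S \<equiv> biorthogonal R M S fst (\<lambda>s. fst (snd s)) (\<lambda>s. snd (snd s))"

abbreviation set_component ::
    "('a, 'm) module \<Rightarrow> ('a \<times> 'm \<times> ('m \<Rightarrow> 'a)) set \<Rightarrow> 'm \<Rightarrow> 'm"
  where "set_component M S \<equiv> biorthogonal.component M (\<lambda>s. fst (snd s)) (\<lambda>s. snd (snd s)) S"

abbreviation set_residual ::
    "('a, 'm) module \<Rightarrow> ('a \<times> 'm \<times> ('m \<Rightarrow> 'a)) set \<Rightarrow> 'm \<Rightarrow> 'm"
  where "set_residual M S \<equiv> biorthogonal.residual M (\<lambda>s. fst (snd s)) (\<lambda>s. snd (snd s)) S"

text \<open>
  The Gram-Schmidt step: \<open>y\<close> and \<open>f\<close> are made orthogonal to \<open>S\<close> by means of the residual projection,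
  and \<open>f\<close> is normalised by the inverse \<open>u\<close> of its value at the new element.
\<close>

lemma biorthogonal_set_extend_by_one:
  fixes R (structure) and M :: "('a, 'm) module"
  assumes S: "finite S" "biorthogonal_set R M S"
    and e: "local_idempotent R e"
    and y: "y \<in> carrier M" "e \<odot>\<^bsub>M\<^esub> y = y"
    and f: "f \<in> functionals R M" "\<And>x. x \<in> carrier M \<Longrightarrow> e \<otimes> f x = f x"
    and unit: "f (set_residual M S y) \<notin> corner_radical R e e"
  obtains u where "u \<in> corner R e e"
    "(e, set_residual M S y, \<lambda>z. u \<otimes> f (set_residual M S z)) \<notin> S"
    "biorthogonal_set R M (insert (e, set_residual M S y, \<lambda>z. u \<otimes> f (set_residual M S z)) S)"
    "set_component M (insert (e, set_residual M S y, \<lambda>z. u \<otimes> f (set_residual M S z)) S) y = y"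
    "\<And>z. z \<in> carrier M \<Longrightarrow>
      set_residual M (insert (e, set_residual M S y, \<lambda>z. u \<otimes> f (set_residual M S z)) S) z
        = set_residual M S z \<ominus>\<^bsub>M\<^esub> (u \<otimes> f (set_residual M S z)) \<odot>\<^bsub>M\<^esub> set_residual M S y"
proof -
  interpret S: biorthogonal R M S fst "\<lambda>s. fst (snd s)" "\<lambda>s. snd (snd s)" by (rule S(2))
  note ee = S.local_idempotentD[OF e]
  define \<pi> where "\<pi> = set_residual M S"
  have \<pi>: "\<pi> x \<in> carrier M" "\<pi> (\<pi> x) = \<pi> x" if "x \<in> carrier M" for x
    using that S(1) by (simp_all add: \<pi>_def S.residual_residual)
  have e_\<pi>y: "e \<odot>\<^bsub>M\<^esub> \<pi> y = \<pi> y"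
    using S.residual_smult[OF S(1) subset_refl ee(1) y(1)] y(2) by (simp add: \<pi>_def)
  have corner: "f (\<pi> y) \<in> corner R e e"
    using f \<pi> y e_\<pi>y ee S.functional_smult[OF f(1) ee(1) \<pi>(1)[OF y(1)]]
    by (auto simp: corner_def)
  obtain u where u: "u \<in> corner R e e" "u \<otimes> f (\<pi> y) = e"
    using S.corner_iso_if_not_radical[OF e e corner] unit unfolding \<pi>_def by metis
  have uc: "u \<in> carrier R" "e \<otimes> u = u" using u by (auto simp: corner_def)
  define h where "h = (\<lambda>z. u \<otimes> f (\<pi> z))"
  define s where "s = (e, \<pi> y, h)"
  have h_\<pi>y: "h (\<pi> y) = e" using \<pi> y u by (simp add: h_def)
  have hc: "h z \<in> carrier R" if "z \<in> carrier M" for z using that uc f \<pi> by (simp add: h_def)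
  have "(\<lambda>z. f (\<pi> z)) \<in> functionals R M"
    unfolding \<pi>_def using module_hom_comp[OF S.residual_hom[OF S(1) subset_refl] f(1)] by simp
  then have hf: "h \<in> functionals R M" unfolding h_def using uc by (intro S.functional_scale) auto
  have h_y: "h (fst (snd t)) = \<zero>" if "t \<in> S" for t
    using S.residual_y[OF S(1) subset_refl that] uc f by (simp add: h_def \<pi>_def S.functional_zero)
  have g_\<pi>y: "snd (snd t) (\<pi> y) = \<zero>" if "t \<in> S" for t
    using S.g_residual[OF S(1) subset_refl that y(1)] by (simp add: \<pi>_def)
  have s_notin: "s \<notin> S"
  proof
    assume "s \<in> S"
    then have "h (\<pi> y) = \<zero>" using h_y[of s] by (simp add: s_def)
    with h_\<pi>y ee show False by simp
  qed
  have bi: "biorthogonal_set R M (insert s S)"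
  proof (intro biorthogonal.intro biorthogonal_axioms.intro)
    show "right_module R M" by (rule S.right_module_axioms)
    fix t assume t: "t \<in> insert s S"
    have "fst t \<in> carrier R \<and> fst (snd t) \<in> carrier M \<and> fst t \<odot>\<^bsub>M\<^esub> fst (snd t) = fst (snd t) \<and>
      snd (snd t) \<in> functionals R M \<and> snd (snd t) (fst (snd t)) = fst t"
    proof (cases "t = s")
      case True
      show ?thesis unfolding True s_def using ee(1) \<pi>(1)[OF y(1)] e_\<pi>y hf h_\<pi>y by simp
    next
      case False
      then have "t \<in> S" using t by simp
      then show ?thesis using S.e_closed S.y_closed S.smult_e_y S.functional_g S.g_y_same by simp
    qed
    then show "fst t \<in> carrier R" "fst (snd t) \<in> carrier M" "fst t \<odot>\<^bsub>M\<^esub> fst (snd t) = fst (snd t)"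
      "snd (snd t) \<in> functionals R M" "snd (snd t) (fst (snd t)) = fst t" by simp_all
    show "fst t \<otimes> snd (snd t) x = snd (snd t) x" if "x \<in> carrier M" for x
    proof (cases "t = s")
      case True
      have "e \<otimes> (u \<otimes> f (\<pi> x)) = e \<otimes> u \<otimes> f (\<pi> x)"
        using ee uc f(1) \<pi> that by (intro S.m_assoc[symmetric]) auto
      also have "\<dots> = u \<otimes> f (\<pi> x)" by (simp only: uc)
      finally show ?thesis unfolding True by (simp add: s_def h_def)
    next
      case False
      then have "t \<in> S" using t by simp
      then show ?thesis using S.mult_e_g that by simp
    qed
    show "snd (snd t) (fst (snd t')) = \<zero>" if t': "t' \<in> insert s S" "t \<noteq> t'" for t'
    proof -
      consider "t = s" "t' \<in> S" | "t \<in> S" "t' = s" | "t \<in> S" "t' \<in> S" using t t' by auto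
      then show ?thesis
      proof cases
        case 1
        then show ?thesis using h_y[of t'] by (simp add: s_def)
      next
        case 2
        then show ?thesis using g_\<pi>y[of t] by (simp add: s_def)
      next
        case 3
        then show ?thesis using t'(2) by (rule S.g_y_other)
      qed
    qed
  qed
  interpret S': biorthogonal R M "insert s S" fst "\<lambda>s. fst (snd s)" "\<lambda>s. snd (snd s)" by (rule bi)
  have comp: "set_component M (insert s S) z = h z \<odot>\<^bsub>M\<^esub> \<pi> y \<oplus>\<^bsub>M\<^esub> set_component M S z"
    if "z \<in> carrier M" for z
    unfolding S.component_def using s_notin S(1) that hc \<pi> y
    by (subst S.M.finsum_insert) (auto simp: s_def)
  have res: "set_residual M (insert s S) z = \<pi> z \<ominus>\<^bsub>M\<^esub> h z \<odot>\<^bsub>M\<^esub> \<pi> y" if "z \<in> carrier M" for z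
    unfolding S.residual_def \<pi>_def using that hc \<pi> y S(1)
    by (simp add: comp a_minus_def S.M.minus_add S.M.a_ac \<pi>_def S.residual_def)
  have "h y = e" using u(2) by (simp add: h_def)
  then have "set_component M (insert s S) y = y"
    using y e_\<pi>y S.component_plus_residual[OF S(1) subset_refl y(1)] S.M.a_comm[of "\<pi> y"] \<pi>
    by (simp add: comp \<pi>_def)
  from that[OF u(1), folded \<pi>_def, folded h_def, folded s_def, OF s_notin bi this res[unfolded h_def]]
  show ?thesis .
qed

text \<open>
  Gram-Schmidt for a family whose matrix is the identity modulo the radical. A step changes each of the
  remaining entries by a multiple of an entry off the diagonal, which lies in the radical, so that the
  hypothesis is inherited.
\<close>

lemma biorthogonal_set_extend:
  fixes R (structure) and M :: "('a, 'm) module" and f :: "'k \<Rightarrow> 'm \<Rightarrow> 'a"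
  assumes K: "finite K"
    and S: "finite S" "biorthogonal_set R M S"
    and e: "\<And>k. k \<in> K \<Longrightarrow> local_idempotent R (e k)"
    and y: "\<And>k. k \<in> K \<Longrightarrow> y k \<in> carrier M" "\<And>k. k \<in> K \<Longrightarrow> e k \<odot>\<^bsub>M\<^esub> y k = y k"
    and f: "\<And>k. k \<in> K \<Longrightarrow> f k \<in> functionals R M"
       "\<And>k x. k \<in> K \<Longrightarrow> x \<in> carrier M \<Longrightarrow> e k \<otimes> f k x = f k x"
    and id: "\<And>k j. k \<in> K \<Longrightarrow> j \<in> K \<Longrightarrow>
      f k (set_residual M S (y j)) \<ominus> (if k = j then e k else \<zero>) \<in> corner_radical R (e k) (e j)"
  shows "\<exists>S'. S \<subseteq> S' \<and> finite S' \<and> biorthogonal_set R M S' \<and> fst ` S' \<subseteq> fst ` S \<union> e ` K \<and>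
    (\<forall>k\<in>K. set_component M S' (y k) = y k)"
  using K S e y f id
proof (induction K arbitrary: S rule: finite_induct)
  case empty
  then show ?case by auto
next
  case (insert k0 K)
  note S = insert.prems(1,2) and e = insert.prems(3) and y = insert.prems(4,5)
    and f = insert.prems(6,7) and id = insert.prems(8)
  interpret S: biorthogonal R M S fst "\<lambda>s. fst (snd s)" "\<lambda>s. snd (snd s)" by (rule S(2))
  define \<pi> where "\<pi> = set_residual M S"
  have \<pi>: "\<pi> x \<in> carrier M" if "x \<in> carrier M" for x using that S(1) by (simp add: \<pi>_def)
  have ee: "e k \<in> carrier R" if "k \<in> insert k0 K" for k using e[OF that] S.local_idempotentD by auto
  have f_corner: "f k (\<pi> (y j)) \<in> corner R (e k) (e j)" if "k \<in> insert k0 K" "j \<in> insert k0 K" for k j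
  proof -
    have "e j \<odot>\<^bsub>M\<^esub> \<pi> (y j) = \<pi> (y j)"
      using S.residual_smult[OF S(1) subset_refl, of "e j" "y j"] y ee that by (simp add: \<pi>_def)
    then show ?thesis
      using f y ee that \<pi> S.functional_smult[of "f k" "e j" "\<pi> (y j)"] by (auto simp: corner_def)
  qed
  have fc: "f k (\<pi> (y j)) \<in> carrier R" if "k \<in> insert k0 K" "j \<in> insert k0 K" for k j
    using f_corner[OF that] S.corner_closed by blast
  have "f k0 (\<pi> (y k0)) \<notin> corner_radical R (e k0) (e k0)"
    using id[of k0 k0] fc
    by (intro S.not_radical_if_radical_minus_idempotent[OF e]) (auto simp: \<pi>_def)
  then have "f k0 (set_residual M S (y k0)) \<notin> corner_radical R (e k0) (e k0)" by (simp add: \<pi>_def)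
  from biorthogonal_set_extend_by_one[OF S e y f this]
  obtain u where u: "u \<in> corner R (e k0) (e k0)"
    and s': "biorthogonal_set R M (insert (e k0, \<pi> (y k0), \<lambda>z. u \<otimes> f k0 (\<pi> z)) S)"
      "set_component M (insert (e k0, \<pi> (y k0), \<lambda>z. u \<otimes> f k0 (\<pi> z)) S) (y k0) = y k0"
    and res': "\<And>z. z \<in> carrier M \<Longrightarrow>
      set_residual M (insert (e k0, \<pi> (y k0), \<lambda>z. u \<otimes> f k0 (\<pi> z)) S) z
        = \<pi> z \<ominus>\<^bsub>M\<^esub> (u \<otimes> f k0 (\<pi> z)) \<odot>\<^bsub>M\<^esub> \<pi> (y k0)"
    unfolding \<pi>_def by auto
  define s where "s = (e k0, \<pi> (y k0), \<lambda>z. u \<otimes> f k0 (\<pi> z))"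
  note s = s'[folded s_def] and res = res'[folded s_def]
  have fst_s: "fst s = e k0" by (simp add: s_def)
  have uc: "u \<in> carrier R" using u S.corner_closed by auto
  have "\<exists>S'. insert s S \<subseteq> S' \<and> finite S' \<and> biorthogonal_set R M S' \<and>
      fst ` S' \<subseteq> fst ` (insert s S) \<union> e ` K \<and> (\<forall>k\<in>K. set_component M S' (y k) = y k)"
  proof (rule insert.IH)
    fix k j assume kj: "k \<in> K" "j \<in> K"
    then have "k \<noteq> k0" using insert.hyps by auto
    then have "f k (\<pi> (y k0)) \<in> corner_radical R (e k) (e k0)"
      using id[of k k0] kj fc[of k k0] by (simp add: \<pi>_def a_minus_def)
    then have "f k (\<pi> (y k0)) \<otimes> (u \<otimes> f k0 (\<pi> (y j))) \<in> corner_radical R (e k) (e j)"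
      using ee kj u f_corner[of k0 j]
      by (intro S.corner_radical_mult_right[where f="e k0"] S.corner_mult) auto
    then have "(f k (\<pi> (y j)) \<ominus> (if k = j then e k else \<zero>))
        \<ominus> f k (\<pi> (y k0)) \<otimes> (u \<otimes> f k0 (\<pi> (y j))) \<in> corner_radical R (e k) (e j)"
      using S.corner_radical_minus[OF e ee id[of k j]] kj by (simp add: \<pi>_def)
    moreover have "f k (set_residual M (insert s S) (y j))
        = f k (\<pi> (y j)) \<ominus> f k (\<pi> (y k0)) \<otimes> (u \<otimes> f k0 (\<pi> (y j)))"
      using kj y f \<pi> uc fc
      by (simp add: res S.functional_minus S.functional_smult)
    moreover have "\<And>a b c. a \<in> carrier R \<Longrightarrow> b \<in> carrier R \<Longrightarrow> c \<in> carrier R \<Longrightarrow>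
        a \<ominus> b \<ominus> c = a \<ominus> c \<ominus> b"
      by (simp add: a_minus_def S.R.a_ac)
    ultimately show "f k (set_residual M (insert s S) (y j)) \<ominus> (if k = j then e k else \<zero>)
        \<in> corner_radical R (e k) (e j)"
      using kj fc uc ee by simp
  qed (use S s e y f in auto)
  then obtain S' where S': "insert s S \<subseteq> S'" "finite S'" "biorthogonal_set R M S'"
      "fst ` S' \<subseteq> fst ` (insert s S) \<union> e ` K" "\<forall>k\<in>K. set_component M S' (y k) = y k"
    by blast
  interpret S': biorthogonal R M S' fst "\<lambda>s. fst (snd s)" "\<lambda>s. snd (snd s)" by (rule S'(3))
  have "set_component M S' (y k0) = y k0"
    using S'.component_mono[OF S'(2,1) subset_refl _ s(2)] y by auto
  then show ?case using S' fst_s by (intro exI[of _ S']) auto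
qed


section \<open>Direct sums, powers and dual bases\<close>

lemma projective_right_module: "projective R P \<Longrightarrow> right_module R P"
  by (simp add: projective_def)

lemma module_sum_simps [simp]:
  "carrier (module_sum M N) = carrier M \<times> carrier N"
  "\<zero>\<^bsub>module_sum M N\<^esub> = (\<zero>\<^bsub>M\<^esub>, \<zero>\<^bsub>N\<^esub>)"
  "p \<oplus>\<^bsub>module_sum M N\<^esub> q = (fst p \<oplus>\<^bsub>M\<^esub> fst q, snd p \<oplus>\<^bsub>N\<^esub> snd q)"
  "a \<odot>\<^bsub>module_sum M N\<^esub> p = (a \<odot>\<^bsub>M\<^esub> fst p, a \<odot>\<^bsub>N\<^esub> snd p)"
  by (simp_all add: module_sum_def case_prod_beta)

lemma right_module_module_sum:
  assumes "right_module R M" "right_module R N"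
  shows "right_module R (module_sum M N)"
proof -
  interpret M: right_module R M by fact
  interpret N: right_module R N by fact
  have "abelian_group (module_sum M N)"
  proof (rule abelian_groupI)
    fix p assume "p \<in> carrier (module_sum M N)"
    then show "\<exists>q\<in>carrier (module_sum M N). q \<oplus>\<^bsub>module_sum M N\<^esub> p = \<zero>\<^bsub>module_sum M N\<^esub>"
      by (intro bexI[of _ "(\<ominus>\<^bsub>M\<^esub> fst p, \<ominus>\<^bsub>N\<^esub> snd p)"]) (auto simp: M.M.l_neg N.M.l_neg)
  qed (auto simp: M.M.a_ac N.M.a_ac)
  then show ?thesis
    by (intro right_moduleI M.R.ring_axioms)
      (auto simp: M.smult_l_distr N.smult_l_distr M.smult_r_distr N.smult_r_distr
        M.smult_assoc N.smult_assoc)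
qed

lemma module_power_simps [simp]:
  "carrier (module_power I M) = {x \<in> I \<rightarrow>\<^sub>E carrier M. finite {i \<in> I. x i \<noteq> \<zero>\<^bsub>M\<^esub>}}"
  "\<zero>\<^bsub>module_power I M\<^esub> = (\<lambda>i\<in>I. \<zero>\<^bsub>M\<^esub>)"
  "x \<oplus>\<^bsub>module_power I M\<^esub> x' = (\<lambda>i\<in>I. x i \<oplus>\<^bsub>M\<^esub> x' i)"
  "a \<odot>\<^bsub>module_power I M\<^esub> x = (\<lambda>i\<in>I. a \<odot>\<^bsub>M\<^esub> x i)"
  by (simp_all add: module_power_def)

lemma right_module_module_power:
  assumes "right_module R M"
  shows "right_module R (module_power I M)"
proof -
  interpret M: right_module R M by fact
  have add: "(\<lambda>i\<in>I. x i \<oplus>\<^bsub>M\<^esub> x' i) \<in> carrier (module_power I M)"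
    if "x \<in> carrier (module_power I M)" "x' \<in> carrier (module_power I M)" for x x'
    using that by (auto simp: PiE_iff
        intro!: finite_subset[OF _ finite_UnI[of "{i \<in> I. x i \<noteq> \<zero>\<^bsub>M\<^esub>}" "{i \<in> I. x' i \<noteq> \<zero>\<^bsub>M\<^esub>}"]])
  have smult: "(\<lambda>i\<in>I. a \<odot>\<^bsub>M\<^esub> x i) \<in> carrier (module_power I M)"
    if "a \<in> carrier R" "x \<in> carrier (module_power I M)" for a x
    using that by (auto simp: PiE_iff intro!: finite_subset[of _ "{i \<in> I. x i \<noteq> \<zero>\<^bsub>M\<^esub>}"])
  have ext: "x = x'" if "x \<in> carrier (module_power I M)" "x' \<in> carrier (module_power I M)"
    "\<And>i. i \<in> I \<Longrightarrow> x i = x' i" for x x'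
    using that by (auto intro: PiE_ext)
  have val: "x i \<in> carrier M" if "x \<in> carrier (module_power I M)" "i \<in> I" for x i
    using that by auto
  have zero: "(\<lambda>i\<in>I. \<zero>\<^bsub>M\<^esub>) \<in> carrier (module_power I M)" by auto
  note simps = module_power_simps(2-4)
  have "abelian_group (module_power I M)"
  proof (rule abelian_groupI, unfold simps)
    fix x assume x: "x \<in> carrier (module_power I M)"
    show "\<exists>x'\<in>carrier (module_power I M). (\<lambda>i\<in>I. x' i \<oplus>\<^bsub>M\<^esub> x i) = (\<lambda>i\<in>I. \<zero>\<^bsub>M\<^esub>)"
      using val[OF x] smult[of "\<ominus>\<^bsub>R\<^esub> \<one>\<^bsub>R\<^esub>" x] x
      by (intro bexI[of _ "\<lambda>i\<in>I. (\<ominus>\<^bsub>R\<^esub> \<one>\<^bsub>R\<^esub>) \<odot>\<^bsub>M\<^esub> x i"])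
        (auto simp del: module_power_simps simp: M.smult_l_minus M.M.l_neg)
    show "(\<lambda>i\<in>I. (\<lambda>i\<in>I. \<zero>\<^bsub>M\<^esub>) i \<oplus>\<^bsub>M\<^esub> x i) = x"
      using x val[OF x] by (intro ext[OF add[OF zero]]) auto
  qed (use add zero val in \<open>auto simp del: module_power_simps simp: M.M.a_ac intro!: restrict_ext\<close>)
  then show ?thesis
  proof (intro right_moduleI M.R.ring_axioms, unfold simps)
    fix x assume x: "x \<in> carrier (module_power I M)"
    show "(\<lambda>i\<in>I. \<one>\<^bsub>R\<^esub> \<odot>\<^bsub>M\<^esub> x i) = x"
      using val[OF x] x by (intro ext[OF smult]) (auto simp del: module_power_simps)
  qed (use smult val in \<open>auto simp del: module_power_simps simp: M.smult_l_distr M.smult_r_distr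
        M.smult_assoc intro!: restrict_ext\<close>)
qed

text \<open>
  The coordinates of a free module that contains \<open>P\<close> as a direct summand, together with the projections
  of its basis elements.
\<close>

lemma projective_dual_basis:
  fixes R (structure) and P :: "('a, 'm) module"
  assumes "projective R P" "x \<in> carrier P"
  obtains F :: "'m set" and y :: "'m \<Rightarrow> 'm" and f :: "'m \<Rightarrow> 'm \<Rightarrow> 'a"
  where "finite F" "\<And>b. b \<in> F \<Longrightarrow> y b \<in> carrier P" "\<And>b. b \<in> F \<Longrightarrow> f b \<in> functionals R P"
    "x = (\<Oplus>\<^bsub>P\<^esub>b\<in>F. f b x \<odot>\<^bsub>P\<^esub> y b)"
proof -
  interpret P: right_module R P using assms(1) by (rule projective_right_module)
  obtain X :: "'m set" and Q :: "('a, 'm \<Rightarrow> 'a) module" and \<theta>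
    where Q: "right_module R Q" and \<theta>: "\<theta> \<in> module_hom R (module_sum P Q) (module_power X (regular_module R))"
      "bij_betw \<theta> (carrier (module_sum P Q)) (carrier (module_power X (regular_module R)))"
    using assms(1) unfolding projective_def module_isomorphic_def by blast
  interpret Q: right_module R Q by fact
  let ?F = "module_power X (regular_module R)"
  interpret F: right_module R ?F
    by (intro right_module_module_power right_module_regular_module P.R.ring_axioms)
  define \<theta>' where "\<theta>' = inv_into (carrier (module_sum P Q)) \<theta>"
  have \<theta>': "\<theta>' \<in> module_hom R ?F (module_sum P Q)"
    unfolding \<theta>'_def using right_module_module_sum[OF P.right_module_axioms Q] \<theta> by (rule module_hom_inverse)
  have \<theta>'\<theta>: "\<theta>' (\<theta> p) = p" if "p \<in> carrier (module_sum P Q)" for p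
    unfolding \<theta>'_def using \<theta>(2) that by (rule bij_betw_inv_into_left)
  define p where "p c = fst (\<theta>' c)" for c
  have p: "p \<in> module_hom R ?F P"
  proof (rule module_homI)
    show "p c \<in> carrier P" if "c \<in> carrier ?F" for c
      using module_hom_closed[OF \<theta>' that] by (simp add: p_def mem_Times_iff)
    show "p (c \<oplus>\<^bsub>?F\<^esub> c') = p c \<oplus>\<^bsub>P\<^esub> p c'" if "c \<in> carrier ?F" "c' \<in> carrier ?F" for c c'
      using module_hom_add[OF \<theta>' that] by (simp only: p_def module_sum_simps fst_conv)
    show "p (a \<odot>\<^bsub>?F\<^esub> c) = a \<odot>\<^bsub>P\<^esub> p c" if "a \<in> carrier R" "c \<in> carrier ?F" for a c
      using module_hom_smult[OF \<theta>' that] by (simp only: p_def module_sum_simps fst_conv)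
  qed
  define i where "i z = \<theta> (z, \<zero>\<^bsub>Q\<^esub>)" for z
  have i_closed: "i z \<in> carrier ?F" if "z \<in> carrier P" for z
    unfolding i_def using that by (intro module_hom_closed[OF \<theta>(1)]) simp
  have i_add: "i (z \<oplus>\<^bsub>P\<^esub> z') = i z \<oplus>\<^bsub>?F\<^esub> i z'" if "z \<in> carrier P" "z' \<in> carrier P" for z z'
    unfolding i_def using that module_hom_add[OF \<theta>(1), of "(z, \<zero>\<^bsub>Q\<^esub>)" "(z', \<zero>\<^bsub>Q\<^esub>)"] by simp
  have i_smult: "i (a \<odot>\<^bsub>P\<^esub> z) = a \<odot>\<^bsub>?F\<^esub> i z" if "a \<in> carrier R" "z \<in> carrier P" for a z
    unfolding i_def using that module_hom_smult[OF \<theta>(1), of a "(z, \<zero>\<^bsub>Q\<^esub>)"] by simp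
  have pi: "p (i z) = z" if "z \<in> carrier P" for z
    using \<theta>'\<theta>[of "(z, \<zero>\<^bsub>Q\<^esub>)"] that by (simp add: p_def i_def)
  define f where "f b z = i z b" for b z
  have f: "f b \<in> functionals R P" if "b \<in> X" for b
    unfolding f_def
  proof (rule P.functionalI)
    show "i z b \<in> carrier R" if "z \<in> carrier P" for z using i_closed[OF that] \<open>b \<in> X\<close> by auto
    show "i (z \<oplus>\<^bsub>P\<^esub> z') b = i z b \<oplus> i z' b" if "z \<in> carrier P" "z' \<in> carrier P" for z z'
      using i_add[OF that] \<open>b \<in> X\<close> by simp
    show "i (a \<odot>\<^bsub>P\<^esub> z) b = i z b \<otimes> a" if "a \<in> carrier R" "z \<in> carrier P" for a z
      using i_smult[OF that] \<open>b \<in> X\<close> by simp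
  qed
  define d where "d b = (\<lambda>c\<in>X. if c = b then \<one> else \<zero>)" for b
  have d: "d b \<in> carrier ?F" if "b \<in> X" for b
    using finite_subset[of "{i \<in> X. d b i \<noteq> \<zero>}" "{b}"] by (auto simp: d_def)
  define F where "F = {b \<in> X. i x b \<noteq> \<zero>}"
  have F: "finite F" "F \<subseteq> X" using i_closed[OF assms(2)] by (auto simp: F_def)
  have sum: "(\<Oplus>\<^bsub>?F\<^esub>b\<in>G. i x b \<odot>\<^bsub>?F\<^esub> d b) = (\<lambda>c\<in>X. if c \<in> G then i x c else \<zero>)"
    if "finite G" "G \<subseteq> X" for G
    using that
  proof (induction G rule: finite_induct)
    case (insert b G)
    have xc: "i x c \<in> carrier R" if "c \<in> X" for c using i_closed[OF assms(2)] that by auto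
    have "i x c \<odot>\<^bsub>?F\<^esub> d c \<in> carrier ?F" if "c \<in> insert b G" for c
      using insert.prems that by (intro F.smult_closed xc d) auto
    then have "(\<Oplus>\<^bsub>?F\<^esub>b\<in>insert b G. i x b \<odot>\<^bsub>?F\<^esub> d b)
      = i x b \<odot>\<^bsub>?F\<^esub> d b \<oplus>\<^bsub>?F\<^esub> (\<Oplus>\<^bsub>?F\<^esub>b\<in>G. i x b \<odot>\<^bsub>?F\<^esub> d b)"
      using insert.hyps by (intro F.M.finsum_insert) auto
    also have "(\<Oplus>\<^bsub>?F\<^esub>b\<in>G. i x b \<odot>\<^bsub>?F\<^esub> d b) = (\<lambda>c\<in>X. if c \<in> G then i x c else \<zero>)"
      using insert by blast
    also have "i x b \<odot>\<^bsub>?F\<^esub> d b \<oplus>\<^bsub>?F\<^esub> (\<lambda>c\<in>X. if c \<in> G then i x c else \<zero>)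
      = (\<lambda>c\<in>X. if c \<in> insert b G then i x c else \<zero>)"
      using xc insert.hyps insert.prems by (auto simp: d_def)
    finally show ?case .
  qed simp
  have ix: "i x = (\<Oplus>\<^bsub>?F\<^esub>b\<in>F. i x b \<odot>\<^bsub>?F\<^esub> d b)"
    unfolding sum[OF F] using i_closed[OF assms(2)] by (auto simp: F_def PiE_iff extensional_def)
  have smult_d: "i x b \<odot>\<^bsub>?F\<^esub> d b \<in> carrier ?F" if "b \<in> F" for b
    using that F i_closed[OF assms(2)] d by (intro F.smult_closed) auto
  have psum: "p (\<Oplus>\<^bsub>?F\<^esub>b\<in>G. h b) = (\<Oplus>\<^bsub>P\<^esub>b\<in>G. p (h b))" if "finite G" "h \<in> G \<rightarrow> carrier ?F" for G h
    using that
  proof (induction G rule: finite_induct)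
    case empty
    show ?case using module_hom_zero[OF F.right_module_axioms P.right_module_axioms p]
      by (simp del: module_power_simps)
  next
    case (insert b G)
    then have h: "h b \<in> carrier ?F" "h \<in> G \<rightarrow> carrier ?F" by (blast, blast)
    then have "p (\<Oplus>\<^bsub>?F\<^esub>b\<in>insert b G. h b) = p (h b) \<oplus>\<^bsub>P\<^esub> p (\<Oplus>\<^bsub>?F\<^esub>b\<in>G. h b)"
      using insert.hyps F.M.finsum_insert[of G b h] F.M.finsum_closed[of h G]
        module_hom_add[OF p, of "h b"] by metis
    also have "\<dots> = (\<Oplus>\<^bsub>P\<^esub>b\<in>insert b G. p (h b))"
      using insert.hyps insert.IH[OF h(2)] h module_hom_closed[OF p]
      by (subst P.M.finsum_insert) (simp_all add: Pi_iff del: module_power_simps)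
    finally show ?case .
  qed
  have "x = p (i x)" using pi assms(2) by simp
  also have "\<dots> = (\<Oplus>\<^bsub>P\<^esub>b\<in>F. p (i x b \<odot>\<^bsub>?F\<^esub> d b))"
    by (subst ix, rule psum[OF F(1)]) (use smult_d in blast)
  also have "\<dots> = (\<Oplus>\<^bsub>P\<^esub>b\<in>F. f b x \<odot>\<^bsub>P\<^esub> p (d b))"
  proof (rule P.M.finsum_cong')
    show "p (i x b \<odot>\<^bsub>?F\<^esub> d b) = f b x \<odot>\<^bsub>P\<^esub> p (d b)" if "b \<in> F" for b
      unfolding f_def using that F i_closed[OF assms(2)] d
      by (intro module_hom_smult[OF p]) auto
    show "(\<lambda>b. f b x \<odot>\<^bsub>P\<^esub> p (d b)) \<in> F \<rightarrow> carrier P"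
      using F f d module_hom_closed[OF p] assms(2) by (auto intro!: P.smult_closed P.functional_closed)
  qed simp
  finally show thesis
    using that[of F "\<lambda>b. p (d b)" f] F f d module_hom_closed[OF p] by blast
qed


section \<open>Capturing elements in finite biorthogonal families\<close>

text \<open>
  The modules \<open>e R\<close> with \<open>e \<in> E\<close> represent the isomorphism classes of indecomposable projective modules.
  Each axiom is invariant under passage to the opposite ring, which gives access to left modules.
\<close>

locale basic_set = ring R for R :: "('a, 'r) ring_scheme" (structure) +
  fixes E :: "'a set"
  assumes finite_E: "finite E"
    and local_E: "e \<in> E \<Longrightarrow> local_idempotent R e"
    and not_iso_E: "e \<in> E \<Longrightarrow> f \<in> E \<Longrightarrow> e \<noteq> f \<Longrightarrow> corner R e f \<subseteq> corner_radical R e f"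
    and generating_E: "\<exists>(n::nat) c a b. (\<forall>l<n. c l \<in> E \<and> a l \<in> carrier R \<and> b l \<in> carrier R) \<and>
      \<one> = (\<Oplus>l\<in>{..<n}. a l \<otimes> c l \<otimes> b l)"
begin

lemma E_closed [simp]: "e \<in> E \<Longrightarrow> e \<in> carrier R"
  and E_idem: "e \<in> E \<Longrightarrow> e \<otimes> e = e"
  and E_nonzero: "e \<in> E \<Longrightarrow> e \<noteq> \<zero>"
  using local_idempotentD[OF local_E] by auto

end

context basic_set
begin

text \<open>
  In the expansion \<open>x = \<Sum> y\<^sub>b f\<^sub>b(x)\<close> by a dual basis insert \<open>1 = \<Sum> a\<^sub>l c\<^sub>l b\<^sub>l\<close>: the term \<open>y\<^sub>b f\<^sub>b(x)\<close> is the
  sum of the \<open>(y\<^sub>b a\<^sub>l c\<^sub>l) (c\<^sub>l b\<^sub>l f\<^sub>b)(x)\<close>.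
\<close>

lemma projective_representation:
  fixes P :: "('a, 'm) module"
  assumes "projective R P" "x \<in> carrier P"
  obtains n :: nat and c y f
  where "\<And>k. k < n \<Longrightarrow> c k \<in> E" "\<And>k. k < n \<Longrightarrow> y k \<in> carrier P" "\<And>k. k < n \<Longrightarrow> c k \<odot>\<^bsub>P\<^esub> y k = y k"
    "\<And>k. k < n \<Longrightarrow> f k \<in> functionals R P"
    "\<And>k z. k < n \<Longrightarrow> z \<in> carrier P \<Longrightarrow> c k \<otimes> f k z = f k z"
    "x = (\<Oplus>\<^bsub>P\<^esub>k\<in>{..<n}. f k x \<odot>\<^bsub>P\<^esub> y k)"
proof -
  interpret P: right_module R P using assms(1) by (rule projective_right_module)
  define good where "good c v h \<longleftrightarrow> c \<in> E \<and> v \<in> carrier P \<and> c \<odot>\<^bsub>P\<^esub> v = v \<and>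
    h \<in> functionals R P \<and> (\<forall>z\<in>carrier P. c \<otimes> h z = h z)" for c v h
  define rep where "rep z \<longleftrightarrow> (\<exists>(n::nat) c y f. (\<forall>k<n. good (c k) (y k) (f k)) \<and>
    z = (\<Oplus>\<^bsub>P\<^esub>k\<in>{..<n}. f k x \<odot>\<^bsub>P\<^esub> y k))" for z
  define addable where "addable t \<longleftrightarrow> t \<in> carrier P \<and> (\<forall>z. rep z \<longrightarrow> rep (z \<oplus>\<^bsub>P\<^esub> t))" for t
  have good_closed: "h x \<odot>\<^bsub>P\<^esub> v \<in> carrier P" if "good c v h" for c v h
    using that assms(2) by (auto simp: good_def)
  have rep_closed: "z \<in> carrier P" if "rep z" for z
    using that good_closed unfolding rep_def by (auto intro!: P.M.finsum_closed)
  have addable_good: "addable (h x \<odot>\<^bsub>P\<^esub> v)" if g: "good c v h" for c v h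
    unfolding addable_def
  proof (intro conjI allI impI)
    show "h x \<odot>\<^bsub>P\<^esub> v \<in> carrier P" using g by (rule good_closed)
    fix z assume "rep z"
    then obtain n :: nat and d y f where
      *: "\<And>k. k < n \<Longrightarrow> good (d k) (y k) (f k)" "z = (\<Oplus>\<^bsub>P\<^esub>k\<in>{..<n}. f k x \<odot>\<^bsub>P\<^esub> y k)"
      unfolding rep_def by blast
    have "(\<Oplus>\<^bsub>P\<^esub>k\<in>{..<Suc n}. (f(n := h)) k x \<odot>\<^bsub>P\<^esub> (y(n := v)) k)
      = h x \<odot>\<^bsub>P\<^esub> v \<oplus>\<^bsub>P\<^esub> (\<Oplus>\<^bsub>P\<^esub>k\<in>{..<n}. (f(n := h)) k x \<odot>\<^bsub>P\<^esub> (y(n := v)) k)"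
      unfolding lessThan_Suc using good_closed[OF g] good_closed[OF *(1)]
      by (subst P.M.finsum_insert) auto
    also have "(\<Oplus>\<^bsub>P\<^esub>k\<in>{..<n}. (f(n := h)) k x \<odot>\<^bsub>P\<^esub> (y(n := v)) k) = z"
      unfolding *(2) using good_closed[OF *(1)] by (intro P.M.finsum_cong') auto
    also have "h x \<odot>\<^bsub>P\<^esub> v \<oplus>\<^bsub>P\<^esub> z = z \<oplus>\<^bsub>P\<^esub> h x \<odot>\<^bsub>P\<^esub> v"
      using good_closed[OF g] rep_closed[OF \<open>rep z\<close>] by (rule P.M.a_comm)
    finally show "rep (z \<oplus>\<^bsub>P\<^esub> h x \<odot>\<^bsub>P\<^esub> v)"
      unfolding rep_def using * g
      by (intro exI[of _ "Suc n"] exI[of _ "d(n := c)"] exI[of _ "y(n := v)"] exI[of _ "f(n := h)"])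
        (simp add: less_Suc_eq)
  qed
  have addable_sum: "addable (\<Oplus>\<^bsub>P\<^esub>i\<in>G. t i)" if "finite G" "\<And>i. i \<in> G \<Longrightarrow> addable (t i)" for G :: "'i set" and t
    using that
  proof (induction G rule: finite_induct)
    case empty
    then show ?case by (simp add: addable_def rep_closed)
  next
    case (insert i G)
    have t: "t i \<in> carrier P" "t \<in> G \<rightarrow> carrier P" using insert.prems by (auto simp: addable_def)
    have "addable (t i)" "addable (\<Oplus>\<^bsub>P\<^esub>i\<in>G. t i)" using insert by auto
    then have "addable (t i \<oplus>\<^bsub>P\<^esub> (\<Oplus>\<^bsub>P\<^esub>i\<in>G. t i))"
      unfolding addable_def using rep_closed by (metis P.M.a_assoc P.M.a_closed)
    then show ?case using insert.hyps t by simp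
  qed
  obtain n :: nat and c a b where gen: "\<And>l. l < n \<Longrightarrow> c l \<in> E" "\<And>l. l < n \<Longrightarrow> a l \<in> carrier R"
    "\<And>l. l < n \<Longrightarrow> b l \<in> carrier R" "\<one> = (\<Oplus>l\<in>{..<n}. a l \<otimes> c l \<otimes> b l)"
    using generating_E by blast
  have addable_term: "addable (h x \<odot>\<^bsub>P\<^esub> v)" if h: "h \<in> functionals R P" and v: "v \<in> carrier P" for h v
  proof -
    have hx: "h x \<in> carrier R" using h assms(2) by simp
    have "h x \<odot>\<^bsub>P\<^esub> v = (\<one> \<otimes> h x) \<odot>\<^bsub>P\<^esub> v" using hx by simp
    also have "\<dots> = (\<Oplus>l\<in>{..<n}. a l \<otimes> c l \<otimes> b l \<otimes> h x) \<odot>\<^bsub>P\<^esub> v"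
      unfolding gen(4) using gen hx by (subst finsum_ldistr) auto
    also have "\<dots> = (\<Oplus>\<^bsub>P\<^esub>l\<in>{..<n}. (a l \<otimes> c l \<otimes> b l \<otimes> h x) \<odot>\<^bsub>P\<^esub> v)"
      using gen hx v by (subst P.finsum_smult) auto
    finally have eq: "h x \<odot>\<^bsub>P\<^esub> v = (\<Oplus>\<^bsub>P\<^esub>l\<in>{..<n}. (a l \<otimes> c l \<otimes> b l \<otimes> h x) \<odot>\<^bsub>P\<^esub> v)" .
    have "addable ((a l \<otimes> c l \<otimes> b l \<otimes> h x) \<odot>\<^bsub>P\<^esub> v)" if l: "l < n" for l
    proof -
      have ca: "c l \<in> carrier R" "a l \<in> carrier R" "b l \<in> carrier R" "c l \<otimes> c l = c l"
        using gen(1-3)[OF l] E_idem by auto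
      have cc: "c l \<otimes> (c l \<otimes> r) = c l \<otimes> r" if "r \<in> carrier R" for r
        using m_assoc[of "c l" "c l" r] ca that by metis
      have "good (c l) ((a l \<otimes> c l) \<odot>\<^bsub>P\<^esub> v) (\<lambda>z. c l \<otimes> b l \<otimes> h z)"
        unfolding good_def
      proof (intro conjI ballI)
        show "c l \<in> E" using gen l by simp
        show "(a l \<otimes> c l) \<odot>\<^bsub>P\<^esub> v \<in> carrier P" using ca v by simp
        show "c l \<odot>\<^bsub>P\<^esub> ((a l \<otimes> c l) \<odot>\<^bsub>P\<^esub> v) = (a l \<otimes> c l) \<odot>\<^bsub>P\<^esub> v"
          using ca v by (simp add: m_assoc flip: P.smult_assoc)
        show "(\<lambda>z. c l \<otimes> b l \<otimes> h z) \<in> functionals R P"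
          using ca h by (intro P.functional_scale) auto
        show "c l \<otimes> (c l \<otimes> b l \<otimes> h z) = c l \<otimes> b l \<otimes> h z" if "z \<in> carrier P" for z
          using ca h that by (simp add: m_assoc cc)
      qed
      from addable_good[OF this] show ?thesis
        using ca v hx by (simp add: m_assoc cc flip: P.smult_assoc)
    qed
    then show ?thesis unfolding eq by (intro addable_sum) auto
  qed
  obtain F :: "'m set" and y :: "'m \<Rightarrow> 'm" and f :: "'m \<Rightarrow> 'm \<Rightarrow> 'a"
    where F: "finite F" "\<And>b. b \<in> F \<Longrightarrow> y b \<in> carrier P" "\<And>b. b \<in> F \<Longrightarrow> f b \<in> functionals R P"
    "x = (\<Oplus>\<^bsub>P\<^esub>b\<in>F. f b x \<odot>\<^bsub>P\<^esub> y b)"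
    using projective_dual_basis[OF assms] by blast
  have "addable x" by (subst F(4)) (intro addable_sum F(1) addable_term F(2,3))
  moreover have "rep \<zero>\<^bsub>P\<^esub>" unfolding rep_def by (intro exI[of _ 0]) simp
  ultimately have "rep x" using assms(2) P.M.l_zero[of x] unfolding addable_def by metis
  then show thesis using that unfolding rep_def good_def by blast
qed

text \<open>
  Let \<open>\<pi>\<close> be the projection along the span of \<open>S\<close> and \<open>r = \<pi> x\<close>. Choose an expression
  \<open>r = \<Sum> \<pi>(y\<^sub>k) f\<^sub>k(r)\<close> with as few summands as possible, and let \<open>B\<close> be the matrix \<open>f\<^sub>k(\<pi>(y\<^sub>j))\<close> minus the
  identity. It annihilates the column of the \<open>f\<^sub>j(r)\<close>. If an entry \<open>B k j\<close> were outside the radical,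
  hence invertible, then \<open>f\<^sub>j(r)\<close> could be expressed by the other \<open>f\<^sub>i(r)\<close> and the summand \<open>j\<close> be
  absorbed by the others. So \<open>B\<close> has entries in the radical, and Gram-Schmidt applies.
\<close>

theorem biorthogonal_set_extend_spanning:
  fixes P :: "('a, 'm) module"
  assumes P: "projective R P" and S: "finite S" "biorthogonal_set R P S" "fst ` S \<subseteq> E"
    and x: "x \<in> carrier P"
  shows "\<exists>S'. S \<subseteq> S' \<and> finite S' \<and> biorthogonal_set R P S' \<and> fst ` S' \<subseteq> E \<and> set_component P S' x = x"
proof -
  interpret S: biorthogonal R P S fst "\<lambda>s. fst (snd s)" "\<lambda>s. snd (snd s)" by (rule S(2))
  define \<pi> where "\<pi> = set_residual P S"
  have \<pi>: "\<pi> z \<in> carrier P" "\<pi> (\<pi> z) = \<pi> z" if "z \<in> carrier P" for z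
    using that S(1) by (simp_all add: \<pi>_def S.residual_residual)
  define r where "r = \<pi> x"
  have r: "r \<in> carrier P" "\<pi> r = r" using \<pi> x by (simp_all add: r_def)
  define good where "good K c y f \<longleftrightarrow> finite K \<and> (\<forall>k\<in>K. c k \<in> E \<and> y k \<in> carrier P \<and> c k \<odot>\<^bsub>P\<^esub> y k = y k \<and>
    f k \<in> functionals R P \<and> (\<forall>z\<in>carrier P. c k \<otimes> f k z = f k z)) \<and>
    r = (\<Oplus>\<^bsub>P\<^esub>k\<in>K. f k r \<odot>\<^bsub>P\<^esub> \<pi> (y k))" for K :: "nat set" and c y f
  obtain n :: nat and c0 y0 f0 where 0:
    "\<And>k. k < n \<Longrightarrow> c0 k \<in> E" "\<And>k. k < n \<Longrightarrow> y0 k \<in> carrier P" "\<And>k. k < n \<Longrightarrow> c0 k \<odot>\<^bsub>P\<^esub> y0 k = y0 k"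
    "\<And>k. k < n \<Longrightarrow> f0 k \<in> functionals R P"
    "\<And>k z. k < n \<Longrightarrow> z \<in> carrier P \<Longrightarrow> c0 k \<otimes> f0 k z = f0 k z"
    "r = (\<Oplus>\<^bsub>P\<^esub>k\<in>{..<n}. f0 k r \<odot>\<^bsub>P\<^esub> y0 k)"
    using projective_representation[OF P r(1)] by blast
  have "\<pi> (\<Oplus>\<^bsub>P\<^esub>k\<in>{..<n}. f0 k r \<odot>\<^bsub>P\<^esub> y0 k) = (\<Oplus>\<^bsub>P\<^esub>k\<in>{..<n}. \<pi> (f0 k r \<odot>\<^bsub>P\<^esub> y0 k))"
    unfolding \<pi>_def using 0 r(1) by (intro S.residual_finsum[OF S(1) subset_refl]) auto
  also have "\<dots> = (\<Oplus>\<^bsub>P\<^esub>k\<in>{..<n}. f0 k r \<odot>\<^bsub>P\<^esub> \<pi> (y0 k))"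
    using 0(2,4) r(1) \<pi> S.residual_smult[OF S(1) subset_refl]
    by (intro S.M.finsum_cong') (auto simp: \<pi>_def)
  finally have "good {..<n} c0 y0 f0" unfolding good_def using 0 r(2) by auto
  \<comment> \<open>The summands are indexed by a finite set \<open>K\<close>, from which a redundant index can be removed.\<close>
  then obtain K c y f where K: "good K c y f"
    and least: "\<And>K' c' y' f'. good K' c' y' f' \<Longrightarrow> card K \<le> card K'"
    using exists_least_iff[of "\<lambda>m. \<exists>K c y f. good K c y f \<and> card K = m"]
    by (metis linorder_not_less)
  have fin: "finite K" and c: "c k \<in> E" and y: "y k \<in> carrier P" "c k \<odot>\<^bsub>P\<^esub> y k = y k"
    and f: "f k \<in> functionals R P" "z \<in> carrier P \<Longrightarrow> c k \<otimes> f k z = f k z"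
    if "k \<in> K" for k z using K that unfolding good_def by blast+
  have fin: "finite K" using K unfolding good_def by blast
  have sum: "r = (\<Oplus>\<^bsub>P\<^esub>k\<in>K. f k r \<odot>\<^bsub>P\<^esub> \<pi> (y k))" using K unfolding good_def by blast
  have fr: "f k r \<in> carrier R" if "k \<in> K" for k using f(1)[OF that] r(1) by simp
  define B where "B k j = f k (\<pi> (y j)) \<ominus> (if k = j then c k else \<zero>)" for k j
  have B: "B k j \<in> corner R (c k) (c j)" if "k \<in> K" "j \<in> K" for k j
  proof -
    have "c j \<odot>\<^bsub>P\<^esub> \<pi> (y j) = \<pi> (y j)"
      using S.residual_smult[OF S(1) subset_refl, of "c j" "y j"] y c that by (simp add: \<pi>_def)
    then have "f k (\<pi> (y j)) \<in> corner R (c k) (c j)"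
      using f y c that \<pi> S.functional_smult[of "f k" "c j" "\<pi> (y j)"] by (auto simp: corner_def)
    moreover have "(if k = j then c k else \<zero>) \<in> corner R (c k) (c j)"
      using c that E_idem by (auto simp: corner_def)
    ultimately show ?thesis unfolding B_def using c that by (intro corner_minus) auto
  qed
  have Bc: "B k j \<in> carrier R" if "k \<in> K" "j \<in> K" for k j using B[OF that] by (rule corner_closed)
  have fy: "f k (\<pi> (y j)) \<in> carrier R" if "k \<in> K" "j \<in> K" for k j
    using f(1) \<pi>(1) y(1) that by simp
  have Bsum: "(\<Oplus>i\<in>K. B k i \<otimes> f i r) = \<zero>" if k: "k \<in> K" for k
  proof -
    have "f k r = f k (\<Oplus>\<^bsub>P\<^esub>i\<in>K. f i r \<odot>\<^bsub>P\<^esub> \<pi> (y i))" using sum by simp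
    also have "\<dots> = (\<Oplus>i\<in>K. f k (f i r \<odot>\<^bsub>P\<^esub> \<pi> (y i)))"
      using fr y \<pi> by (intro S.functional_finsum f(1)[OF k]) auto
    also have "\<dots> = (\<Oplus>i\<in>K. f k (\<pi> (y i)) \<otimes> f i r)"
      using f(1)[OF k] fr y \<pi> fy[OF k] by (intro finsum_cong') (auto simp: S.functional_smult)
    also have "\<dots> = (\<Oplus>i\<in>K. B k i \<otimes> f i r \<oplus> (if k = i then f i r else \<zero>))"
    proof (intro finsum_cong')
      fix i assume i: "i \<in> K"
      then show "f k (\<pi> (y i)) \<otimes> f i r = B k i \<otimes> f i r \<oplus> (if k = i then f i r else \<zero>)"
        using f(2)[OF k r(1)] fr[OF i] fy[OF k i] c[OF i] unfolding B_def
        by (auto simp: a_minus_def l_distr l_minus a_assoc l_neg)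
    qed (use Bc fr k in auto)
    also have "\<dots> = (\<Oplus>i\<in>K. B k i \<otimes> f i r) \<oplus> (\<Oplus>i\<in>K. if k = i then f i r else \<zero>)"
      using Bc fr k by (intro finsum_addf) auto
    also have "(\<Oplus>i\<in>K. if k = i then f i r else \<zero>) = f k r"
      using fr k fin by (intro finsum_singleton) auto
    finally have "f k r = (\<Oplus>i\<in>K. B k i \<otimes> f i r) \<oplus> f k r" .
    moreover have "(\<Oplus>i\<in>K. B k i \<otimes> f i r) \<in> carrier R" using Bc fr k by (intro finsum_closed) auto
    ultimately show ?thesis using add.r_cancel_one' fr[OF k] by metis
  qed
  have rad: "B k j \<in> corner_radical R (c k) (c j)" if kj: "k \<in> K" "j \<in> K" for k j
  proof (rule ccontr)
    assume "B k j \<notin> corner_radical R (c k) (c j)"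
    then obtain b where b: "b \<in> corner R (c j) (c k)" "b \<otimes> B k j = c j"
      using corner_iso_if_not_radical[OF local_E local_E B] c kj by metis
    have bc: "b \<in> carrier R" using b corner_closed by auto
    define d where "d i = b \<otimes> B k i" for i
    have d: "d i \<in> corner R (c j) (c i)" if "i \<in> K" for i
      unfolding d_def using b B c kj that by (intro corner_mult) auto
    have dc: "d i \<in> carrier R" if "i \<in> K" for i using d[OF that] by (rule corner_closed)
    have "b \<otimes> (\<Oplus>i\<in>K. B k i \<otimes> f i r) = (\<Oplus>i\<in>K. b \<otimes> (B k i \<otimes> f i r))"
      using Bc fr kj bc fin by (intro finsum_rdistr) auto
    also have "\<dots> = (\<Oplus>i\<in>K. d i \<otimes> f i r)"
      unfolding d_def using Bc fr kj bc by (intro finsum_cong') (auto simp: m_assoc)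
    finally have dsum: "(\<Oplus>i\<in>K. d i \<otimes> f i r) = \<zero>" using Bsum kj bc by simp
    have "(\<Oplus>i\<in>insert j (K - {j}). d i \<otimes> f i r) = d j \<otimes> f j r \<oplus> (\<Oplus>i\<in>K - {j}. d i \<otimes> f i r)"
      using fin kj dc fr by (intro finsum_insert) auto
    moreover have "d j \<otimes> f j r = f j r" using b(2) f(2)[OF kj(2) r(1)] by (simp add: d_def)
    ultimately have "f j r \<oplus> (\<Oplus>i\<in>K - {j}. d i \<otimes> f i r) = \<zero>"
      using dsum kj by (simp add: insert_absorb)
    moreover have dsc: "(\<Oplus>i\<in>K - {j}. d i \<otimes> f i r) \<in> carrier R"
      using dc fr by (intro finsum_closed) auto
    ultimately have fj: "f j r = \<ominus> (\<Oplus>i\<in>K - {j}. d i \<otimes> f i r)"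
      using minus_equality[of "f j r" "\<Oplus>i\<in>K - {j}. d i \<otimes> f i r"] fr kj by simp
    also have "\<dots> = (\<ominus> \<one>) \<otimes> (\<Oplus>i\<in>K - {j}. d i \<otimes> f i r)" using dsc by (simp add: l_minus)
    also have "\<dots> = (\<Oplus>i\<in>K - {j}. (\<ominus> \<one>) \<otimes> (d i \<otimes> f i r))"
      using dc fr fin by (intro finsum_rdistr) auto
    also have "\<dots> = (\<Oplus>i\<in>K - {j}. (\<ominus> d i) \<otimes> f i r)"
      using dc fr by (intro finsum_cong') (auto simp: l_minus)
    finally have fj: "f j r = (\<Oplus>i\<in>K - {j}. (\<ominus> d i) \<otimes> f i r)" .
    define y' where "y' i = y i \<oplus>\<^bsub>P\<^esub> (\<ominus> d i) \<odot>\<^bsub>P\<^esub> y j" for i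
    have y': "y' i \<in> carrier P" "c i \<odot>\<^bsub>P\<^esub> y' i = y' i" if i: "i \<in> K" for i
    proof -
      show "y' i \<in> carrier P" unfolding y'_def using y dc kj i by simp
      have "(\<ominus> d i) \<otimes> c i = \<ominus> d i" using d[OF i] c[OF i] dc[OF i] by (simp add: corner_def l_minus)
      then have "c i \<odot>\<^bsub>P\<^esub> ((\<ominus> d i) \<odot>\<^bsub>P\<^esub> y j) = (\<ominus> d i) \<odot>\<^bsub>P\<^esub> y j"
        using y(1)[OF kj(2)] dc[OF i] c[OF i] by (simp flip: S.smult_assoc)
      then show "c i \<odot>\<^bsub>P\<^esub> y' i = y' i"
        unfolding y'_def using y dc kj i c by (simp add: S.smult_r_distr)
    qed
    have \<pi>y': "\<pi> (y' i) = \<pi> (y i) \<oplus>\<^bsub>P\<^esub> (\<ominus> d i) \<odot>\<^bsub>P\<^esub> \<pi> (y j)" if "i \<in> K" for i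
      unfolding y'_def \<pi>_def using y dc kj that
      by (simp add: S.residual_add[OF S(1) subset_refl] S.residual_smult[OF S(1) subset_refl])
    have "r = (\<Oplus>\<^bsub>P\<^esub>k\<in>insert j (K - {j}). f k r \<odot>\<^bsub>P\<^esub> \<pi> (y k))"
      using sum kj by (simp add: insert_absorb)
    also have "\<dots> = f j r \<odot>\<^bsub>P\<^esub> \<pi> (y j) \<oplus>\<^bsub>P\<^esub> (\<Oplus>\<^bsub>P\<^esub>i\<in>K - {j}. f i r \<odot>\<^bsub>P\<^esub> \<pi> (y i))"
      using fin kj y \<pi> fr by (intro S.M.finsum_insert) auto
    also have "f j r \<odot>\<^bsub>P\<^esub> \<pi> (y j) = (\<Oplus>\<^bsub>P\<^esub>i\<in>K - {j}. ((\<ominus> d i) \<otimes> f i r) \<odot>\<^bsub>P\<^esub> \<pi> (y j))"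
      unfolding fj using dc fr y kj \<pi> by (intro S.finsum_smult) auto
    also have "\<dots> \<oplus>\<^bsub>P\<^esub> (\<Oplus>\<^bsub>P\<^esub>i\<in>K - {j}. f i r \<odot>\<^bsub>P\<^esub> \<pi> (y i))
      = (\<Oplus>\<^bsub>P\<^esub>i\<in>K - {j}. ((\<ominus> d i) \<otimes> f i r) \<odot>\<^bsub>P\<^esub> \<pi> (y j) \<oplus>\<^bsub>P\<^esub> f i r \<odot>\<^bsub>P\<^esub> \<pi> (y i))"
      using dc fr y kj \<pi> by (intro S.M.finsum_addf[symmetric]) auto
    also have "\<dots> = (\<Oplus>\<^bsub>P\<^esub>i\<in>K - {j}. f i r \<odot>\<^bsub>P\<^esub> \<pi> (y' i))"
    proof (intro S.M.finsum_cong')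
      fix i assume "i \<in> K - {j}"
      then show "((\<ominus> d i) \<otimes> f i r) \<odot>\<^bsub>P\<^esub> \<pi> (y j) \<oplus>\<^bsub>P\<^esub> f i r \<odot>\<^bsub>P\<^esub> \<pi> (y i) = f i r \<odot>\<^bsub>P\<^esub> \<pi> (y' i)"
        using dc fr y kj \<pi> by (simp add: \<pi>y' S.smult_r_distr S.smult_assoc S.M.a_comm)
    qed (use fr \<pi> y' in auto)
    finally have "good (K - {j}) c y' f" unfolding good_def using fin c y' f by auto
    from least[OF this] show False using card_Diff1_less[OF fin kj(2)] by linarith
  qed
  then have "\<exists>S'. S \<subseteq> S' \<and> finite S' \<and> biorthogonal_set R P S' \<and> fst ` S' \<subseteq> fst ` S \<union> c ` K \<and>
    (\<forall>k\<in>K. set_component P S' (y k) = y k)"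
    using y f local_E[OF c] unfolding B_def \<pi>_def by (intro biorthogonal_set_extend[OF fin S(1,2)])
  then obtain S' where S': "S \<subseteq> S'" "finite S'" "biorthogonal_set R P S'"
    "fst ` S' \<subseteq> fst ` S \<union> c ` K" "\<And>k. k \<in> K \<Longrightarrow> set_component P S' (y k) = y k" by blast
  interpret S': biorthogonal R P S' fst "\<lambda>s. fst (snd s)" "\<lambda>s. snd (snd s)" by (rule S'(3))
  note span = S'.spanned_iff_component[OF S'(2)]
  have comp: "set_component P S z \<in> S'.spanned" if "z \<in> carrier P" for z
    unfolding S'.component_def
  proof (rule S.submodule_finsum_closed[OF S'.submodule_spanned], rule funcsetI)
    fix s assume "s \<in> S"
    then show "snd (snd s) z \<odot>\<^bsub>P\<^esub> fst (snd s) \<in> S'.spanned"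
      using S'.submodule_spanned S'.y_in_spanned[of s] S'(1) S'.g_closed[of s z] that
      unfolding S.submodule_iff by blast
  qed
  have "\<pi> (y k) \<in> S'.spanned" if "k \<in> K" for k
    unfolding \<pi>_def S.residual_def using S'(5)[OF that] y[OF that]
    by (intro S.submodule_minus_closed[OF S'.submodule_spanned _ comp]) (auto simp: span)
  then have "r \<in> S'.spanned"
    by (subst sum, intro S.submodule_finsum_closed[OF S'.submodule_spanned] funcsetI)
      (use fr S'.submodule_spanned in \<open>auto simp: S.submodule_iff\<close>)
  then have "set_component P S x \<oplus>\<^bsub>P\<^esub> r \<in> S'.spanned"
    using comp[OF x] S'.submodule_spanned unfolding S.submodule_iff by blast
  then have "x \<in> S'.spanned"
    using S.component_plus_residual[OF S(1) subset_refl x] by (simp add: r_def \<pi>_def)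
  then have "set_component P S' x = x" by (simp only: span)
  moreover have "fst ` S \<union> c ` K \<subseteq> E" using S(3) c by auto
  with S'(4) have "fst ` S' \<subseteq> E" by (rule subset_trans)
  ultimately show ?thesis using S'(1-3) by (intro exI[of _ S'] conjI)
qed

end


section \<open>Frames\<close>

locale frame = biorthogonal R M A e y g
  for R :: "('a, 'r) ring_scheme" (structure) and M :: "('a, 'm) module"
    and A :: "'i set" and e y g +
  assumes carrier_spanned: "carrier M \<subseteq> spanned"
begin

lemma spanning: "x \<in> carrier M \<Longrightarrow> \<exists>F. finite F \<and> F \<subseteq> A \<and> component F x = x"
  using carrier_spanned unfolding spanned_def by blast

lemma submodule_eq_carrier:
  assumes H: "submodule H R M" and y: "y ` A \<subseteq> H"
  shows "H = carrier M"
proof -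
  have "x \<in> H" if x: "x \<in> carrier M" for x
  proof -
    obtain F where F: "finite F" "F \<subseteq> A" "component F x = x" using spanning[OF x] by blast
    have "g s x \<odot>\<^bsub>M\<^esub> y s \<in> H" if "s \<in> F" for s
    proof -
      have "s \<in> A" "y s \<in> H" using that F(2) y by auto
      then show ?thesis using H x by (simp add: submodule_iff)
    qed
    then have "component F x \<in> H"
      unfolding component_def by (intro submodule_finsum_closed[OF H]) auto
    with F show ?thesis by simp
  qed
  then show ?thesis using H unfolding submodule_iff by blast
qed

lemma zero_if_g_zero:
  assumes "x \<in> carrier M" "\<And>s. s \<in> A \<Longrightarrow> g s x = \<zero>" shows "x = \<zero>\<^bsub>M\<^esub>"
proof -
  obtain F where F: "finite F" "F \<subseteq> A" "component F x = x" using spanning[OF assms(1)] by blast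
  have "component F x = (\<Oplus>\<^bsub>M\<^esub>s\<in>F. \<zero>\<^bsub>M\<^esub>)"
    unfolding component_def using F assms by (intro M.finsum_cong') (auto simp: subset_iff)
  with F show ?thesis by simp
qed

lemma finite_support: 
  assumes "x \<in> carrier M" shows "finite {s \<in> A. g s x \<noteq> \<zero>}"
proof -
  obtain F where F: "finite F" "F \<subseteq> A" "component F x = x" using spanning[OF assms] by blast
  have "g s x = \<zero>" if "s \<in> A" "s \<notin> F" for s
    using g_component[OF F(1,2) that(1) assms] F(3) that(2) by simp
  then show ?thesis by (intro finite_subset[OF _ F(1)]) auto
qed

end

text \<open>
  Generation suffices because the elements with a finite expansion form a submodule.
\<close>

lemma frameI:
  assumes "biorthogonal R M A e y g"
    and "\<And>H. submodule H R M \<Longrightarrow> y ` A \<subseteq> H \<Longrightarrow> carrier M \<subseteq> H"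
  shows "frame R M A e y g"
proof -
  interpret biorthogonal R M A e y g by fact
  show ?thesis
    by (intro frame.intro frame_axioms.intro assms(1) assms(2)[OF submodule_spanned])
      (auto intro: y_in_spanned)
qed

lemma biorthogonal_reindex:
  assumes "biorthogonal R M A e y g" "inj_on \<sigma> B" "\<sigma> ` B \<subseteq> A"
  shows "biorthogonal R M B (\<lambda>s. e (\<sigma> s)) (\<lambda>s. y (\<sigma> s)) (\<lambda>s. g (\<sigma> s))"
proof -
  interpret biorthogonal R M A e y g by fact
  have "\<sigma> s \<in> A" if "s \<in> B" for s using assms(3) that by blast
  with assms(2) show ?thesis
    by (intro biorthogonal.intro biorthogonal_axioms.intro right_module_axioms)
      (auto simp: smult_e_y functional_g mult_e_g g_y inj_on_def)
qed

lemma frame_reindex: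
  assumes "frame R M A e y g" "bij_betw \<sigma> B A"
  shows "frame R M B (\<lambda>s. e (\<sigma> s)) (\<lambda>s. y (\<sigma> s)) (\<lambda>s. g (\<sigma> s))"
proof -
  interpret frame R M A e y g by fact
  have \<sigma>: "inj_on \<sigma> B" "\<sigma> ` B = A" using assms(2) by (auto simp: bij_betw_def)
  show ?thesis
  proof (rule frameI)
    show "biorthogonal R M B (\<lambda>s. e (\<sigma> s)) (\<lambda>s. y (\<sigma> s)) (\<lambda>s. g (\<sigma> s))"
      using \<sigma> by (intro biorthogonal_reindex[OF biorthogonal_axioms]) auto
    fix H assume "submodule H R M" "(\<lambda>s. y (\<sigma> s)) ` B \<subseteq> H"
    then show "carrier M \<subseteq> H" using submodule_eq_carrier[of H] \<sigma> by (auto simp: image_image)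
  qed
qed

section \<open>Direct sums of principal projective modules\<close>

text \<open>The external direct sum of the right ideals \<open>e s R\<close>.\<close>

definition idem_sum :: "('a, 'r) ring_scheme \<Rightarrow> 'i set \<Rightarrow> ('i \<Rightarrow> 'a) \<Rightarrow> ('a, 'i \<Rightarrow> 'a) module"
  where "idem_sum R A e = (module_power A (regular_module R))
    \<lparr>carrier := {x \<in> carrier (module_power A (regular_module R)). \<forall>s\<in>A. e s \<otimes>\<^bsub>R\<^esub> x s = x s}\<rparr>"

lemma idem_sum_simps:
  "carrier (idem_sum R A e) = {x \<in> A \<rightarrow>\<^sub>E carrier R. finite {s \<in> A. x s \<noteq> \<zero>\<^bsub>R\<^esub>} \<and> (\<forall>s\<in>A. e s \<otimes>\<^bsub>R\<^esub> x s = x s)}"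
  "\<zero>\<^bsub>idem_sum R A e\<^esub> = (\<lambda>i\<in>A. \<zero>\<^bsub>R\<^esub>)"
  "x \<oplus>\<^bsub>idem_sum R A e\<^esub> x' = (\<lambda>s\<in>A. x s \<oplus>\<^bsub>R\<^esub> x' s)"
  "a \<odot>\<^bsub>idem_sum R A e\<^esub> x = (\<lambda>s\<in>A. x s \<otimes>\<^bsub>R\<^esub> a)"
  by (auto simp: idem_sum_def module_power_def)

lemma idem_sum_cong: "(\<And>s. s \<in> A \<Longrightarrow> e s = e' s) \<Longrightarrow> idem_sum R A e = idem_sum R A e'"
  by (auto simp: idem_sum_def)

lemma right_module_submodule:
  fixes M :: "('a, 'm) module"
  assumes "right_module R M" "submodule H R M"
  shows "right_module R (M\<lparr>carrier := H\<rparr>)"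
proof -
  interpret right_module R M by fact
  have H: "H \<subseteq> carrier M" "\<zero>\<^bsub>M\<^esub> \<in> H" "\<And>x x'. x \<in> H \<Longrightarrow> x' \<in> H \<Longrightarrow> x \<oplus>\<^bsub>M\<^esub> x' \<in> H"
    "\<And>a x. a \<in> carrier R \<Longrightarrow> x \<in> H \<Longrightarrow> a \<odot>\<^bsub>M\<^esub> x \<in> H"
    using assms(2) unfolding submodule_iff by auto
  have Hc: "x \<in> carrier M" if "x \<in> H" for x using H(1) that by blast
  have "abelian_group (M\<lparr>carrier := H\<rparr>)"
  proof (rule abelian_groupI)
    fix x assume "x \<in> carrier (M\<lparr>carrier := H\<rparr>)"
    then have x: "x \<in> H" by simp
    have "(\<ominus>\<^bsub>R\<^esub> \<one>\<^bsub>R\<^esub>) \<odot>\<^bsub>M\<^esub> x \<oplus>\<^bsub>M\<^esub> x = \<zero>\<^bsub>M\<^esub>"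
      using Hc[OF x] by (simp add: smult_l_minus M.l_neg)
    then show "\<exists>x'\<in>carrier (M\<lparr>carrier := H\<rparr>). x' \<oplus>\<^bsub>M\<lparr>carrier := H\<rparr>\<^esub> x = \<zero>\<^bsub>M\<lparr>carrier := H\<rparr>\<^esub>"
      using H(4)[OF _ x, of "\<ominus>\<^bsub>R\<^esub> \<one>\<^bsub>R\<^esub>"] by auto
  qed (simp_all add: H Hc M.a_ac)
  then show ?thesis
    by (intro right_moduleI R.ring_axioms)
      (simp_all add: H Hc smult_l_distr smult_r_distr smult_assoc)
qed

lemma right_module_idem_sum:
  assumes "ring R" "\<And>s. s \<in> A \<Longrightarrow> e s \<in> carrier R"
  shows "right_module R (idem_sum R A e)"
proof -
  interpret ring R by fact
  interpret F: right_module R "module_power A (regular_module R)"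
    by (intro right_module_module_power right_module_regular_module assms(1))
  have "submodule {x \<in> carrier (module_power A (regular_module R)). \<forall>s\<in>A. e s \<otimes>\<^bsub>R\<^esub> x s = x s}
     R (module_power A (regular_module R))" (is "submodule ?H R ?F")
    unfolding F.submodule_iff
  proof (intro conjI ballI)
    show "\<zero>\<^bsub>?F\<^esub> \<in> ?H" using F.M.zero_closed assms(2) by simp
    show "x \<oplus>\<^bsub>?F\<^esub> x' \<in> ?H" if "x \<in> ?H" "x' \<in> ?H" for x x'
    proof -
      have "x \<oplus>\<^bsub>?F\<^esub> x' \<in> carrier ?F" using that by (intro F.M.a_closed) simp_all
      moreover have "x s \<in> carrier R" "x' s \<in> carrier R" if "s \<in> A" for s
        using \<open>x \<in> ?H\<close> \<open>x' \<in> ?H\<close> that by auto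
      ultimately show ?thesis using that assms(2) by (auto simp: r_distr)
    qed
    show "a \<odot>\<^bsub>?F\<^esub> x \<in> ?H" if "a \<in> carrier R" "x \<in> ?H" for a x
    proof -
      have "a \<odot>\<^bsub>?F\<^esub> x \<in> carrier ?F" using that by (intro F.smult_closed) simp_all
      moreover have "x s \<in> carrier R" if "s \<in> A" for s using \<open>x \<in> ?H\<close> that by auto
      ultimately show ?thesis using that assms(2) by (auto simp flip: m_assoc)
    qed
  qed auto
  then show ?thesis
    unfolding idem_sum_def by (intro right_module_submodule F.right_module_axioms)
qed

text \<open>The isomorphism sends an element to its coordinates \<open>g s x\<close>.\<close>

lemma (in frame) isomorphic_idem_sum: "module_isomorphic R M (idem_sum R A e)"
  unfolding module_isomorphic_def
proof (rule bexI)
  let ?\<phi> = "\<lambda>x. \<lambda>s\<in>A. g s x"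
  show hom: "?\<phi> \<in> module_hom R M (idem_sum R A e)"
    by (rule module_homI)
      (auto simp: idem_sum_simps finite_support mult_e_g functional_g functional_add functional_smult
        intro: rev_finite_subset[OF finite_support])
  have "inj_on ?\<phi> (carrier M)"
  proof (rule inj_onI)
    fix x x' assume x: "x \<in> carrier M" "x' \<in> carrier M" and eq: "?\<phi> x = ?\<phi> x'"
    have "g s x = g s x'" if "s \<in> A" for s using fun_cong[OF eq, of s] that by simp
    then have "x \<ominus>\<^bsub>M\<^esub> x' = \<zero>\<^bsub>M\<^esub>"
      using x by (intro zero_if_g_zero) (simp_all add: functional_g functional_minus, simp add: a_minus_def R.r_neg)
    then show "x = x'" using x M.minus_equality[of x "\<ominus>\<^bsub>M\<^esub> x'"] by (simp add: a_minus_def M.minus_minus)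
  qed
  moreover have "z \<in> ?\<phi> ` carrier M" if z: "z \<in> carrier (idem_sum R A e)" for z
  proof (rule image_eqI)
    let ?F = "{s \<in> A. z s \<noteq> \<zero>}"
    have zc: "z s \<in> carrier R" "e s \<otimes> z s = z s" if "s \<in> A" for s
      using z that by (auto simp: idem_sum_simps)
    have F: "finite ?F" "?F \<subseteq> A" using z by (auto simp: idem_sum_simps)
    let ?x = "\<Oplus>\<^bsub>M\<^esub>s\<in>?F. z s \<odot>\<^bsub>M\<^esub> y s"
    show "?x \<in> carrier M" using zc by (intro M.finsum_closed) auto
    have "g s ?x = z s" if "s \<in> A" for s using g_sum[OF F that, of z] zc that by auto
    then show "z = ?\<phi> ?x" using z by (auto simp: idem_sum_simps PiE_iff extensional_def)
  qed
  ultimately show "bij_betw ?\<phi> (carrier M) (carrier (idem_sum R A e))"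
    using module_hom_closed[OF hom] unfolding bij_betw_def by blast
qed

lemma frame_idem_sum:
  fixes R (structure)
  assumes "ring R" and e: "\<And>s. s \<in> A \<Longrightarrow> e s \<in> carrier R" "\<And>s. s \<in> A \<Longrightarrow> e s \<otimes> e s = e s"
  shows "frame R (idem_sum R A e) A e (\<lambda>s. \<lambda>t\<in>A. if t = s then e s else \<zero>) (\<lambda>s x. x s)"
proof -
  interpret ring R by fact
  let ?M = "idem_sum R A e" and ?y = "\<lambda>s. \<lambda>t\<in>A. if t = s then e s else \<zero>"
  interpret M: right_module R ?M by (intro right_module_idem_sum assms)
  have y: "?y s \<in> carrier ?M" if "s \<in> A" for s
    using that e finite_subset[of "{t \<in> A. ?y s t \<noteq> \<zero>}" "{s}"]
    by (auto simp: idem_sum_simps)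
  interpret biorthogonal R ?M A e ?y "\<lambda>s x. x s"
  proof (intro biorthogonal.intro biorthogonal_axioms.intro M.right_module_axioms)
    show "(\<lambda>x. x s) \<in> functionals R ?M" if "s \<in> A" for s
      using that by (intro M.functionalI) (auto simp: idem_sum_simps)
  qed (use y e in \<open>auto simp: idem_sum_simps\<close>)
  show ?thesis
  proof (intro frame.intro frame_axioms.intro biorthogonal_axioms subsetI)
    fix x assume x: "x \<in> carrier ?M"
    let ?F = "{s \<in> A. x s \<noteq> \<zero>}"
    have F: "finite ?F" "?F \<subseteq> A" using x by (auto simp: idem_sum_simps)
    have "component ?F x s = x s" if "s \<in> A" for s
      using g_component[OF F that x] that by auto
    then have "component ?F x = x"
      using x component_closed[OF F(2) x] by (auto simp: idem_sum_simps intro: PiE_ext)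
    with F x show "x \<in> spanned" unfolding spanned_def by blast
  qed
qed

lemma frames_isomorphic:
  assumes M: "frame R M A e y g" and N: "frame R N B d z h"
    and \<sigma>: "bij_betw \<sigma> A B" "\<And>s. s \<in> A \<Longrightarrow> d (\<sigma> s) = e s"
  shows "module_isomorphic R M N"
proof -
  interpret M: frame R M A e y g by fact
  interpret N: frame R N A "\<lambda>s. d (\<sigma> s)" "\<lambda>s. z (\<sigma> s)" "\<lambda>s. h (\<sigma> s)"
    using N \<sigma>(1) by (rule frame_reindex)
  have "idem_sum R A (\<lambda>s. d (\<sigma> s)) = idem_sum R A e" using \<sigma>(2) by (intro idem_sum_cong)
  then have "module_isomorphic R (idem_sum R A e) N"
    using module_isomorphic_sym[OF N.right_module_axioms N.isomorphic_idem_sum] by simp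
  with M.isomorphic_idem_sum show ?thesis by (rule module_isomorphic_trans)
qed

lemma frame_transfer:
  assumes "frame R M A e y g" "right_module R N" "module_isomorphic R M N"
  obtains z h where "frame R N A e z h"
proof -
  interpret M: frame R M A e y g by fact
  interpret N: right_module R N by fact
  obtain \<phi> where \<phi>: "\<phi> \<in> module_hom R M N" "bij_betw \<phi> (carrier M) (carrier N)"
    using assms(3) unfolding module_isomorphic_def by blast
  define \<psi> where "\<psi> = inv_into (carrier M) \<phi>"
  have \<psi>: "\<psi> \<in> module_hom R N M" unfolding \<psi>_def using M.right_module_axioms \<phi> by (rule module_hom_inverse)
  have \<psi>\<phi>: "\<psi> (\<phi> x) = x" if "x \<in> carrier M" for x
    unfolding \<psi>_def using \<phi>(2) that by (rule bij_betw_inv_into_left)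
  have \<phi>\<psi>: "\<phi> (\<psi> x) = x" if "x \<in> carrier N" for x
    unfolding \<psi>_def using \<phi>(2) that by (rule bij_betw_inv_into_right)
  note closed = module_hom_closed[OF \<phi>(1)] module_hom_closed[OF \<psi>]
  have "frame R N A e (\<lambda>s. \<phi> (y s)) (\<lambda>s x. g s (\<psi> x))"
  proof (rule frameI)
    show "biorthogonal R N A e (\<lambda>s. \<phi> (y s)) (\<lambda>s x. g s (\<psi> x))"
    proof (intro biorthogonal.intro biorthogonal_axioms.intro N.right_module_axioms)
      show "(\<lambda>x. g s (\<psi> x)) \<in> functionals R N" if "s \<in> A" for s
        using \<psi> M.functional_g[OF that] by (rule module_hom_comp)
      show "e s \<odot>\<^bsub>N\<^esub> \<phi> (y s) = \<phi> (y s)" if "s \<in> A" for s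
        using module_hom_smult[OF \<phi>(1), of "e s" "y s"] that M.smult_e_y by simp
    qed (auto simp: closed \<psi>\<phi> M.mult_e_g M.g_y)
    fix H assume H: "submodule H R N" "(\<lambda>s. \<phi> (y s)) ` A \<subseteq> H"
    have "submodule {x \<in> carrier M. \<phi> x \<in> H} R M"
      using H(1) module_hom_zero[OF M.right_module_axioms N.right_module_axioms \<phi>(1)]
      unfolding M.submodule_iff N.submodule_iff
      by (auto simp: module_hom_add[OF \<phi>(1)] module_hom_smult[OF \<phi>(1)])
    then have "{x \<in> carrier M. \<phi> x \<in> H} = carrier M"
      using H(2) by (intro M.submodule_eq_carrier) auto
    then show "carrier N \<subseteq> H" using \<phi>\<psi> closed(2) by (metis (no_types, lifting) mem_Collect_eq subsetI)
  qed
  then show thesis by (rule that)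
qed

lemma (in frame) countably_generated:
  assumes "countable A" shows "countably_generated R M"
  unfolding countably_generated_def
  by (intro exI[of _ "y ` A"])
    (auto simp: assms module_span_eq_carrier_iff[OF right_module_axioms] image_subset_iff
      intro!: submodule_eq_carrier)

lemma (in frame) finitely_generated:
  assumes "finite A" shows "finitely_generated R M"
  unfolding finitely_generated_def
  by (intro exI[of _ "y ` A"])
    (auto simp: assms module_span_eq_carrier_iff[OF right_module_axioms] image_subset_iff
      intro!: submodule_eq_carrier)

text \<open>
  Finitely many generators are contained in the span of a finite part \<open>U\<close> of the frame, so that
  every \<open>g s\<close> with \<open>s \<notin> U\<close> vanishes on \<open>M\<close>, although \<open>g s (y s) = e s\<close>.
\<close>

lemma (in frame) finite_if_finitely_generated:
  assumes "finitely_generated R M" and nonzero: "\<And>s. s \<in> A \<Longrightarrow> e s \<noteq> \<zero>"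
  shows "finite A"
proof -
  obtain G where G: "G \<subseteq> carrier M" "finite G" "module_span R M G = carrier M"
    using assms(1) unfolding finitely_generated_def by blast
  have "\<forall>x\<in>G. \<exists>F. finite F \<and> F \<subseteq> A \<and> component F x = x" using spanning G(1) by (simp add: subset_iff)
  from bchoice[OF this] obtain F
    where F': "\<forall>x\<in>G. finite (F x) \<and> F x \<subseteq> A \<and> component (F x) x = x" ..
  then have F: "finite (F x)" "F x \<subseteq> A" "component (F x) x = x" if "x \<in> G" for x
    using that by simp_all
  define U where "U = (\<Union>x\<in>G. F x)"
  have U: "finite U" "U \<subseteq> A" unfolding U_def using F' G(2) by (simp, blast)
  have "component U \<zero>\<^bsub>M\<^esub> = \<zero>\<^bsub>M\<^esub>"
    using component_smult[OF U(2) R.zero_closed M.zero_closed] U by simp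
  then have sub: "submodule {x \<in> carrier M. component U x = x} R M"
    unfolding submodule_iff by (simp add: component_add[OF U(2)] component_smult[OF U(2)] subset_iff)
  have "x \<in> carrier M \<and> component U x = x" if x: "x \<in> G" for x
  proof
    show "x \<in> carrier M" using G(1) x by blast
    moreover have "F x \<subseteq> U" using x by (auto simp: U_def)
    ultimately show "component U x = x" using component_mono[OF U(1) _ U(2) _ F(3)[OF x]] by simp
  qed
  then have "G \<subseteq> {x \<in> carrier M. component U x = x}" by (simp add: subset_iff)
  from module_span_minimal[OF this sub]
  have "carrier M \<subseteq> {x \<in> carrier M. component U x = x}" unfolding G(3) .
  then have all: "component U x = x" if "x \<in> carrier M" for x using that by (simp add: subset_iff)
  have "A \<subseteq> U"
  proof (rule subsetI, rule ccontr)
    fix s assume s: "s \<in> A" "s \<notin> U"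
    then have "g s (component U (y s)) = \<zero>" using g_component[OF U s(1), of "y s"] by simp
    then show False using all[of "y s"] nonzero[OF s(1)] g_y_same[OF s(1)] s(1) by simp
  qed
  then show ?thesis using U(1) by (rule finite_subset)
qed

text \<open>
  A complement of the sum of the \<open>e R\<close> in the free module is the sum of the \<open>(1 - e) R\<close>. The basis of
  the free module has to be a set of elements of \<open>M\<close>, which is why the frame is first indexed by
  its elements \<open>y s\<close>; they are distinct when \<open>e s\<close> is not zero.
\<close>

lemma (in frame) projective: "projective R M"
proof -
  have "inj_on y {s \<in> A. e s \<noteq> \<zero>}"
    by (rule inj_onI) (metis (mono_tags, lifting) g_y mem_Collect_eq)
  define X where "X = y ` {s \<in> A. e s \<noteq> \<zero>}"
  \<comment> \<open>Members with \<open>e s = 0\<close> have \<open>y s = 0\<close> and are discarded.\<close>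
  define \<sigma> where "\<sigma> = inv_into {s \<in> A. e s \<noteq> \<zero>} y"
  have \<sigma>: "inj_on \<sigma> X" "\<sigma> ` X = {s \<in> A. e s \<noteq> \<zero>}"
    using \<open>inj_on y _\<close> bij_betw_inv_into[of y "{s \<in> A. e s \<noteq> \<zero>}" X]
    by (auto simp: X_def \<sigma>_def bij_betw_def)
  define d where "d x = e (\<sigma> x)" for x
  have \<sigma>A: "\<sigma> x \<in> A" if "x \<in> X" for x using \<sigma>(2) that by blast
  then have d: "d x \<in> carrier R" "d x \<otimes> d x = d x" if "x \<in> X" for x
    using that by (auto simp: d_def e_idem)
  have fr: "frame R M X d (\<lambda>x. y (\<sigma> x)) (\<lambda>x. g (\<sigma> x))"
  proof (rule frameI)
    show "biorthogonal R M X d (\<lambda>x. y (\<sigma> x)) (\<lambda>x. g (\<sigma> x))"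
      unfolding d_def using \<sigma> by (intro biorthogonal_reindex[OF biorthogonal_axioms]) auto
    fix H assume H: "submodule H R M" "(\<lambda>x. y (\<sigma> x)) ` X \<subseteq> H"
    have "y s \<in> H" if s: "s \<in> A" for s
    proof (cases "e s = \<zero>")
      case True
      then have "y s = \<zero>\<^bsub>M\<^esub>" using smult_e_y[OF s] s by simp
      then show ?thesis using H(1) by (simp add: submodule_iff)
    next
      case False
      then have "s \<in> \<sigma> ` X" using \<sigma> s by simp
      then show ?thesis using H(2) by auto
    qed
    then show "carrier M \<subseteq> H" using submodule_eq_carrier[OF H(1)] by auto
  qed
  define d' where "d' x = \<one> \<ominus> d x" for x
  have d': "d' x \<in> carrier R" "d x \<otimes> d' x = \<zero>" "d' x \<otimes> d x = \<zero>" "d' x \<otimes> d' x = d' x"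
    "d x \<oplus> d' x = \<one>" if "x \<in> X" for x
    using d[OF that] by (auto simp: d'_def a_minus_def r_distr l_distr r_minus l_minus R.r_neg R.minus_add
        R.minus_minus R.a_ac R.r_neg1 R.r_neg2)
  interpret Q: right_module R "idem_sum R X d'" by (intro right_module_idem_sum R.ring_axioms d')
  interpret I: right_module R "idem_sum R X d" by (intro right_module_idem_sum R.ring_axioms d)
  let ?F = "module_power X (regular_module R)"
  interpret F: right_module R ?F
    by (intro right_module_module_power right_module_regular_module R.ring_axioms)
  \<comment> \<open>The Peirce decomposition \<open>R = d R \<oplus> (1 - d) R\<close>, coordinatewise.\<close>
  let ?\<theta> = "\<lambda>p. \<lambda>x\<in>X. fst p x \<oplus> snd p x"
  have mem: "v \<in> carrier ?F" if "v \<in> carrier (idem_sum R X d) \<or> v \<in> carrier (idem_sum R X d')" for v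
    using that by (auto simp: idem_sum_def)
  have val: "v x \<in> carrier R" if "v \<in> carrier (idem_sum R X d) \<or> v \<in> carrier (idem_sum R X d')" "x \<in> X" for v x
    using that by (auto simp: idem_sum_simps)
  have val_pair: "fst p x \<in> carrier R" "snd p x \<in> carrier R"
    if "p \<in> carrier (module_sum (idem_sum R X d) (idem_sum R X d'))" "x \<in> X" for p x
    using val[of "fst p" x] val[of "snd p" x] that by (simp_all add: mem_Times_iff)
  have hom: "?\<theta> \<in> module_hom R (module_sum (idem_sum R X d) (idem_sum R X d')) ?F"
  proof (rule module_homI)
    fix p assume "p \<in> carrier (module_sum (idem_sum R X d) (idem_sum R X d'))"
    then have "fst p \<in> carrier ?F" "snd p \<in> carrier ?F" by (intro mem; simp add: mem_Times_iff)+
    from F.M.a_closed[OF this] show "?\<theta> p \<in> carrier ?F" by (simp only: module_power_simps regular_module_simps)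
  next
    fix p q assume p: "p \<in> carrier (module_sum (idem_sum R X d) (idem_sum R X d'))"
      and q: "q \<in> carrier (module_sum (idem_sum R X d) (idem_sum R X d'))"
    show "?\<theta> (p \<oplus>\<^bsub>module_sum (idem_sum R X d) (idem_sum R X d')\<^esub> q) = ?\<theta> p \<oplus>\<^bsub>?F\<^esub> ?\<theta> q"
      using val_pair[OF p] val_pair[OF q] by (auto simp: idem_sum_simps R.a_ac)
  next
    fix a p assume a: "a \<in> carrier R"
      and p: "p \<in> carrier (module_sum (idem_sum R X d) (idem_sum R X d'))"
    show "?\<theta> (a \<odot>\<^bsub>module_sum (idem_sum R X d) (idem_sum R X d')\<^esub> p) = a \<odot>\<^bsub>?F\<^esub> ?\<theta> p"
      using a val_pair[OF p] by (auto simp: idem_sum_simps l_distr)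
  qed
  have "bij_betw ?\<theta> (carrier (module_sum (idem_sum R X d) (idem_sum R X d'))) (carrier ?F)"
  proof (rule bij_betw_byWitness[where f' = "\<lambda>v. (\<lambda>x\<in>X. d x \<otimes> v x, \<lambda>x\<in>X. d' x \<otimes> v x)"])
    show "\<forall>p\<in>carrier (module_sum (idem_sum R X d) (idem_sum R X d')).
      (\<lambda>x\<in>X. d x \<otimes> ?\<theta> p x, \<lambda>x\<in>X. d' x \<otimes> ?\<theta> p x) = p"
    proof
      fix p assume p: "p \<in> carrier (module_sum (idem_sum R X d) (idem_sum R X d'))"
      obtain v w where [simp]: "p = (v, w)" by force
      have v: "v \<in> extensional X" "\<And>x. x \<in> X \<Longrightarrow> v x \<in> carrier R" "\<And>x. x \<in> X \<Longrightarrow> d x \<otimes> v x = v x"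
        and w: "w \<in> extensional X" "\<And>x. x \<in> X \<Longrightarrow> w x \<in> carrier R" "\<And>x. x \<in> X \<Longrightarrow> d' x \<otimes> w x = w x"
        using p by (auto simp: idem_sum_simps PiE_iff)
      have "d x \<otimes> (v x \<oplus> w x) = v x" "d' x \<otimes> (v x \<oplus> w x) = w x" if x: "x \<in> X" for x
      proof -
        have "d x \<otimes> w x = \<zero>" using m_assoc[of "d x" "d' x" "w x"] d(1)[OF x] d'[OF x] w x by simp
        moreover have "d' x \<otimes> v x = \<zero>" using m_assoc[of "d' x" "d x" "v x"] d(1)[OF x] d'[OF x] v x by simp
        ultimately show "d x \<otimes> (v x \<oplus> w x) = v x" "d' x \<otimes> (v x \<oplus> w x) = w x"
          using d(1)[OF x] d'(1)[OF x] v w x by (simp_all add: r_distr)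
      qed
      with v(1) w(1) show "(\<lambda>x\<in>X. d x \<otimes> ?\<theta> p x, \<lambda>x\<in>X. d' x \<otimes> ?\<theta> p x) = p"
        by (auto simp: extensional_def)
    qed
    show "\<forall>v\<in>carrier ?F. ?\<theta> (\<lambda>x\<in>X. d x \<otimes> v x, \<lambda>x\<in>X. d' x \<otimes> v x) = v"
    proof
      fix v assume v: "v \<in> carrier ?F"
      have "d x \<otimes> v x \<oplus> d' x \<otimes> v x = v x" if "x \<in> X" for x
      proof -
        have "v x \<in> carrier R" using v that by auto
        then show ?thesis using l_distr[of "d x" "d' x" "v x"] d(1)[OF that] d'(1,5)[OF that] by simp
      qed
      then show "?\<theta> (\<lambda>x\<in>X. d x \<otimes> v x, \<lambda>x\<in>X. d' x \<otimes> v x) = v"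
        using v by (auto simp: PiE_iff extensional_def)
    qed
    show "?\<theta> ` carrier (module_sum (idem_sum R X d) (idem_sum R X d')) \<subseteq> carrier ?F"
      using module_hom_closed[OF hom] by blast
    show "(\<lambda>v. (\<lambda>x\<in>X. d x \<otimes> v x, \<lambda>x\<in>X. d' x \<otimes> v x)) ` carrier ?F
      \<subseteq> carrier (module_sum (idem_sum R X d) (idem_sum R X d'))"
    proof (intro subsetI, elim imageE)
      fix p v assume p: "p = (\<lambda>x\<in>X. d x \<otimes> v x, \<lambda>x\<in>X. d' x \<otimes> v x)" and v: "v \<in> carrier ?F"
      have dd: "d x \<otimes> (d x \<otimes> v x) = d x \<otimes> v x" "d' x \<otimes> (d' x \<otimes> v x) = d' x \<otimes> v x"
        if "x \<in> X" for x
      proof -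
        have "v x \<in> carrier R" using v that by auto
        then show "d x \<otimes> (d x \<otimes> v x) = d x \<otimes> v x" "d' x \<otimes> (d' x \<otimes> v x) = d' x \<otimes> v x"
          using d[OF that] d'(1,4)[OF that] by (simp_all flip: m_assoc)
      qed
      have "finite {x \<in> X. c x \<otimes> v x \<noteq> \<zero>}" if "\<And>x. x \<in> X \<Longrightarrow> c x \<in> carrier R" for c
        by (rule finite_subset[of _ "{x \<in> X. v x \<noteq> \<zero>}"]) (use v that in auto)
      from this[of d] this[of d'] have "finite {x \<in> X. d x \<otimes> v x \<noteq> \<zero>}" "finite {x \<in> X. d' x \<otimes> v x \<noteq> \<zero>}"
        using d d' by auto
      then show "p \<in> carrier (module_sum (idem_sum R X d) (idem_sum R X d'))"
        unfolding p using v d d' dd by (auto simp: idem_sum_simps cong: conj_cong)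
    qed
  qed
  with hom have 1: "module_isomorphic R (module_sum (idem_sum R X d) (idem_sum R X d')) ?F"
    unfolding module_isomorphic_def by blast
  obtain \<phi> where \<phi>: "\<phi> \<in> module_hom R M (idem_sum R X d)" "bij_betw \<phi> (carrier M) (carrier (idem_sum R X d))"
    using frame.isomorphic_idem_sum[OF fr] unfolding module_isomorphic_def by blast
  have "map_prod \<phi> id \<in> module_hom R (module_sum M (idem_sum R X d')) (module_sum (idem_sum R X d) (idem_sum R X d'))"
    using \<phi>(1) by (intro module_homI) (auto simp: module_hom_add module_hom_smult dest: module_hom_closed)
  moreover have "bij_betw (map_prod \<phi> id) (carrier (module_sum M (idem_sum R X d')))
     (carrier (module_sum (idem_sum R X d) (idem_sum R X d')))"
    using bij_betw_map_prod[OF \<phi>(2) bij_betw_id] by simp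
  ultimately have "module_isomorphic R (module_sum M (idem_sum R X d')) (module_sum (idem_sum R X d) (idem_sum R X d'))"
    unfolding module_isomorphic_def by blast
  from module_isomorphic_trans[OF this 1] show ?thesis
    unfolding projective_def using right_module_axioms Q.right_module_axioms by blast
qed


section \<open>Frames of sums, powers and duals\<close>

lemma frame_module_sum:
  assumes "frame R M A c y g" "frame R N B d z h"
  shows "frame R (module_sum M N) (A <+> B) (case_sum c d)
    (case_sum (\<lambda>s. (y s, \<zero>\<^bsub>N\<^esub>)) (\<lambda>t. (\<zero>\<^bsub>M\<^esub>, z t)))
    (case_sum (\<lambda>s p. g s (fst p)) (\<lambda>t p. h t (snd p)))"
proof -
  interpret M: frame R M A c y g by fact
  interpret N: frame R N B d z h by fact
  interpret MN: right_module R "module_sum M N"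
    by (intro right_module_module_sum M.right_module_axioms N.right_module_axioms)
  have orth: "s \<in> A \<Longrightarrow> s' \<in> A \<Longrightarrow> g s (y s') \<noteq> \<zero>\<^bsub>R\<^esub> \<Longrightarrow> s = s'"
    "t \<in> B \<Longrightarrow> t' \<in> B \<Longrightarrow> h t (z t') \<noteq> \<zero>\<^bsub>R\<^esub> \<Longrightarrow> t = t'" for s s' t t'
    using M.g_y_other N.g_y_other by blast+
  show ?thesis
  proof (rule frameI)
    show "biorthogonal R (module_sum M N) (A <+> B) (case_sum c d)
      (case_sum (\<lambda>s. (y s, \<zero>\<^bsub>N\<^esub>)) (\<lambda>t. (\<zero>\<^bsub>M\<^esub>, z t)))
      (case_sum (\<lambda>s p. g s (fst p)) (\<lambda>t p. h t (snd p)))"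
    proof (intro biorthogonal.intro biorthogonal_axioms.intro MN.right_module_axioms)
      fix s assume "s \<in> A <+> B"
      then show "case_sum (\<lambda>s p. g s (fst p)) (\<lambda>t p. h t (snd p)) s \<in> functionals R (module_sum M N)"
        by (auto intro!: MN.functionalI simp: M.functional_g M.functional_add M.functional_smult
            N.functional_g N.functional_add N.functional_smult)
    qed (auto simp: M.smult_e_y N.smult_e_y M.mult_e_g N.mult_e_g M.g_y_same N.g_y_same
        M.functional_g N.functional_g M.functional_zero N.functional_zero
        dest: orth(1) orth(2))
    fix H assume H: "submodule H R (module_sum M N)"
      and gen: "case_sum (\<lambda>s. (y s, \<zero>\<^bsub>N\<^esub>)) (\<lambda>t. (\<zero>\<^bsub>M\<^esub>, z t)) ` (A <+> B) \<subseteq> H"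
    have gen': "(y s, \<zero>\<^bsub>N\<^esub>) \<in> H" if "s \<in> A" for s using gen InlI[OF that] by force
    have gen'': "(\<zero>\<^bsub>M\<^esub>, z t) \<in> H" if "t \<in> B" for t using gen InrI[OF that] by force
    have Hadd: "(v, w) \<in> H \<Longrightarrow> (v', w') \<in> H \<Longrightarrow> (v \<oplus>\<^bsub>M\<^esub> v', w \<oplus>\<^bsub>N\<^esub> w') \<in> H" for v w v' w'
      using H unfolding MN.submodule_iff by fastforce
    have Hsm: "a \<in> carrier R \<Longrightarrow> (v, w) \<in> H \<Longrightarrow> (a \<odot>\<^bsub>M\<^esub> v, a \<odot>\<^bsub>N\<^esub> w) \<in> H" for a v w
      using H unfolding MN.submodule_iff by fastforce
    have H0: "(\<zero>\<^bsub>M\<^esub>, \<zero>\<^bsub>N\<^esub>) \<in> H" using H unfolding MN.submodule_iff by simp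
    have "submodule {v \<in> carrier M. (v, \<zero>\<^bsub>N\<^esub>) \<in> H} R M"
      unfolding M.submodule_iff
    proof (intro conjI ballI)
      show "v \<oplus>\<^bsub>M\<^esub> v' \<in> {v \<in> carrier M. (v, \<zero>\<^bsub>N\<^esub>) \<in> H}"
        if "v \<in> {v \<in> carrier M. (v, \<zero>\<^bsub>N\<^esub>) \<in> H}" "v' \<in> {v \<in> carrier M. (v, \<zero>\<^bsub>N\<^esub>) \<in> H}" for v v'
        using that Hadd[of v "\<zero>\<^bsub>N\<^esub>" v' "\<zero>\<^bsub>N\<^esub>"] by simp
      show "a \<odot>\<^bsub>M\<^esub> v \<in> {v \<in> carrier M. (v, \<zero>\<^bsub>N\<^esub>) \<in> H}"
        if "a \<in> carrier R" "v \<in> {v \<in> carrier M. (v, \<zero>\<^bsub>N\<^esub>) \<in> H}" for a v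
        using that Hsm[of a v "\<zero>\<^bsub>N\<^esub>"] by simp
    qed (use H0 in auto)
    then have 1: "{v \<in> carrier M. (v, \<zero>\<^bsub>N\<^esub>) \<in> H} = carrier M"
      using gen' by (intro M.submodule_eq_carrier) auto
    have "submodule {w \<in> carrier N. (\<zero>\<^bsub>M\<^esub>, w) \<in> H} R N"
      unfolding N.submodule_iff
    proof (intro conjI ballI)
      show "w \<oplus>\<^bsub>N\<^esub> w' \<in> {w \<in> carrier N. (\<zero>\<^bsub>M\<^esub>, w) \<in> H}"
        if "w \<in> {w \<in> carrier N. (\<zero>\<^bsub>M\<^esub>, w) \<in> H}" "w' \<in> {w \<in> carrier N. (\<zero>\<^bsub>M\<^esub>, w) \<in> H}" for w w'
        using that Hadd[of "\<zero>\<^bsub>M\<^esub>" w "\<zero>\<^bsub>M\<^esub>" w'] by simp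
      show "a \<odot>\<^bsub>N\<^esub> w \<in> {w \<in> carrier N. (\<zero>\<^bsub>M\<^esub>, w) \<in> H}"
        if "a \<in> carrier R" "w \<in> {w \<in> carrier N. (\<zero>\<^bsub>M\<^esub>, w) \<in> H}" for a w
        using that Hsm[of a "\<zero>\<^bsub>M\<^esub>" w] by simp
    qed (use H0 in auto)
    then have 2: "{w \<in> carrier N. (\<zero>\<^bsub>M\<^esub>, w) \<in> H} = carrier N"
      using gen'' by (intro N.submodule_eq_carrier) auto
    show "carrier (module_sum M N) \<subseteq> H"
    proof
      fix p assume "p \<in> carrier (module_sum M N)"
      then obtain v w where p: "p = (v, w)" "v \<in> carrier M" "w \<in> carrier N" by auto
      have "(v, \<zero>\<^bsub>N\<^esub>) \<in> H" "(\<zero>\<^bsub>M\<^esub>, w) \<in> H" using 1 2 p by blast+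
      from Hadd[OF this] show "p \<in> H" using p by simp
    qed
  qed
qed

lemma frame_module_power:
  assumes "frame R M A c y g"
  shows "frame R (module_power I M) (I \<times> A) (\<lambda>(i, s). c s)
    (\<lambda>(i, s). \<lambda>j\<in>I. if j = i then y s else \<zero>\<^bsub>M\<^esub>) (\<lambda>(i, s) x. g s (x i))"
proof -
  interpret M: frame R M A c y g by fact
  let ?F = "module_power I M"
  interpret F: right_module R ?F by (intro right_module_module_power M.right_module_axioms)
  define inj where "inj i v = (\<lambda>j\<in>I. if j = i then v else \<zero>\<^bsub>M\<^esub>)" for i v
  have inj: "inj i v \<in> carrier ?F" if "v \<in> carrier M" for i v
    using that finite_subset[of "{j \<in> I. inj i v j \<noteq> \<zero>\<^bsub>M\<^esub>}" "{i}"] by (auto simp: inj_def)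
  have val: "x i \<in> carrier M" if "x \<in> carrier ?F" "i \<in> I" for x i using that by auto
  have "frame R ?F (I \<times> A) (\<lambda>(i, s). c s) (\<lambda>(i, s). inj i (y s)) (\<lambda>(i, s) x. g s (x i))"
  proof (rule frameI)
    show "biorthogonal R ?F (I \<times> A) (\<lambda>(i, s). c s) (\<lambda>(i, s). inj i (y s)) (\<lambda>(i, s) x. g s (x i))"
    proof (intro biorthogonal.intro biorthogonal_axioms.intro F.right_module_axioms)
      fix p assume "p \<in> I \<times> A"
      then obtain i s where p: "p = (i, s)" "i \<in> I" "s \<in> A" by auto
      show "(case p of (i, s) \<Rightarrow> inj i (y s)) \<in> carrier ?F" using p inj[of "y s" i] by simp
      show "(case p of (i, s) \<Rightarrow> c s) \<odot>\<^bsub>?F\<^esub> (case p of (i, s) \<Rightarrow> inj i (y s)) = (case p of (i, s) \<Rightarrow> inj i (y s))"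
        using p M.smult_e_y[OF p(3)] by (auto simp: inj_def)
      have "(\<lambda>x. g s (x i)) \<in> functionals R ?F"
        using p val[OF _ p(2)] M.functional_g[OF p(3)]
        by (intro F.functionalI)
          (simp_all add: M.functional_add M.functional_smult del: module_power_simps(1))
      then show "(case p of (i, s) \<Rightarrow> \<lambda>x. g s (x i)) \<in> functionals R ?F" by (simp add: p)
      show "(case p of (i, s) \<Rightarrow> c s) \<otimes>\<^bsub>R\<^esub> (case p of (i, s) \<Rightarrow> \<lambda>x. g s (x i)) x
          = (case p of (i, s) \<Rightarrow> \<lambda>x. g s (x i)) x" if "x \<in> carrier ?F" for x
        using M.mult_e_g[OF p(3) val[OF that p(2)]] by (simp add: p)
      show "(case p of (i, s) \<Rightarrow> \<lambda>x. g s (x i)) (case p of (i, s) \<Rightarrow> inj i (y s)) = (case p of (i, s) \<Rightarrow> c s)"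
        using p M.g_y_same by (simp add: inj_def)
      show "(case p of (i, s) \<Rightarrow> \<lambda>x. g s (x i)) (case q of (i, s) \<Rightarrow> inj i (y s)) = \<zero>\<^bsub>R\<^esub>"
        if "q \<in> I \<times> A" "p \<noteq> q" for q
        using p that M.g_y_other M.functional_zero[OF M.functional_g[OF p(3)]]
        by (cases q) (auto simp: inj_def)
    qed auto
    fix H assume H: "submodule H R ?F" and gen: "(\<lambda>(i, s). inj i (y s)) ` (I \<times> A) \<subseteq> H"
    have inj_add: "inj i (v \<oplus>\<^bsub>M\<^esub> v') = inj i v \<oplus>\<^bsub>?F\<^esub> inj i v'" if "v \<in> carrier M" "v' \<in> carrier M" for i v v'
      using that by (auto simp: inj_def)
    have inj_smult: "inj i (a \<odot>\<^bsub>M\<^esub> v) = a \<odot>\<^bsub>?F\<^esub> inj i v" if "a \<in> carrier R" "v \<in> carrier M" for i a v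
      using that by (auto simp: inj_def)
    have inj_zero: "inj i \<zero>\<^bsub>M\<^esub> = \<zero>\<^bsub>?F\<^esub>" for i by (auto simp: inj_def)
    have Hadd: "x \<oplus>\<^bsub>?F\<^esub> x' \<in> H" if "x \<in> H" "x' \<in> H" for x x' using H that unfolding F.submodule_iff by blast
    have Hsm: "a \<odot>\<^bsub>?F\<^esub> x \<in> H" if "a \<in> carrier R" "x \<in> H" for a x using H that unfolding F.submodule_iff by blast
    have H0: "\<zero>\<^bsub>?F\<^esub> \<in> H" using H unfolding F.submodule_iff by blast
    have inj_H: "inj i v \<in> H" if i: "i \<in> I" and v: "v \<in> carrier M" for i v
    proof -
      have "submodule {v \<in> carrier M. inj i v \<in> H} R M"
        unfolding M.submodule_iff
        by (intro conjI ballI)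
          (simp_all add: inj_zero H0 inj_add inj_smult Hadd Hsm subset_iff del: module_power_simps)
      then have "{v \<in> carrier M. inj i v \<in> H} = carrier M"
        using gen i by (intro M.submodule_eq_carrier) auto
      then show ?thesis using v by blast
    qed
    show "carrier ?F \<subseteq> H"
    proof
      fix x assume x: "x \<in> carrier ?F"
      \<comment> \<open>Truncations of \<open>x\<close> to finite sets of coordinates, built up one coordinate at a time.\<close>
      have trunc: "(\<lambda>j\<in>I. if j \<in> G then x j else \<zero>\<^bsub>M\<^esub>) \<in> H" if "finite G" "G \<subseteq> I" for G
        using that
      proof (induction G rule: finite_induct)
        case empty
        show ?case using H0 by (simp only: module_power_simps empty_iff if_False)
      next
        case (insert i G)
        have xi: "x j \<in> carrier M" if "j \<in> I" for j using val[OF x that] .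
        have i: "i \<in> I" "x i \<in> carrier M" using insert.prems xi by auto
        have "(\<lambda>j\<in>I. if j \<in> insert i G then x j else \<zero>\<^bsub>M\<^esub>)
          = inj i (x i) \<oplus>\<^bsub>?F\<^esub> (\<lambda>j\<in>I. if j \<in> G then x j else \<zero>\<^bsub>M\<^esub>)"
          using insert.hyps xi i by (auto simp: inj_def)
        moreover have "(\<lambda>j\<in>I. if j \<in> G then x j else \<zero>\<^bsub>M\<^esub>) \<in> H" using insert by blast
        ultimately show ?case using Hadd inj_H[OF i] by metis
      qed
      have "x = (\<lambda>j\<in>I. if j \<in> {i \<in> I. x i \<noteq> \<zero>\<^bsub>M\<^esub>} then x j else \<zero>\<^bsub>M\<^esub>)"
        using x by (auto simp: PiE_iff extensional_def)
      moreover have "finite {i \<in> I. x i \<noteq> \<zero>\<^bsub>M\<^esub>}" using x by simp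
      ultimately show "x \<in> H" using trunc[of "{i \<in> I. x i \<noteq> \<zero>\<^bsub>M\<^esub>}"] by (metis (no_types, lifting) mem_Collect_eq subsetI)
    qed
  qed
  then show ?thesis unfolding inj_def .
qed

lemma dual_module_simps:
  "carrier (dual_module R M) = functionals R M \<inter> extensional (carrier M)"
  "\<zero>\<^bsub>dual_module R M\<^esub> = (\<lambda>x\<in>carrier M. \<zero>\<^bsub>R\<^esub>)"
  "f \<oplus>\<^bsub>dual_module R M\<^esub> f' = (\<lambda>x\<in>carrier M. f x \<oplus>\<^bsub>R\<^esub> f' x)"
  "a \<odot>\<^bsub>dual_module R M\<^esub> f = (\<lambda>x\<in>carrier M. a \<otimes>\<^bsub>R\<^esub> f x)"
  by (simp_all add: dual_module_def)

context right_module
begin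

lemma functional_restrict:
  assumes "f \<in> functionals R M" shows "(\<lambda>x\<in>carrier M. f x) \<in> functionals R M"
  by (intro functionalI) (simp_all add: assms functional_add functional_smult)

lemma dual_closed:
  "(\<lambda>x\<in>carrier M. \<zero>) \<in> carrier (dual_module R M)"
  "f \<in> carrier (dual_module R M) \<Longrightarrow> f' \<in> carrier (dual_module R M) \<Longrightarrow>
    (\<lambda>x\<in>carrier M. f x \<oplus> f' x) \<in> carrier (dual_module R M)"
  "a \<in> carrier R \<Longrightarrow> f \<in> carrier (dual_module R M) \<Longrightarrow>
    (\<lambda>x\<in>carrier M. a \<otimes> f x) \<in> carrier (dual_module R M)"
proof -
  show "(\<lambda>x\<in>carrier M. \<zero>) \<in> carrier (dual_module R M)"
    unfolding dual_module_simps by (intro IntI functional_restrict functionalI) auto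
  show "(\<lambda>x\<in>carrier M. f x \<oplus> f' x) \<in> carrier (dual_module R M)"
    if "f \<in> carrier (dual_module R M)" "f' \<in> carrier (dual_module R M)"
    using that unfolding dual_module_simps
    by (intro IntI functional_restrict functionalI)
      (auto simp: functional_add functional_smult l_distr R.a_ac)
  show "(\<lambda>x\<in>carrier M. a \<otimes> f x) \<in> carrier (dual_module R M)"
    if "a \<in> carrier R" "f \<in> carrier (dual_module R M)"
    using that unfolding dual_module_simps by (intro IntI functional_restrict functional_scale) auto
qed

lemma right_module_dual_module: "right_module (opp_ring R) (dual_module R M)"
proof -
  have val: "f x \<in> carrier R" if "f \<in> carrier (dual_module R M)" "x \<in> carrier M" for f x
    using that by (simp add: dual_module_simps)
  have ext: "f = f'" if "f \<in> carrier (dual_module R M)" "f' \<in> carrier (dual_module R M)"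
    "\<And>x. x \<in> carrier M \<Longrightarrow> f x = f' x" for f f'
    using that by (auto simp: dual_module_simps intro: extensionalityI)
  have "abelian_group (dual_module R M)"
  proof (rule abelian_groupI, unfold dual_module_simps(2,3))
    fix f assume f: "f \<in> carrier (dual_module R M)"
    show "(\<lambda>x\<in>carrier M. (\<lambda>x\<in>carrier M. \<zero>) x \<oplus> f x) = f"
      using f by (intro ext dual_closed) (simp_all add: val)
    show "\<exists>f'\<in>carrier (dual_module R M). (\<lambda>x\<in>carrier M. f' x \<oplus> f x) = (\<lambda>x\<in>carrier M. \<zero>)"
      using f by (intro bexI[OF _ dual_closed(3)[of "\<ominus> \<one>" f]] restrict_ext)
        (simp_all add: val l_minus R.l_neg)
  qed (simp_all add: dual_closed val R.a_ac cong: restrict_cong)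
  then show ?thesis
  proof (rule right_moduleI[OF ring_opp_ring[OF R.ring_axioms]], unfold dual_module_simps(3,4) opp_ring_simps)
    fix f assume f: "f \<in> carrier (dual_module R M)"
    show "(\<lambda>x\<in>carrier M. \<one> \<otimes> f x) = f"
      using f by (intro ext dual_closed) (simp_all add: val)
  qed (simp_all add: dual_closed val l_distr r_distr m_assoc cong: restrict_cong)
qed

end

text \<open>
  The functionals \<open>g s\<close> and the evaluations at \<open>y s\<close>: since \<open>x = \<Sum> y s g s(x)\<close>, every functional \<open>f\<close>
  is \<open>\<Sum> f(y s) g s\<close>. Finiteness of \<open>A\<close> makes this a finite sum for all \<open>x\<close> at once.
\<close>

lemma frame_dual_module:
  assumes "frame R M A c y g" "finite A"
  shows "frame (opp_ring R) (dual_module R M) A c (\<lambda>s. \<lambda>x\<in>carrier M. g s x) (\<lambda>s f. f (y s))"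
proof -
  interpret M: frame R M A c y g by fact
  let ?D = "dual_module R M" and ?z = "\<lambda>s. \<lambda>x\<in>carrier M. g s x"
  interpret D: right_module "opp_ring R" ?D by (rule M.right_module_dual_module)
  have D: "f \<in> functionals R M" "f \<in> extensional (carrier M)" if "f \<in> carrier ?D" for f
    using that by (auto simp: dual_module_simps)
  have eval: "(\<lambda>f. f x) \<in> functionals (opp_ring R) ?D" if "x \<in> carrier M" for x
    using that D by (intro D.functionalI) (auto simp: dual_module_simps)
  have z: "?z s \<in> carrier ?D" if "s \<in> A" for s
    unfolding dual_module_simps using M.functional_restrict[OF M.functional_g[OF that]] by simp
  interpret biorthogonal "opp_ring R" ?D A c ?z "\<lambda>s f. f (y s)"
  proof (intro biorthogonal.intro biorthogonal_axioms.intro D.right_module_axioms)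
    show "c s \<odot>\<^bsub>?D\<^esub> ?z s = ?z s" if "s \<in> A" for s
      unfolding dual_module_simps by (rule restrict_ext) (simp add: M.mult_e_g[OF that])
    show "c s \<otimes>\<^bsub>opp_ring R\<^esub> f (y s) = f (y s)" if "s \<in> A" "f \<in> carrier ?D" for s f
      using M.functional_smult[OF D(1)[OF that(2)], of "c s" "y s"] that M.smult_e_y by simp
  qed (use eval z M.g_y in auto)
  have all: "component A f = f" if f: "f \<in> carrier ?D" for f
  proof (rule extensionalityI)
    show "component A f \<in> extensional (carrier M)" using f by (intro D component_closed) auto
    fix x assume x: "x \<in> carrier M"
    obtain F where F: "finite F" "F \<subseteq> A" "M.component F x = x" using M.spanning[OF x] by blast
    then have Ax: "M.component A x = x" using M.component_mono[OF assms(2) F(2) _ x F(3)] by simp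
    have fy: "f (y s) \<in> carrier R" if "s \<in> A" for s using D(1)[OF f] that by simp
    have op: "finsum (opp_ring R) h A = finsum R h A" for h
      by (simp add: finsum_def opp_ring_def)
    have "component A f x = (\<Oplus>\<^bsub>opp_ring R\<^esub>s\<in>A. (f (y s) \<odot>\<^bsub>?D\<^esub> ?z s) x)"
      unfolding component_def using f fy z by (intro D.functional_finsum eval x) auto
    also have "\<dots> = (\<Oplus>\<^bsub>R\<^esub>s\<in>A. (f (y s) \<odot>\<^bsub>?D\<^esub> ?z s) x)" by (rule op)
    also have "\<dots> = (\<Oplus>\<^bsub>R\<^esub>s\<in>A. f (g s x \<odot>\<^bsub>M\<^esub> y s))"
      using x fy by (intro M.R.finsum_cong')
        (auto simp: dual_module_simps M.functional_smult[OF D(1)[OF f]])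
    also have "\<dots> = f (M.component A x)"
      unfolding M.component_def using x by (intro M.functional_finsum[symmetric] D f) auto
    finally show "component A f x = f x" unfolding Ax .
  qed (use D that in auto)
  show ?thesis
    by (intro frame.intro frame_axioms.intro biorthogonal_axioms subsetI)
      (use all assms(2) in \<open>auto simp: spanned_def\<close>)
qed


section \<open>Multiplicities\<close>

definition ecard :: "'b set \<Rightarrow> enat"
  where "ecard X = (if finite X then enat (card X) else \<infinity>)"

lemma ecard_bij_betw: "bij_betw f X Y \<Longrightarrow> ecard X = ecard Y"
  using bij_betw_same_card[of f X Y] bij_betw_finite[of f X Y] by (simp add: ecard_def)

lemma ecard_initial_segment: "ecard {k. enat k < n} = n"
proof (cases n)
  case (enat m)
  then have "{k. enat k < n} = {..<m}" by auto
  then show ?thesis using enat by (simp add: ecard_def)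
next
  case infinity
  then show ?thesis by (simp add: ecard_def)
qed

lemma ex_bij_betw_if_ecard_eq:
  assumes "countable X" "countable Y" "ecard X = ecard Y"
  shows "\<exists>f. bij_betw f X Y"
proof (cases "finite X")
  case True
  then have "finite Y" "card X = card Y" using assms(3) by (auto simp: ecard_def split: if_splits)
  with True show ?thesis by (intro finite_same_card_bij)
next
  case False
  then have "infinite Y" using assms(3) by (auto simp: ecard_def split: if_splits)
  then have "bij_betw (from_nat_into Y) UNIV Y" using assms(2) by (intro bij_betw_from_nat_into)
  moreover have "bij_betw (to_nat_on X) X UNIV" using assms(1) False by (intro to_nat_on_infinite)
  ultimately show ?thesis using bij_betw_trans by blast
qed

lemma ecard_Plus:
  "ecard {s \<in> A <+> B. case_sum c d s = e} = ecard {s \<in> A. c s = e} + ecard {s \<in> B. d s = e}"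
proof -
  have "{s \<in> A <+> B. case_sum c d s = e} = {s \<in> A. c s = e} <+> {s \<in> B. d s = e}" by auto
  moreover have "card ({s \<in> A. c s = e} <+> {s \<in> B. d s = e}) = card {s \<in> A. c s = e} + card {s \<in> B. d s = e}"
    if "finite {s \<in> A. c s = e}" "finite {s \<in> B. d s = e}"
    using that by (rule card_Plus)
  ultimately show ?thesis by (auto simp: ecard_def finite_Plus_iff)
qed

text \<open>
  A biorthogonal family of \<open>n\<close> members with idempotent \<open>e\<close> is the same as a decomposition of \<open>M\<close> into
  \<open>(e R)\<^sup>n\<close> and a complement. In this form the multiplicity is defined for a module without
  a frame, too.
\<close>

definition multiplicity :: "('a, 'r) ring_scheme \<Rightarrow> ('a, 'm) module \<Rightarrow> 'a \<Rightarrow> enat"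
  where "multiplicity R M e = (SUP n \<in> {n::nat. \<exists>y g. biorthogonal R M {..<n} (\<lambda>_. e) y g}. enat n)"

lemma biorthogonal_card_le_multiplicity:
  assumes "biorthogonal R M K c y g" "finite K" "\<And>k. k \<in> K \<Longrightarrow> c k = e"
  shows "enat (card K) \<le> multiplicity R M e"
proof -
  obtain \<sigma> where \<sigma>: "bij_betw \<sigma> {..<card K} K"
    using ex_bij_betw_nat_finite[OF assms(2)] by (auto simp: atLeast0LessThan)
  have "biorthogonal R M {..<card K} (\<lambda>k. c (\<sigma> k)) (\<lambda>k. y (\<sigma> k)) (\<lambda>k. g (\<sigma> k))"
    using \<sigma> by (intro biorthogonal_reindex[OF assms(1)]) (auto simp: bij_betw_def)
  then interpret biorthogonal R M "{..<card K}" "\<lambda>k. c (\<sigma> k)" "\<lambda>k. y (\<sigma> k)" "\<lambda>k. g (\<sigma> k)" .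
  have c\<sigma>: "c (\<sigma> k) = e" if "k < card K" for k
    using assms(3) \<sigma> that by (auto simp: bij_betw_def)
  have "biorthogonal R M {..<card K} (\<lambda>_. e) (\<lambda>k. y (\<sigma> k)) (\<lambda>k. g (\<sigma> k))"
    using c\<sigma> e_closed smult_e_y mult_e_g g_y_same
    by (intro biorthogonal.intro biorthogonal_axioms.intro right_module_axioms)
      (simp_all add: functional_g g_y_other)
  then show ?thesis unfolding multiplicity_def by (intro SUP_upper) auto
qed

lemma biorthogonal_if_le_multiplicity:
  assumes "enat n \<le> multiplicity R M e" "right_module R M"
  shows "\<exists>y g. biorthogonal R M {..<n} (\<lambda>_. e) y g"
proof (rule ccontr)
  assume no: "\<not> ?thesis"
  have "m < n" if "biorthogonal R M {..<m} (\<lambda>_. e) y g" for m y g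
  proof (rule ccontr)
    assume "\<not> m < n"
    then have "biorthogonal R M {..<n} (\<lambda>_. e) y g"
      using biorthogonal_reindex[OF that, of "\<lambda>k. k" "{..<n}"] by auto
    with no show False by blast
  qed
  then have "multiplicity R M e \<le> enat (n - 1)"
    unfolding multiplicity_def by (intro SUP_least) fastforce
  moreover have "n \<noteq> 0"
  proof
    assume "n = 0"
    then have "biorthogonal R M {..<n} (\<lambda>_. e) (\<lambda>_. undefined) (\<lambda>_. undefined)"
      by (intro biorthogonal.intro biorthogonal_axioms.intro assms(2)) auto
    with no show False by blast
  qed
  ultimately have "enat n \<le> enat (n - 1)" using assms(1) by (meson order_trans)
  with \<open>n \<noteq> 0\<close> show False by simp
qed

context basic_set
begin

text \<open>
  Applying \<open>f k\<close> to the decomposition of \<open>y j\<close> into component and residual shows that the identity matrix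
  factors, modulo the radical, through the members of \<open>F\<close>. Those with an idempotent other than \<open>e\<close>
  contribute products \<open>e R c R e\<close>, which lie in the radical because \<open>e R\<close> and \<open>c R\<close> are not isomorphic.
\<close>

lemma card_le_if_residuals_radical:
  assumes F: "biorthogonal R M F c z h" "finite F" "\<And>s. s \<in> F \<Longrightarrow> c s \<in> E"
    and e: "e \<in> E"
    and K: "biorthogonal R M K (\<lambda>_. e) y f" "finite K"
    and rad: "\<And>k j. k \<in> K \<Longrightarrow> j \<in> K \<Longrightarrow>
      f k (biorthogonal.residual M z h F (y j)) \<in> corner_radical R e e"
  shows "card K \<le> card {s \<in> F. c s = e}"
proof (rule card_le_if_identity_factors_modulo_radical[OF local_E[OF e] K(2)])
  interpret F: biorthogonal R M F c z h by fact
  interpret K: biorthogonal R M K "\<lambda>_. e" y f by fact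
  let ?L = "{s \<in> F. c s = e}"
  show "finite ?L" using F(2) by simp
  have e_right: "q x \<otimes> c' = q x" if "q \<in> functionals R M" "x \<in> carrier M" "c' \<odot>\<^bsub>M\<^esub> x = x" "c' \<in> carrier R"
    for q x c'
    using F.functional_smult[OF that(1,4,2)] that(3) by simp
  have a: "f k (z l) \<in> corner R e (c l)" if "k \<in> K" "l \<in> F" for k l
    using K.mult_e_g[OF that(1)] e_right[OF K.functional_g[OF that(1)] F.y_closed F.smult_e_y F.e_closed] that
    by (simp add: corner_def)
  have b: "h l (y j) \<in> corner R (c l) e" if "j \<in> K" "l \<in> F" for l j
    using F.mult_e_g[OF that(2)] e_right[OF F.functional_g[OF that(2)] K.y_closed K.smult_e_y K.e_closed] that
    by (simp add: corner_def)
  show "f k (z l) \<in> corner R e e" if "k \<in> K" "l \<in> ?L" for k l using a[of k l] that by simp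
  show "h l (y j) \<in> corner R e e" if "l \<in> ?L" "j \<in> K" for l j using b[of j l] that by simp
  fix k j assume kj: "k \<in> K" "j \<in> K"
  have ab: "f k (z l) \<otimes> h l (y j) \<in> carrier R" if "l \<in> F" for l using that kj by simp
  define X where "X = (\<Oplus>l\<in>?L. f k (z l) \<otimes> h l (y j))"
  define Y where "Y = (\<Oplus>l\<in>F - ?L. f k (z l) \<otimes> h l (y j))"
  define Z where "Z = f k (F.residual F (y j))"
  have XYZ: "X \<in> carrier R" "Y \<in> carrier R" "Z \<in> carrier R"
    unfolding X_def Y_def Z_def using ab kj F(2) by (auto intro!: finsum_closed)
  have "f k (z l) \<otimes> h l (y j) \<in> corner_radical R e e" if "l \<in> F - ?L" for l
  proof -
    have "f k (z l) \<in> corner_radical R e (c l)"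
      using not_iso_E[OF e F(3)[of l]] a[of k l] kj that by auto
    then show ?thesis
      using corner_radical_mult_right[OF _ _ _ _ b[of j l], of e] e kj that by simp
  qed
  then have Y: "Y \<in> corner_radical R e e"
    unfolding Y_def using e local_E by (intro corner_radical_finsum) auto
  have Z: "Z \<in> corner_radical R e e" unfolding Z_def using kj by (rule rad)
  have "f k (y j) = f k (F.component F (y j) \<oplus>\<^bsub>M\<^esub> F.residual F (y j))"
    using F.component_plus_residual[OF F(2) subset_refl, of "y j"] kj by simp
  also have "\<dots> = f k (F.component F (y j)) \<oplus> Z"
    unfolding Z_def using F.functional_add[OF K.functional_g[OF kj(1)]] F(2) kj by simp
  also have "f k (F.component F (y j)) = (\<Oplus>l\<in>F. f k (h l (y j) \<odot>\<^bsub>M\<^esub> z l))"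
    unfolding F.component_def using kj by (intro F.functional_finsum K.functional_g) auto
  also have "\<dots> = (\<Oplus>l\<in>F. f k (z l) \<otimes> h l (y j))"
    using kj F.functional_smult[OF K.functional_g[OF kj(1)]] by (intro finsum_cong') auto
  also have "\<dots> = (\<Oplus>l\<in>?L \<union> (F - ?L). f k (z l) \<otimes> h l (y j))"
    by (rule arg_cong[where f="finsum R _"]) auto
  also have "\<dots> = X \<oplus> Y"
    unfolding X_def Y_def using F(2) ab by (intro finsum_Un_disjoint) auto
  finally have eq: "(if k = j then e else \<zero>) = X \<oplus> Y \<oplus> Z" using K.g_y[OF kj] by simp
  have "X \<ominus> (X \<oplus> Y \<oplus> Z) = \<ominus> (Y \<oplus> Z)"
    using XYZ by (simp add: a_minus_def minus_add a_assoc r_neg2)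
  then show "(\<Oplus>l\<in>?L. f k (z l) \<otimes> h l (y j)) \<ominus> (if k = j then e else \<zero>) \<in> corner_radical R e e"
    unfolding eq X_def[symmetric] using Y Z e local_E
    by (simp add: corner_radical_uminus corner_radical_add)
qed

text \<open>
  A family of \<open>n\<close> copies of \<open>e R\<close> lies in the span of a finite part of the frame, where all residuals
  vanish, so the rank inequality bounds \<open>n\<close>. The members of the frame with idempotent \<open>e\<close> give the
  other inequality.
\<close>

lemma multiplicity_frame:
  assumes "frame R M A c y g" "\<And>s. s \<in> A \<Longrightarrow> c s \<in> E" "e \<in> E"
  shows "multiplicity R M e = ecard {s \<in> A. c s = e}"
proof (rule antisym)
  interpret frame R M A c y g by fact
  let ?L = "{s \<in> A. c s = e}"
  have sub: "biorthogonal R M B c y g" if "B \<subseteq> A" for B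
    using biorthogonal_reindex[OF biorthogonal_axioms, of "\<lambda>s. s" B] that by auto
  show "multiplicity R M e \<le> ecard ?L"
    unfolding multiplicity_def
  proof (rule SUP_least, elim CollectE exE)
    fix n :: nat and w f assume n: "biorthogonal R M {..<n} (\<lambda>_. e) w f"
    then interpret K: biorthogonal R M "{..<n}" "\<lambda>_. e" w f .
    have "\<forall>j\<in>{..<n}. \<exists>F. finite F \<and> F \<subseteq> A \<and> component F (w j) = w j" by (intro ballI spanning) simp
    from bchoice[OF this] obtain F
      where F: "\<forall>j\<in>{..<n}. finite (F j) \<and> F j \<subseteq> A \<and> component (F j) (w j) = w j" ..
    define U where "U = (\<Union>j\<in>{..<n}. F j)"
    have F': "finite (F j)" "F j \<subseteq> A" "component (F j) (w j) = w j" if "j \<in> {..<n}" for j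
      using bspec[OF F that] by simp_all
    have "finite U" unfolding U_def by (simp add: F'(1))
    moreover have "U \<subseteq> A" unfolding U_def by (rule UN_least[OF F'(2)])
    ultimately have U: "finite U" "U \<subseteq> A" .
    have "f k (residual U (w j)) \<in> corner_radical R e e" if "k \<in> {..<n}" "j \<in> {..<n}" for k j
    proof -
      have "F j \<subseteq> U" unfolding U_def using that by blast
      then have "component U (w j) = w j"
        using U F'(3)[OF that(2)] K.y_closed[OF that(2)] by (intro component_mono[of U "F j"])
      then have "residual U (w j) = \<zero>\<^bsub>M\<^esub>" using that by (simp add: residual_def a_minus_def M.r_neg)
      then show ?thesis
        using corner_radical_zero[OF local_E[OF assms(3)]] assms(3) that
        by (simp add: functional_zero[OF K.functional_g])
    qed
    then have "card {..<n} \<le> card {s \<in> U. c s = e}"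
      using U assms(2,3) by (intro card_le_if_residuals_radical[OF sub[OF U(2)] U(1) _ _ n]) auto
    moreover have "card {s \<in> U. c s = e} \<le> card ?L" if "finite ?L"
      using U(2) that by (intro card_mono) auto
    ultimately show "enat n \<le> ecard ?L" by (auto simp: ecard_def)
  qed
  have le: "enat (card K) \<le> multiplicity R M e" if "K \<subseteq> ?L" "finite K" for K
    using that by (intro biorthogonal_card_le_multiplicity[OF sub]) auto
  show "ecard ?L \<le> multiplicity R M e"
  proof (cases "finite ?L")
    case True
    then show ?thesis using le[of ?L] by (simp add: ecard_def)
  next
    case False
    have "enat n \<le> multiplicity R M e" for n
      using infinite_arbitrarily_large[OF False, of n] le by metis
    then have "multiplicity R M e = \<infinity>" by (metis Suc_n_not_le_n enat_ord_simps(1) not_infinity_eq)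
    then show ?thesis by simp
  qed
qed

text \<open>
  Countable sets of equal extended cardinality are in bijection, and bijections for the single
  idempotents combine to one of the index sets.
\<close>

lemma frames_isomorphic_if_multiplicity_eq:
  assumes M: "frame R M A c y g" "\<And>s. s \<in> A \<Longrightarrow> c s \<in> E" "countable A"
    and N: "frame R N B d z h" "\<And>s. s \<in> B \<Longrightarrow> d s \<in> E" "countable B"
    and eq: "\<And>e. e \<in> E \<Longrightarrow> multiplicity R M e = multiplicity R N e"
  shows "module_isomorphic R M N"
proof -
  have "\<exists>f. bij_betw f {s \<in> A. c s = e} {s \<in> B. d s = e}" if e: "e \<in> E" for e
  proof (rule ex_bij_betw_if_ecard_eq)
    show "ecard {s \<in> A. c s = e} = ecard {s \<in> B. d s = e}"
      using eq[OF e] multiplicity_frame[OF M(1,2) e] multiplicity_frame[OF N(1,2) e] by simp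
  qed (use M(3) N(3) in \<open>auto intro: countable_subset\<close>)
  then obtain f where f: "bij_betw (f e) {s \<in> A. c s = e} {s \<in> B. d s = e}" if "e \<in> E" for e
    by metis
  define \<sigma> where "\<sigma> s = f (c s) s" for s
  have \<sigma>: "\<sigma> s \<in> B" "d (\<sigma> s) = c s" if "s \<in> A" for s
    using bij_betwE[OF f[OF M(2)[OF that]]] that by (auto simp: \<sigma>_def)
  have "bij_betw \<sigma> A B"
  proof (rule bij_betw_imageI)
    show "inj_on \<sigma> A"
    proof (rule inj_onI)
      fix s t assume st: "s \<in> A" "t \<in> A" "\<sigma> s = \<sigma> t"
      then have "c s = c t" using \<sigma>(2)[of s] \<sigma>(2)[of t] by simp
      then show "s = t"
        using bij_betw_imp_inj_on[OF f[OF M(2)[OF st(1)]]] st by (auto simp: \<sigma>_def inj_on_def)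
    qed
    show "\<sigma> ` A = B"
    proof (intro equalityI subsetI)
      fix t assume t: "t \<in> B"
      then have "t \<in> f (d t) ` {s \<in> A. c s = d t}"
        using bij_betw_imp_surj_on[OF f[OF N(2)[OF t]]] by simp
      then obtain s where s: "t = f (d t) s" "s \<in> {s \<in> A. c s = d t}" by (rule imageE)
      from s(2) have "s \<in> A" "c s = d t" by simp_all
      have "t = \<sigma> s" unfolding \<sigma>_def \<open>c s = d t\<close> by (rule s(1))
      then show "t \<in> \<sigma> ` A" using \<open>s \<in> A\<close> by (rule image_eqI)
    qed (use \<sigma> in auto)
  qed
  then show ?thesis by (rule frames_isomorphic[OF M(1) N(1)]) (use \<sigma> in simp)
qed

text \<open>
  The index set \<open>{(k, e). k < n e}\<close> is countable and is coded by natural numbers, which gives the carrier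
  the type \<^typ>\<open>nat \<Rightarrow> 'a\<close>.
\<close>

lemma ex_module_with_multiplicities:
  obtains N :: "('a, nat \<Rightarrow> 'a) module" and B :: "nat set" and d z h
  where "frame R N B d z h" "\<And>s. s \<in> B \<Longrightarrow> d s \<in> E" "\<And>e. e \<in> E \<Longrightarrow> multiplicity R N e = n e"
proof -
  define C where "C = {(k, e). e \<in> E \<and> enat k < n e}"
  have "C \<subseteq> UNIV \<times> E" by (auto simp: C_def)
  moreover have "countable ((UNIV :: nat set) \<times> E)" using finite_E by (simp add: countable_finite)
  ultimately have "countable C" by (rule countable_subset)
  then have inj: "inj_on (to_nat_on C) C" by (rule inj_on_to_nat_on)
  define B where "B = to_nat_on C ` C"
  define d where "d b = snd (inv_into C (to_nat_on C) b)" for b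
  have d: "d (to_nat_on C p) = snd p" if "p \<in> C" for p using that inj by (simp add: d_def)
  have dE: "d b \<in> E" if "b \<in> B" for b using that by (auto simp: B_def d) (auto simp: C_def)
  have fr: "frame R (idem_sum R B d) B d (\<lambda>s. \<lambda>t\<in>B. if t = s then d s else \<zero>) (\<lambda>s x. x s)"
    using dE E_idem by (intro frame_idem_sum ring_axioms) auto
  have "multiplicity R (idem_sum R B d) e = n e" if e: "e \<in> E" for e
  proof -
    have "bij_betw (\<lambda>k. to_nat_on C (k, e)) {k. enat k < n e} {b \<in> B. d b = e}"
    proof (rule bij_betw_imageI)
      show "inj_on (\<lambda>k. to_nat_on C (k, e)) {k. enat k < n e}"
        using inj e by (auto simp: inj_on_def C_def)
      show "(\<lambda>k. to_nat_on C (k, e)) ` {k. enat k < n e} = {b \<in> B. d b = e}"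
        using e d unfolding B_def by (force simp: C_def)
    qed
    from ecard_bij_betw[OF this] have "ecard {b \<in> B. d b = e} = n e"
      by (simp add: ecard_initial_segment)
    moreover have "multiplicity R (idem_sum R B d) e = ecard {b \<in> B. d b = e}"
      using fr dE e by (rule multiplicity_frame)
    ultimately show ?thesis by simp
  qed
  with fr dE show thesis by (rule that)
qed

text \<open>
  The union of a chain of finite biorthogonal families, the \<open>n\<close>-th of which captures the \<open>n\<close>-th generator.
\<close>

lemma ex_countable_frame:
  fixes P :: "('a, 'm) module"
  assumes P: "projective R P" "countably_generated R P"
  obtains S where "countable S" "frame R P S fst (\<lambda>s. fst (snd s)) (\<lambda>s. snd (snd s))" "fst ` S \<subseteq> E"
proof -
  interpret P: right_module R P using P(1) by (rule projective_right_module)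
  obtain G where G: "G \<subseteq> carrier P" "countable G" "module_span R P G = carrier P"
    using P(2) unfolding countably_generated_def by blast
  define x where "x = from_nat_into (insert \<zero>\<^bsub>P\<^esub> G)"
  have rx: "range x = insert \<zero>\<^bsub>P\<^esub> G" unfolding x_def using G(2) by (intro range_from_nat_into) auto
  have xc: "x n \<in> carrier P" for n
  proof -
    have "x n \<in> insert \<zero>\<^bsub>P\<^esub> G" unfolding rx[symmetric] by (rule rangeI)
    then show ?thesis using G(1) by auto
  qed
  define ok where "ok S \<longleftrightarrow> finite S \<and> biorthogonal_set R P S \<and> fst ` S \<subseteq> E" for S
  have "\<exists>T. \<forall>n. (ok (T n) \<and> set_component P (T n) (x n) = x n) \<and> T n \<subseteq> T (Suc n)"
  proof (rule dependent_nat_choice)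
    have "biorthogonal_set R P {}"
      by (intro biorthogonal.intro biorthogonal_axioms.intro P.right_module_axioms) auto
    from biorthogonal_set_extend_spanning[OF P(1) _ this _ xc[of 0]]
    show "\<exists>S. ok S \<and> set_component P S (x 0) = x 0" unfolding ok_def by auto
  next
    fix S n assume "ok S \<and> set_component P S (x n) = x n"
    then have "finite S" "biorthogonal_set R P S" "fst ` S \<subseteq> E" by (simp_all add: ok_def)
    from biorthogonal_set_extend_spanning[OF P(1) this xc[of "Suc n"]]
    show "\<exists>S'. (ok S' \<and> set_component P S' (x (Suc n)) = x (Suc n)) \<and> S \<subseteq> S'"
      unfolding ok_def by blast
  qed
  then obtain T where T: "\<forall>n. (ok (T n) \<and> set_component P (T n) (x n) = x n) \<and> T n \<subseteq> T (Suc n)" ..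
  have fin: "finite (T n)" and bi: "biorthogonal_set R P (T n)" and TE: "fst ` T n \<subseteq> E"
    and Tx: "set_component P (T n) (x n) = x n" and Suc: "T n \<subseteq> T (Suc n)" for n
    using spec[OF T, of n] by (simp_all add: ok_def)
  have mono: "T m \<subseteq> T n" if "m \<le> n" for m n using Suc that by (rule lift_Suc_mono_le)
  define S where "S = (\<Union>n. T n)"
  have "biorthogonal_set R P S"
  proof (intro biorthogonal.intro biorthogonal_axioms.intro P.right_module_axioms)
    fix s assume "s \<in> S"
    then obtain n where n: "s \<in> T n" by (auto simp: S_def)
    interpret T: biorthogonal R P "T n" fst "\<lambda>s. fst (snd s)" "\<lambda>s. snd (snd s)" by (rule bi)
    show "fst s \<in> carrier R" "fst (snd s) \<in> carrier P" "fst s \<odot>\<^bsub>P\<^esub> fst (snd s) = fst (snd s)"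
      "snd (snd s) \<in> functionals R P" "snd (snd s) (fst (snd s)) = fst s"
      using T.e_closed[OF n] T.y_closed[OF n] T.smult_e_y[OF n] T.functional_g[OF n] T.g_y_same[OF n]
      by simp_all
    show "fst s \<otimes> snd (snd s) v = snd (snd s) v" if "v \<in> carrier P" for v using n that by (rule T.mult_e_g)
    show "snd (snd s) (fst (snd t)) = \<zero>" if "t \<in> S" "s \<noteq> t" for t
    proof -
      obtain m where "t \<in> T m" using \<open>t \<in> S\<close> by (auto simp: S_def)
      then have "s \<in> T (max n m)" "t \<in> T (max n m)" using n mono[of n "max n m"] mono[of m "max n m"] by auto
      from biorthogonal.g_y_other[OF bi this that(2)] show ?thesis .
    qed
  qed
  then interpret S: biorthogonal R P S fst "\<lambda>s. fst (snd s)" "\<lambda>s. snd (snd s)" .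
  have "x n \<in> S.spanned" for n
  proof -
    have "T n \<subseteq> S" by (auto simp: S_def)
    then show ?thesis unfolding S.spanned_def using xc[of n] fin[of n] Tx[of n] by blast
  qed
  then have "range x \<subseteq> S.spanned" by (rule image_subsetI)
  then have "G \<subseteq> S.spanned" unfolding rx by simp
  from module_span_minimal[OF this S.submodule_spanned] have "carrier P \<subseteq> S.spanned"
    unfolding G(3) .
  then have "frame R P S fst (\<lambda>s. fst (snd s)) (\<lambda>s. snd (snd s))"
    by (intro frame.intro frame_axioms.intro S.biorthogonal_axioms)
  moreover have "countable S" unfolding S_def by (rule countable_UN[OF _ countable_finite[OF fin]]) simp
  moreover have "fst ` S \<subseteq> E" using TE by (auto simp: S_def)
  ultimately show thesis by (intro that)
qed

lemma finitely_generated_iff_multiplicity: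
  assumes "frame R M A c y g" "\<And>s. s \<in> A \<Longrightarrow> c s \<in> E"
  shows "finitely_generated R M \<longleftrightarrow> (\<forall>e\<in>E. multiplicity R M e \<noteq> \<infinity>)"
proof -
  interpret frame R M A c y g by fact
  have "finitely_generated R M \<longleftrightarrow> finite A"
    using finitely_generated finite_if_finitely_generated assms(2) E_nonzero by blast
  also have "finite A \<longleftrightarrow> (\<forall>e\<in>E. finite {s \<in> A. c s = e})"
  proof
    assume *: "\<forall>e\<in>E. finite {s \<in> A. c s = e}"
    have "A \<subseteq> (\<Union>e\<in>E. {s \<in> A. c s = e})" using assms(2) by auto
    then show "finite A" by (rule finite_subset) (use * finite_E in simp)
  qed simp
  also have "\<dots> \<longleftrightarrow> (\<forall>e\<in>E. multiplicity R M e \<noteq> \<infinity>)"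
    using multiplicity_frame[OF assms] by (intro ball_cong) (auto simp: ecard_def)
  finally show ?thesis .
qed

end


section \<open>Basic sets of semiperfect rings\<close>

context ring
begin

lemma right_ideal_iff:
  "submodule K R (regular_module R) \<longleftrightarrow> K \<subseteq> carrier R \<and> \<zero> \<in> K \<and>
    (\<forall>x\<in>K. \<forall>y\<in>K. x \<oplus> y \<in> K) \<and> (\<forall>a\<in>carrier R. \<forall>x\<in>K. x \<otimes> a \<in> K)"
  using right_module.submodule_iff[OF right_module_regular_module[OF ring_axioms]] by simp

lemma right_idealD:
  assumes "submodule K R (regular_module R)"
  shows "x \<in> K \<Longrightarrow> x \<in> carrier R" "\<zero> \<in> K" "x \<in> K \<Longrightarrow> y \<in> K \<Longrightarrow> x \<oplus> y \<in> K"
    "a \<in> carrier R \<Longrightarrow> x \<in> K \<Longrightarrow> x \<otimes> a \<in> K" "x \<in> K \<Longrightarrow> \<ominus> x \<in> K"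
    "\<one> \<in> K \<longleftrightarrow> K = carrier R"
proof -
  have K: "K \<subseteq> carrier R" "\<zero> \<in> K" "\<And>x y. x \<in> K \<Longrightarrow> y \<in> K \<Longrightarrow> x \<oplus> y \<in> K"
    "\<And>a x. a \<in> carrier R \<Longrightarrow> x \<in> K \<Longrightarrow> x \<otimes> a \<in> K"
    using assms unfolding right_ideal_iff by auto
  show "x \<in> K \<Longrightarrow> x \<in> carrier R" "\<zero> \<in> K" "x \<in> K \<Longrightarrow> y \<in> K \<Longrightarrow> x \<oplus> y \<in> K"
    "a \<in> carrier R \<Longrightarrow> x \<in> K \<Longrightarrow> x \<otimes> a \<in> K"
    using K by auto
  show "\<ominus> x \<in> K" if "x \<in> K"
  proof -
    have "x \<otimes> (\<ominus> \<one>) \<in> K" "x \<in> carrier R" using K(1) K(4)[of "\<ominus> \<one>" x] that by auto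
    then show ?thesis by (simp add: r_minus)
  qed
  show "\<one> \<in> K \<longleftrightarrow> K = carrier R"
  proof
    assume 1: "\<one> \<in> K"
    have "r \<in> K" if "r \<in> carrier R" for r using K(4)[OF that 1] that by simp
    with K(1) show "K = carrier R" by blast
  qed simp
qed

lemma maximal_right_idealD:
  assumes "maximal_right_ideal R m"
  shows "submodule m R (regular_module R)" "\<one> \<notin> m"
  using assms right_idealD(6) unfolding maximal_right_ideal_def by auto

text \<open>The right ideal \<open>m + a R\<close> is larger than \<open>m\<close>.\<close>

lemma maximal_right_ideal_plus:
  assumes m: "maximal_right_ideal R m" and a: "a \<in> carrier R" "a \<notin> m" and r: "r \<in> carrier R"
  shows "\<exists>x\<in>m. \<exists>q\<in>carrier R. r = x \<oplus> a \<otimes> q"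
proof -
  note md = right_idealD[OF maximal_right_idealD(1)[OF m]]
  define K where "K = {x \<oplus> a \<otimes> q | x q. x \<in> m \<and> q \<in> carrier R}"
  have "submodule K R (regular_module R)"
    unfolding right_ideal_iff
  proof (intro conjI ballI)
    show "K \<subseteq> carrier R" using md(1) a by (auto simp: K_def)
    show "\<zero> \<in> K" using md(2) a unfolding K_def by (intro CollectI exI[of _ \<zero>]) auto
    fix x assume "x \<in> K"
    then obtain v q where x: "x = v \<oplus> a \<otimes> q" "v \<in> m" "q \<in> carrier R" by (auto simp: K_def)
    show "x \<oplus> y \<in> K" if "y \<in> K" for y
    proof -
      obtain v' q' where y: "y = v' \<oplus> a \<otimes> q'" "v' \<in> m" "q' \<in> carrier R"
        using \<open>y \<in> K\<close> by (auto simp: K_def)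
      have "x \<oplus> y = (v \<oplus> v') \<oplus> a \<otimes> (q \<oplus> q')"
        unfolding x(1) y(1) using x y md(1) a by (simp add: r_distr a_ac)
      then show ?thesis unfolding K_def using x y md(3) by blast
    qed
    show "x \<otimes> c \<in> K" if "c \<in> carrier R" for c
    proof -
      have "x \<otimes> c = v \<otimes> c \<oplus> a \<otimes> (q \<otimes> c)"
        unfolding x(1) using x md(1) a that by (simp add: l_distr m_assoc)
      then show ?thesis unfolding K_def using x md(4) that by blast
    qed
  qed
  moreover have "m \<subseteq> K"
  proof
    fix x assume "x \<in> m"
    moreover from this have "x = x \<oplus> a \<otimes> \<zero>" using md(1) a by simp
    ultimately show "x \<in> K" unfolding K_def by blast
  qed
  moreover have "a \<in> K"
    using md(2) a unfolding K_def by (intro CollectI exI[of _ \<zero>] exI[of _ \<one>]) simp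
  ultimately have "K = carrier R"
    using m a(2) unfolding maximal_right_ideal_def by blast
  then show ?thesis using r unfolding K_def by blast
qed

lemma ex_maximal_right_ideal:
  assumes K: "submodule K R (regular_module R)" "\<one> \<notin> K"
  shows "\<exists>m. maximal_right_ideal R m \<and> K \<subseteq> m"
proof -
  define \<A> where "\<A> = {L. submodule L R (regular_module R) \<and> \<one> \<notin> L \<and> K \<subseteq> L}"
  have "\<exists>M\<in>\<A>. \<forall>X\<in>\<A>. M \<subseteq> X \<longrightarrow> X = M"
  proof (rule subset_Zorn_nonempty)
    show "\<A> \<noteq> {}" using K by (auto simp: \<A>_def)
    fix \<C> assume ne: "\<C> \<noteq> {}" and ch: "subset.chain \<A> \<C>"
    have sub: "submodule L R (regular_module R)" "\<one> \<notin> L" "K \<subseteq> L" if "L \<in> \<C>" for L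
      using ch that by (auto simp: subset.chain_def \<A>_def)
    have "submodule (\<Union>\<C>) R (regular_module R)"
      unfolding right_ideal_iff
    proof (intro conjI ballI)
      show "\<Union>\<C> \<subseteq> carrier R" using right_idealD(1)[OF sub(1)] by blast
      show "\<zero> \<in> \<Union>\<C>" using ne right_idealD(2)[OF sub(1)] by blast
      show "x \<oplus> y \<in> \<Union>\<C>" if xy: "x \<in> \<Union>\<C>" "y \<in> \<Union>\<C>" for x y
      proof -
        obtain L L' where L: "x \<in> L" "L \<in> \<C>" "y \<in> L'" "L' \<in> \<C>" using xy by blast
        then have "L \<subseteq> L' \<or> L' \<subseteq> L" using ch by (auto simp: subset.chain_def)
        then obtain L'' where "L'' \<in> \<C>" "x \<in> L''" "y \<in> L''" using L by blast
        then show ?thesis using right_idealD(3)[OF sub(1)] by blast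
      qed
      show "x \<otimes> a \<in> \<Union>\<C>" if "a \<in> carrier R" "x \<in> \<Union>\<C>" for a x
        using that right_idealD(4)[OF sub(1)] by blast
    qed
    moreover have "\<one> \<notin> \<Union>\<C>" using sub(2) by blast
    moreover have "K \<subseteq> \<Union>\<C>" using ne sub(3) by blast
    ultimately show "\<Union>\<C> \<in> \<A>" by (simp add: \<A>_def)
  qed
  then obtain m where m: "m \<in> \<A>" "\<And>X. X \<in> \<A> \<Longrightarrow> m \<subseteq> X \<Longrightarrow> X = m" by blast
  have "maximal_right_ideal R m"
    unfolding maximal_right_ideal_def
  proof (intro conjI allI impI)
    show sub: "submodule m R (regular_module R)" using m(1) by (simp add: \<A>_def)
    show "m \<noteq> carrier R" using m(1) right_idealD(6)[OF sub] by (simp add: \<A>_def)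
    fix L assume L: "submodule L R (regular_module R) \<and> m \<subseteq> L \<and> L \<noteq> carrier R"
    then have "\<one> \<notin> L" using right_idealD(6) by blast
    with L m(1) have "L \<in> \<A>" by (auto simp: \<A>_def)
    with L show "L = m" using m(2) by blast
  qed
  with m(1) show ?thesis by (auto simp: \<A>_def)
qed

lemma jacobson_radicalD: "a \<in> jacobson_radical R \<Longrightarrow> a \<in> carrier R"
  "a \<in> jacobson_radical R \<Longrightarrow> maximal_right_ideal R m \<Longrightarrow> a \<in> m"
  by (auto simp: jacobson_radical_def)

lemma jacobson_radical_right_ideal: "submodule (jacobson_radical R) R (regular_module R)"
  unfolding right_ideal_iff jacobson_radical_def
  using right_idealD[OF maximal_right_idealD(1)] by auto

text \<open>
  Otherwise the right ideal \<open>(1 - a) R\<close> would lie in a maximal one, which contains \<open>a\<close>, and hence \<open>1\<close>.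
\<close>

lemma jacobson_radical_right_inverse:
  assumes "a \<in> jacobson_radical R"
  shows "\<exists>w\<in>carrier R. (\<one> \<ominus> a) \<otimes> w = \<one>"
proof (rule ccontr)
  assume no: "\<not> ?thesis"
  have a: "a \<in> carrier R" using assms by (rule jacobson_radicalD)
  define K where "K = {(\<one> \<ominus> a) \<otimes> q | q. q \<in> carrier R}"
  have "submodule K R (regular_module R)"
    unfolding right_ideal_iff
  proof (intro conjI ballI)
    show "K \<subseteq> carrier R" using a by (auto simp: K_def)
    show "\<zero> \<in> K" unfolding K_def using a by (intro CollectI exI[of _ \<zero>]) simp
    fix x assume "x \<in> K"
    then obtain q where x: "x = (\<one> \<ominus> a) \<otimes> q" "q \<in> carrier R" by (auto simp: K_def)
    show "x \<oplus> y \<in> K" if "y \<in> K" for y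
    proof -
      obtain q' where y: "y = (\<one> \<ominus> a) \<otimes> q'" "q' \<in> carrier R"
        using \<open>y \<in> K\<close> by (auto simp: K_def)
      have "x \<oplus> y = (\<one> \<ominus> a) \<otimes> (q \<oplus> q')" using x y a by (simp add: r_distr)
      then show ?thesis unfolding K_def using x y by blast
    qed
    show "x \<otimes> c \<in> K" if "c \<in> carrier R" for c
    proof -
      have "x \<otimes> c = (\<one> \<ominus> a) \<otimes> (q \<otimes> c)" using x a that by (simp add: m_assoc)
      then show ?thesis unfolding K_def using x that by blast
    qed
  qed
  moreover have "\<one> \<notin> K" using no by (auto simp: K_def)
  ultimately obtain m where m: "maximal_right_ideal R m" "K \<subseteq> m" using ex_maximal_right_ideal by blast
  note md = right_idealD[OF maximal_right_idealD(1)[OF m(1)]]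
  have "\<one> \<ominus> a = (\<one> \<ominus> a) \<otimes> \<one>" using a by simp
  then have "\<one> \<ominus> a \<in> K" unfolding K_def by blast
  then have "(\<one> \<ominus> a) \<oplus> a \<in> m" using m(2) md(3) jacobson_radicalD(2)[OF assms m(1)] by blast
  moreover have "(\<one> \<ominus> a) \<oplus> a = \<one>" using a by (simp add: a_minus_def a_assoc l_neg)
  ultimately show False using maximal_right_idealD(2)[OF m(1)] by simp
qed

lemma jacobson_radical_ideal: "ideal (jacobson_radical R) R"
proof (rule idealI[OF ring_axioms])
  let ?J = "jacobson_radical R"
  show "subgroup ?J (add_monoid R)"
    using right_idealD[OF jacobson_radical_right_ideal]
    by (intro subgroup.intro) (auto simp flip: a_inv_def)
  show "a \<otimes> x \<in> ?J" if "a \<in> ?J" "x \<in> carrier R" for a x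
    using right_idealD(4)[OF jacobson_radical_right_ideal] that by blast
  show "x \<otimes> a \<in> ?J" if a: "a \<in> ?J" and x: "x \<in> carrier R" for a x
  proof -
    have ac: "a \<in> carrier R" using a by (rule jacobson_radicalD)
    have "x \<otimes> a \<in> m" if m: "maximal_right_ideal R m" for m
    proof (rule ccontr)
      \<comment> \<open>If \<open>x \<otimes> a \<notin> m\<close> then \<open>x \<otimes> a \<otimes> q\<close> agrees with \<open>x\<close> modulo \<open>m\<close> for some \<open>q\<close>,
        so that \<open>x \<otimes> (1 - a \<otimes> q)\<close> lies in \<open>m\<close>, where \<open>1 - a \<otimes> q\<close> is right invertible.\<close>
      note md = right_idealD[OF maximal_right_idealD(1)[OF m]]
      assume "x \<otimes> a \<notin> m"
      then obtain v q where vq: "v \<in> m" "q \<in> carrier R" "x = v \<oplus> x \<otimes> a \<otimes> q"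
        using maximal_right_ideal_plus[OF m, of "x \<otimes> a" x] x ac by blast
      have "a \<otimes> q \<in> ?J" using right_idealD(4)[OF jacobson_radical_right_ideal] a vq(2) by blast
      then obtain w where w: "w \<in> carrier R" "(\<one> \<ominus> a \<otimes> q) \<otimes> w = \<one>"
        using jacobson_radical_right_inverse by blast
      have vc: "v \<in> carrier R" using md(1) vq(1) by blast
      have "x \<ominus> x \<otimes> a \<otimes> q = (v \<oplus> x \<otimes> a \<otimes> q) \<ominus> x \<otimes> a \<otimes> q" using vq(3) by simp
      also have "\<dots> = v" using vc x ac vq(2) by (simp add: a_minus_def a_assoc r_neg)
      finally have "x \<otimes> (\<one> \<ominus> a \<otimes> q) = v"
        using x ac vq(2) by (simp add: a_minus_def r_distr r_minus m_assoc)
      then have "x \<otimes> ((\<one> \<ominus> a \<otimes> q) \<otimes> w) = v \<otimes> w"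
        using x ac vq(2) w(1) by (simp flip: m_assoc)
      then have "x \<in> m" using w md(4) vq(1) x by simp
      then show False using \<open>x \<otimes> a \<notin> m\<close> md(4) ac by blast
    qed
    then show ?thesis using x ac by (simp add: jacobson_radical_def)
  qed
qed

text \<open>
  The preimage in \<open>R\<close> of a complement of \<open>m\<close> modulo the radical.
\<close>

lemma complement_modulo_jacobson_radical:
  assumes ss: "semisimple_module (R Quot jacobson_radical R) (regular_module (R Quot jacobson_radical R))"
    and m: "submodule m R (regular_module R)" "jacobson_radical R \<subseteq> m"
  obtains S where "submodule S R (regular_module R)" "jacobson_radical R \<subseteq> S"
    "S \<inter> m \<subseteq> jacobson_radical R" "\<And>r. r \<in> carrier R \<Longrightarrow> \<exists>x\<in>m. \<exists>s\<in>S. r = x \<oplus> s"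
proof -
  let ?J = "jacobson_radical R"
  let ?Q = "R Quot ?J"
  interpret J: ideal ?J R by (rule jacobson_radical_ideal)
  interpret Q: ring ?Q by (rule J.quotient_is_ring)
  note md = right_idealD[OF m(1)]
  define \<pi> where "\<pi> x = ?J +> x" for x
  have hom: "\<pi> \<in> ring_hom R ?Q" unfolding \<pi>_def using J.rcos_ring_hom by simp
  have \<pi>: "\<pi> x \<in> carrier ?Q" "\<pi> (x \<oplus> y) = \<pi> x \<oplus>\<^bsub>?Q\<^esub> \<pi> y" "\<pi> (x \<otimes> y) = \<pi> x \<otimes>\<^bsub>?Q\<^esub> \<pi> y"
    if "x \<in> carrier R" "y \<in> carrier R" for x y
    using ring_hom_memE[OF hom] that by auto
  have \<pi>0: "\<pi> x = \<zero>\<^bsub>?Q\<^esub> \<longleftrightarrow> x \<in> ?J" if "x \<in> carrier R" for x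
    using J.a_rcos_const[of x] J.a_rcos_self[OF that] unfolding \<pi>_def FactRing_def by auto
  have surj: "\<exists>x\<in>carrier R. z = \<pi> x" if "z \<in> carrier ?Q" for z
    using that unfolding FactRing_def A_RCOSETS_defs \<pi>_def a_r_coset_def by simp
  have \<pi>eq: "\<exists>j\<in>?J. x = j \<oplus> y" if "\<pi> x = \<pi> y" "x \<in> carrier R" "y \<in> carrier R" for x y
    using J.a_rcos_self[OF that(2)] that(1) unfolding \<pi>_def a_r_coset_def r_coset_def by auto
  have "submodule (\<pi> ` m) ?Q (regular_module ?Q)"
    unfolding Q.right_ideal_iff
  proof (intro conjI ballI)
    show "\<pi> ` m \<subseteq> carrier ?Q" using \<pi>(1) md(1) by blast
    have "\<pi> \<zero> = \<zero>\<^bsub>?Q\<^esub>" using \<pi>0 J.zero_closed by simp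
    then show "\<zero>\<^bsub>?Q\<^esub> \<in> \<pi> ` m" using md(2) by (metis imageI)
    show "z \<oplus>\<^bsub>?Q\<^esub> z' \<in> \<pi> ` m" if zz: "z \<in> \<pi> ` m" "z' \<in> \<pi> ` m" for z z'
    proof -
      obtain x x' where "x \<in> m" "x' \<in> m" "z = \<pi> x" "z' = \<pi> x'" using zz by blast
      then have "z \<oplus>\<^bsub>?Q\<^esub> z' = \<pi> (x \<oplus> x')" "x \<oplus> x' \<in> m" using \<pi>(2) md by auto
      then show ?thesis by (rule image_eqI)
    qed
    show "z \<otimes>\<^bsub>?Q\<^esub> b \<in> \<pi> ` m" if b: "b \<in> carrier ?Q" and z: "z \<in> \<pi> ` m" for b z
    proof -
      obtain x where x: "x \<in> m" "z = \<pi> x" using z by blast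
      obtain a where a: "a \<in> carrier R" "b = \<pi> a" using surj[OF b] by blast
      have "z \<otimes>\<^bsub>?Q\<^esub> b = \<pi> (x \<otimes> a)" "x \<otimes> a \<in> m" using \<pi>(3) md x a by auto
      then show ?thesis by (rule image_eqI)
    qed
  qed
  then obtain B where B: "internal_direct_sum ?Q (regular_module ?Q) (\<pi> ` m) B"
    using ss unfolding semisimple_module_def by blast
  have Bsub: "submodule B ?Q (regular_module ?Q)" and Bint: "\<pi> ` m \<inter> B = {\<zero>\<^bsub>?Q\<^esub>}"
    and Bsum: "\<pi> ` m <+>\<^bsub>regular_module ?Q\<^esub> B = carrier ?Q"
    using B unfolding internal_direct_sum_def by simp_all
  note Bd = Q.right_idealD[OF Bsub]
  define S where "S = {x \<in> carrier R. \<pi> x \<in> B}"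
  show thesis
  proof (rule that[of S])
    show "submodule S R (regular_module R)"
      unfolding right_ideal_iff
    proof (intro conjI ballI)
      have "\<pi> \<zero> = \<zero>\<^bsub>?Q\<^esub>" using \<pi>0 J.zero_closed by simp
      then show "\<zero> \<in> S" using Bd(2) by (simp add: S_def)
      show "x \<oplus> y \<in> S" if "x \<in> S" "y \<in> S" for x y using that \<pi>(2) Bd(3) by (simp add: S_def)
      show "x \<otimes> a \<in> S" if "a \<in> carrier R" "x \<in> S" for x a using that \<pi>(1,3) Bd(4) by (simp add: S_def)
    qed (simp add: S_def)
    show "?J \<subseteq> S"
    proof
      fix x assume x: "x \<in> ?J"
      then have "x \<in> carrier R" by (rule jacobson_radicalD)
      moreover from this x have "\<pi> x = \<zero>\<^bsub>?Q\<^esub>" using \<pi>0 by simp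
      ultimately show "x \<in> S" using Bd(2) by (simp add: S_def)
    qed
    show "S \<inter> m \<subseteq> ?J"
    proof
      fix x assume "x \<in> S \<inter> m"
      then have "\<pi> x \<in> \<pi> ` m \<inter> B" "x \<in> carrier R" by (auto simp: S_def)
      then show "x \<in> ?J" unfolding Bint using \<pi>0 by simp
    qed
    fix r assume r: "r \<in> carrier R"
    then have "\<pi> r \<in> \<pi> ` m <+>\<^bsub>regular_module ?Q\<^esub> B" unfolding Bsum using \<pi>(1) by blast
    then obtain x b where x: "x \<in> m" "b \<in> B" "\<pi> r = \<pi> x \<oplus>\<^bsub>?Q\<^esub> b"
      unfolding set_add_def set_mult_def by auto
    obtain s where s: "s \<in> carrier R" "b = \<pi> s" using surj Bd(1)[OF x(2)] by blast
    have xc: "x \<in> carrier R" using md(1) x(1) by blast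
    have "\<pi> r = \<pi> (x \<oplus> s)" using \<pi>(2)[OF xc s(1)] x(3) s(2) by simp
    then obtain j where j: "j \<in> ?J" "r = j \<oplus> (x \<oplus> s)" using \<pi>eq r xc s(1) by blast
    have "r = (j \<oplus> x) \<oplus> s" unfolding j(2) using jacobson_radicalD(1)[OF j(1)] xc s(1) by (simp add: a_assoc)
    moreover have "j \<oplus> x \<in> m" using md(3) m(2) j(1) x(1) by blast
    moreover have "s \<in> S" using s x(2) by (simp add: S_def)
    ultimately show "\<exists>x\<in>m. \<exists>s\<in>S. r = x \<oplus> s" by blast
  qed
qed

text \<open>The two-sided ideal generated by \<open>E\<close>.\<close>

definition generated_by :: "'a set \<Rightarrow> 'a set"
  where "generated_by E = {x. \<exists>(n::nat) c a b. (\<forall>l<n. c l \<in> E \<and> a l \<in> carrier R \<and> b l \<in> carrier R) \<and>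
    x = (\<Oplus>l\<in>{..<n}. a l \<otimes> c l \<otimes> b l)}"

lemma generated_by_step:
  assumes E: "E \<subseteq> carrier R" and x: "x \<in> generated_by E" and e: "e \<in> E" "a \<in> carrier R" "b \<in> carrier R"
  shows "x \<oplus> a \<otimes> e \<otimes> b \<in> generated_by E"
proof -
  obtain n :: nat and c u v where *: "\<And>l. l < n \<Longrightarrow> c l \<in> E" "\<And>l. l < n \<Longrightarrow> u l \<in> carrier R"
    "\<And>l. l < n \<Longrightarrow> v l \<in> carrier R" "x = (\<Oplus>l\<in>{..<n}. u l \<otimes> c l \<otimes> v l)"
    using x unfolding generated_by_def by blast
  have cc: "c l \<in> carrier R" if "l < n" for l using *(1)[OF that] E by blast
  have ec: "e \<in> carrier R" using e E by blast
  have t: "u l \<otimes> c l \<otimes> v l \<in> carrier R" if "l < n" for l using * cc that by simp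
  have "(\<Oplus>l\<in>{..<Suc n}. (u(n := a)) l \<otimes> (c(n := e)) l \<otimes> (v(n := b)) l)
    = a \<otimes> e \<otimes> b \<oplus> (\<Oplus>l\<in>{..<n}. (u(n := a)) l \<otimes> (c(n := e)) l \<otimes> (v(n := b)) l)"
    unfolding lessThan_Suc using t e ec by (subst finsum_insert) auto
  also have "(\<Oplus>l\<in>{..<n}. (u(n := a)) l \<otimes> (c(n := e)) l \<otimes> (v(n := b)) l) = x"
    unfolding *(4) using t by (intro finsum_cong') auto
  also have "a \<otimes> e \<otimes> b \<oplus> x = x \<oplus> a \<otimes> e \<otimes> b"
    unfolding *(4) using t e ec by (intro a_comm finsum_closed) auto
  finally have "x \<oplus> a \<otimes> e \<otimes> b = (\<Oplus>l\<in>{..<Suc n}. (u(n := a)) l \<otimes> (c(n := e)) l \<otimes> (v(n := b)) l)" by simp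
  moreover have "\<forall>l<Suc n. (c(n := e)) l \<in> E \<and> (u(n := a)) l \<in> carrier R \<and> (v(n := b)) l \<in> carrier R"
    using * e by (simp add: less_Suc_eq)
  ultimately show ?thesis unfolding generated_by_def by blast
qed

lemma generated_by_zero: "\<zero> \<in> generated_by E"
  unfolding generated_by_def by (intro CollectI exI[of _ 0]) simp

lemma generated_by_add_sum:
  assumes E: "E \<subseteq> carrier R" and x: "x \<in> generated_by E" "x \<in> carrier R"
    and c: "\<And>l. l < n \<Longrightarrow> c l \<in> E" "\<And>l. l < n \<Longrightarrow> a l \<in> carrier R" "\<And>l. l < n \<Longrightarrow> b l \<in> carrier R"
  shows "x \<oplus> (\<Oplus>l\<in>{..<n::nat}. a l \<otimes> c l \<otimes> b l) \<in> generated_by E"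
  using c
proof (induction n)
  case (Suc n)
  have cc: "c l \<in> carrier R" if "l < Suc n" for l using Suc.prems(1)[OF that] E by blast
  have t: "a l \<otimes> c l \<otimes> b l \<in> carrier R" if "l < Suc n" for l using Suc.prems(2,3) cc that by simp
  have S: "(\<Oplus>l\<in>{..<n}. a l \<otimes> c l \<otimes> b l) \<in> carrier R" using t by (intro finsum_closed) auto
  have "(\<Oplus>l\<in>{..<Suc n}. a l \<otimes> c l \<otimes> b l) = a n \<otimes> c n \<otimes> b n \<oplus> (\<Oplus>l\<in>{..<n}. a l \<otimes> c l \<otimes> b l)"
    unfolding lessThan_Suc using t by (intro finsum_insert) auto
  then have "x \<oplus> (\<Oplus>l\<in>{..<Suc n}. a l \<otimes> c l \<otimes> b l)
    = (x \<oplus> (\<Oplus>l\<in>{..<n}. a l \<otimes> c l \<otimes> b l)) \<oplus> a n \<otimes> c n \<otimes> b n"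
    using x(2) S t[of n] by (simp add: a_ac)
  moreover have "x \<oplus> (\<Oplus>l\<in>{..<n}. a l \<otimes> c l \<otimes> b l) \<in> generated_by E" using Suc by simp
  ultimately show ?case using generated_by_step[OF E] Suc.prems[of n] by simp
qed (use x in simp)

lemma generated_by_closed:
  assumes "E \<subseteq> carrier R" "x \<in> generated_by E" shows "x \<in> carrier R"
  using assms unfolding generated_by_def by (auto intro!: finsum_closed)

lemma generated_by_right_ideal:
  assumes E: "E \<subseteq> carrier R"
  shows "submodule (generated_by E) R (regular_module R)"
  unfolding right_ideal_iff
proof (intro conjI ballI)
  show "generated_by E \<subseteq> carrier R" using generated_by_closed[OF E] by blast
  show "\<zero> \<in> generated_by E" by (rule generated_by_zero)
  show "x \<oplus> y \<in> generated_by E" if "x \<in> generated_by E" "y \<in> generated_by E" for x y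
  proof -
    obtain n :: nat and c u v where *: "\<And>l. l < n \<Longrightarrow> c l \<in> E" "\<And>l. l < n \<Longrightarrow> u l \<in> carrier R"
      "\<And>l. l < n \<Longrightarrow> v l \<in> carrier R" "y = (\<Oplus>l\<in>{..<n}. u l \<otimes> c l \<otimes> v l)"
      using \<open>y \<in> generated_by E\<close> unfolding generated_by_def by blast
    show ?thesis unfolding *(4) using *(1-3)
      by (rule generated_by_add_sum[OF E that(1) generated_by_closed[OF E that(1)]])
  qed
  show "x \<otimes> r \<in> generated_by E" if "r \<in> carrier R" "x \<in> generated_by E" for r x
  proof -
    obtain n :: nat and c u v where *: "\<And>l. l < n \<Longrightarrow> c l \<in> E" "\<And>l. l < n \<Longrightarrow> u l \<in> carrier R"
      "\<And>l. l < n \<Longrightarrow> v l \<in> carrier R" "x = (\<Oplus>l\<in>{..<n}. u l \<otimes> c l \<otimes> v l)"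
      using \<open>x \<in> generated_by E\<close> unfolding generated_by_def by blast
    have cc: "c l \<in> carrier R" if "l < n" for l using *(1)[OF that] E by blast
    have "x \<otimes> r = (\<Oplus>l\<in>{..<n}. u l \<otimes> c l \<otimes> v l \<otimes> r)"
      unfolding *(4) using *(2,3) cc that(1) by (intro finsum_ldistr) auto
    also have "\<dots> = (\<Oplus>l\<in>{..<n}. u l \<otimes> c l \<otimes> (v l \<otimes> r))"
      using *(2,3) cc that(1) by (intro finsum_cong') (auto simp: m_assoc)
    finally show ?thesis unfolding generated_by_def using * that(1)
      by (intro CollectI exI[of _ n] exI[of _ c] exI[of _ u] exI[of _ "\<lambda>l. v l \<otimes> r"]) simp
  qed
qed

text \<open>
  Modulo the radical \<open>e R\<close> is a complement of a maximal right ideal and thus simple, so that the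
  image of \<open>e R e\<close> is a division ring; units lift along the radical.
\<close>

lemma local_idempotent_if_maximal_complement:
  assumes m: "maximal_right_ideal R m" "e \<in> carrier R" "e \<otimes> e = e" "e \<noteq> \<zero>"
    and S: "submodule S R (regular_module R)" "S \<inter> m \<subseteq> jacobson_radical R" "e \<in> S" "\<one> \<ominus> e \<in> m"
  shows "local_idempotent R e"
proof -
  let ?J = "jacobson_radical R"
  interpret J: ideal ?J R by (rule jacobson_radical_ideal)
  note md = right_idealD[OF maximal_right_idealD(1)[OF m(1)]]
  note Sd = right_idealD[OF S(1)]
  note e = m(2,3)
  have eJ: "e \<notin> ?J"
  proof
    assume "e \<in> ?J"
    then obtain w where w: "w \<in> carrier R" "(\<one> \<ominus> e) \<otimes> w = \<one>"
      using jacobson_radical_right_inverse by blast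
    have "e = e \<otimes> ((\<one> \<ominus> e) \<otimes> w)" using w e by simp
    also have "\<dots> = e \<otimes> (\<one> \<ominus> e) \<otimes> w" using w(1) e(1) by (simp add: m_assoc)
    also have "e \<otimes> (\<one> \<ominus> e) = \<zero>" using e by (simp add: a_minus_def r_distr r_minus r_neg)
    also have "\<zero> \<otimes> w = \<zero>" using w(1) by simp
    finally show False using m(4) by simp
  qed
  \<comment> \<open>Modulo the radical \<open>e R\<close> is simple, so that \<open>e R e\<close> is a division ring there.\<close>
  have right_inv: "\<exists>b\<in>corner R e e. a \<otimes> b = e" if a: "a \<in> corner R e e" "a \<notin> ?J" for a
  proof -
    have ac: "a \<in> carrier R" "e \<otimes> a = a" "a \<otimes> e = a" using a by (auto simp: corner_def)
    have "a \<in> S" using Sd(4)[OF ac(1) S(3)] ac(2) by simp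
    then have "a \<notin> m" using a(2) S(2) by blast
    then obtain x q where x: "x \<in> m" "q \<in> carrier R" "e = x \<oplus> a \<otimes> q"
      using maximal_right_ideal_plus[OF m(1) ac(1) _ e(1)] by blast
    have xc: "x \<in> carrier R" using md(1) x(1) by blast
    define j where "j = e \<ominus> a \<otimes> q"
    have jx: "j = x"
    proof -
      have "(x \<oplus> a \<otimes> q) \<ominus> a \<otimes> q = x" using xc ac x(2) by (simp add: a_minus_def a_assoc r_neg)
      then show ?thesis unfolding j_def using x(3) by simp
    qed
    have "j \<in> S" unfolding j_def a_minus_def using Sd S(3) \<open>a \<in> S\<close> x(2) by simp
    then have jJ: "j \<in> ?J" using jx x(1) S(2) by blast
    then have jc: "j \<in> carrier R" by (rule jacobson_radicalD)
    have jeJ: "j \<otimes> e \<in> ?J" using J.I_r_closed[OF jJ e(1)] .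
    then obtain w where w: "w \<in> carrier R" "(\<one> \<ominus> j \<otimes> e) \<otimes> w = \<one>"
      using jacobson_radical_right_inverse by blast
    have ej: "e \<otimes> j = j" unfolding j_def using e ac x(2)
      by (simp add: a_minus_def r_distr r_minus flip: m_assoc)
    have "a \<otimes> q \<otimes> e = e \<ominus> j \<otimes> e"
    proof -
      have "a \<otimes> q = e \<ominus> j" unfolding j_def using e ac x(2)
        by (simp add: a_minus_def minus_add minus_minus r_neg2)
      then show ?thesis using e jc by (simp add: a_minus_def l_distr l_minus)
    qed
    also have "\<dots> = e \<otimes> (\<one> \<ominus> j \<otimes> e)"
      using e jc ej by (simp add: a_minus_def r_distr r_minus flip: m_assoc)
    finally have "a \<otimes> q \<otimes> e \<otimes> w = e \<otimes> ((\<one> \<ominus> j \<otimes> e) \<otimes> w)"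
      using e jc w(1) by (simp add: m_assoc)
    then have aqew: "a \<otimes> q \<otimes> e \<otimes> w = e" using w e by simp
    define b where "b = e \<otimes> q \<otimes> e \<otimes> w \<otimes> e"
    have "b \<in> corner R e e"
      unfolding b_def using e x(2) w(1) by (intro cornerI) (simp_all add: m_assoc flip: m_assoc[of e e])
    moreover have "a \<otimes> b = e"
    proof -
      have "a \<otimes> b = (a \<otimes> e) \<otimes> q \<otimes> e \<otimes> w \<otimes> e"
        unfolding b_def using e(1) ac(1) x(2) w(1) by (simp add: m_assoc)
      then show ?thesis using ac(3) aqew e by simp
    qed
    ultimately show ?thesis by blast
  qed
  have unit: "\<exists>b\<in>corner R e e. a \<otimes> b = e \<and> b \<otimes> a = e" if a: "a \<in> corner R e e" "a \<notin> ?J" for a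
  proof -
    obtain b where b: "b \<in> corner R e e" "a \<otimes> b = e" using right_inv[OF a] by blast
    have ac: "a \<in> carrier R" "e \<otimes> a = a" "a \<otimes> e = a" using a by (auto simp: corner_def)
    have bc: "b \<in> carrier R" "b \<otimes> e = b" using b by (auto simp: corner_def)
    have "b \<notin> ?J" using J.I_l_closed[of b a] ac(1) b(2) eJ by auto
    then obtain c where c: "c \<in> corner R e e" "b \<otimes> c = e" using right_inv b(1) by blast
    then have cc: "c \<in> carrier R" "e \<otimes> c = c" by (auto simp: corner_def)
    have "a \<otimes> (b \<otimes> c) = c" using b(2) cc ac bc by (simp flip: m_assoc)
    then have "a = c" using c(2) ac by simp
    then show ?thesis using b c by blast
  qed
  have "\<exists>b\<in>corner R e e. a \<otimes> b = e \<and> b \<otimes> a = e \<or> (e \<ominus> a) \<otimes> b = e \<and> b \<otimes> (e \<ominus> a) = e"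
    if a: "a \<in> corner R e e" for a
  proof (cases "a \<in> ?J")
    case False
    then show ?thesis using unit[OF a] by blast
  next
    case True
    have ac: "a \<in> carrier R" using a by (rule corner_closed)
    have "e \<ominus> a \<notin> ?J"
    proof
      assume "e \<ominus> a \<in> ?J"
      then have "(e \<ominus> a) \<oplus> a \<in> ?J" using True by (rule J.a_closed)
      then show False using eJ e ac by (simp add: a_minus_def a_assoc l_neg)
    qed
    moreover have "e \<ominus> a \<in> corner R e e"
      using e a by (intro corner_minus) (auto simp: corner_def)
    ultimately show ?thesis using unit by blast
  qed
  with e m(4) show ?thesis unfolding local_idempotent_def by blast
qed

text \<open>
  Suppose that the ideal generated by the local idempotents lies in a maximal right ideal \<open>m\<close>.
  Write \<open>1 = x + s\<close> with \<open>x \<in> m\<close> and \<open>s\<close> in a complement \<open>S\<close> of \<open>m\<close> modulo the radical. Then \<open>s\<close> is an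
  idempotent modulo the radical and lifts to an idempotent \<open>e\<close>. This \<open>e\<close> is local, so it belongs to
  \<open>m\<close>, while \<open>1 - e \<in> m\<close> as well.
\<close>

lemma semiperfect_generated_by_local_idempotents:
  assumes "semiperfect R"
  shows "\<one> \<in> generated_by {e. local_idempotent R e}"
proof (rule ccontr)
  let ?J = "jacobson_radical R" and ?L = "{e. local_idempotent R e}"
  interpret J: ideal ?J R by (rule jacobson_radical_ideal)
  have ss: "semisimple_module (R Quot ?J) (regular_module (R Quot ?J))"
    and lift: "\<And>x. x \<in> carrier (R Quot ?J) \<Longrightarrow> x \<otimes>\<^bsub>R Quot ?J\<^esub> x = x \<Longrightarrow>
      \<exists>e\<in>carrier R. e \<otimes> e = e \<and> ?J +> e = x"
    using assms unfolding semiperfect_def Let_def by blast+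
  have L: "?L \<subseteq> carrier R" using local_idempotentD(1) by blast
  assume "\<one> \<notin> generated_by ?L"
  then obtain m where m: "maximal_right_ideal R m" "generated_by ?L \<subseteq> m"
    using ex_maximal_right_ideal[OF generated_by_right_ideal[OF L]] by blast
  note md = right_idealD[OF maximal_right_idealD(1)[OF m(1)]]
  have Jm: "?J \<subseteq> m" using m(1) jacobson_radicalD(2) by blast
  obtain S where S: "submodule S R (regular_module R)" "?J \<subseteq> S" "S \<inter> m \<subseteq> ?J"
    "\<And>r. r \<in> carrier R \<Longrightarrow> \<exists>x\<in>m. \<exists>s\<in>S. r = x \<oplus> s"
    using complement_modulo_jacobson_radical[OF ss maximal_right_idealD(1)[OF m(1)] Jm] by blast
  note Sd = right_idealD[OF S(1)]
  obtain x s where xs: "x \<in> m" "s \<in> S" "\<one> = x \<oplus> s" using S(4)[of \<one>] by auto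
  have xc: "x \<in> carrier R" and sc: "s \<in> carrier R" using md(1) Sd(1) xs by auto
  have "s = \<one> \<otimes> s" using sc by simp
  also have "\<dots> = x \<otimes> s \<oplus> s \<otimes> s" unfolding xs(3) using xc sc by (simp add: l_distr)
  finally have s_eq: "s = x \<otimes> s \<oplus> s \<otimes> s" .
  have "x \<otimes> s = s \<ominus> s \<otimes> s"
  proof -
    have "(x \<otimes> s \<oplus> s \<otimes> s) \<ominus> s \<otimes> s = x \<otimes> s" using xc sc by (simp add: a_minus_def a_assoc r_neg)
    then show ?thesis using s_eq by simp
  qed
  then have "x \<otimes> s \<in> S" using Sd xs(2) sc by (simp add: a_minus_def)
  then have xsJ: "x \<otimes> s \<in> ?J" using S(3) md(4)[OF sc xs(1)] by blast
  have hom: "(+>) ?J \<in> ring_hom R (R Quot ?J)" by (rule J.rcos_ring_hom)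
  have "?J +> s = ?J +> (x \<otimes> s \<oplus> s \<otimes> s)" using s_eq by simp
  also have "\<dots> = ?J +> (s \<otimes> s)"
  proof -
    have "x \<otimes> s \<oplus> s \<otimes> s \<in> ?J +> (s \<otimes> s)" using xsJ unfolding a_r_coset_def r_coset_def by auto
    then show ?thesis using J.a_repr_independence'[of _ "s \<otimes> s"] sc by simp
  qed
  also have "\<dots> = (?J +> s) \<otimes>\<^bsub>R Quot ?J\<^esub> (?J +> s)" using ring_hom_memE(2)[OF hom sc sc] .
  finally obtain e where e: "e \<in> carrier R" "e \<otimes> e = e" "?J +> e = ?J +> s"
    using lift[of "?J +> s"] ring_hom_memE(1)[OF hom sc] by auto
  have "e \<in> ?J +> s" using J.a_rcos_self[OF e(1)] e(3) by simp
  then obtain j where j: "j \<in> ?J" "e = j \<oplus> s" unfolding a_r_coset_def r_coset_def by auto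
  have jc: "j \<in> carrier R" using j(1) by (rule jacobson_radicalD)
  have eS: "e \<in> S" unfolding j(2) using Sd(3) S(2) j(1) xs(2) by blast
  have "\<one> \<ominus> e = x \<oplus> \<ominus> j"
    unfolding xs(3) j(2) using xc sc jc by algebra
  then have em: "\<one> \<ominus> e \<in> m" using md(3)[OF xs(1) md(5)] Jm j(1) by auto
  have e0: "e \<noteq> \<zero>"
  proof
    assume "e = \<zero>"
    then have "\<one> \<in> m" using em by (simp add: a_minus_def)
    then show False using maximal_right_idealD(2)[OF m(1)] by simp
  qed
  have "local_idempotent R e"
    using m(1) e(1,2) e0 S(1,3) eS em by (rule local_idempotent_if_maximal_complement)
  then have "\<zero> \<oplus> \<one> \<otimes> e \<otimes> \<one> \<in> generated_by ?L"
    by (intro generated_by_step[OF L generated_by_zero]) auto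
  then have "e \<in> m" using m(2) e(1) by auto
  then have "(\<one> \<ominus> e) \<oplus> e \<in> m" using em md(3) by blast
  then show False using maximal_right_idealD(2)[OF m(1)] e(1) by (simp add: a_minus_def a_assoc l_neg)
qed

text \<open>
  A generating set of local idempotents with the least number of elements contains no two
  isomorphic ones.
\<close>

theorem semiperfect_basic_set:
  assumes "semiperfect R"
  shows "\<exists>E. basic_set R E"
proof -
  define ok where "ok E \<longleftrightarrow> finite E \<and> (\<forall>e\<in>E. local_idempotent R e) \<and> \<one> \<in> generated_by E" for E
  obtain n :: nat and c a b where 1: "\<And>l. l < n \<Longrightarrow> local_idempotent R (c l)" "\<And>l. l < n \<Longrightarrow> a l \<in> carrier R"
    "\<And>l. l < n \<Longrightarrow> b l \<in> carrier R" "\<one> = (\<Oplus>l\<in>{..<n}. a l \<otimes> c l \<otimes> b l)"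
    using semiperfect_generated_by_local_idempotents[OF assms] unfolding generated_by_def by blast
  have "\<one> \<in> generated_by (c ` {..<n})"
    unfolding generated_by_def using 1(2-4)
    by (intro CollectI exI[of _ n] exI[of _ c] exI[of _ a] exI[of _ b]) simp
  then have "ok (c ` {..<n})" using 1(1) by (auto simp: ok_def)
  then obtain E where E: "ok E" and least: "\<And>E'. ok E' \<Longrightarrow> card E \<le> card E'"
    using exists_least_iff[of "\<lambda>m. \<exists>E. ok E \<and> card E = m"] by (metis linorder_not_less)
  have fin: "finite E" and loc: "\<And>e. e \<in> E \<Longrightarrow> local_idempotent R e" and gen: "\<one> \<in> generated_by E"
    using E by (auto simp: ok_def)
  obtain n :: nat and c a b where 2: "\<And>l. l < n \<Longrightarrow> c l \<in> E" "\<And>l. l < n \<Longrightarrow> a l \<in> carrier R"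
    "\<And>l. l < n \<Longrightarrow> b l \<in> carrier R" "\<one> = (\<Oplus>l\<in>{..<n}. a l \<otimes> c l \<otimes> b l)"
    using gen unfolding generated_by_def by blast
  have "corner R e f \<subseteq> corner_radical R e f" if ef: "e \<in> E" "f \<in> E" "e \<noteq> f" for e f
  proof (rule ccontr)
    \<comment> \<open>Otherwise \<open>e = u \<otimes> v\<close> factors through \<open>f\<close>, and \<open>E - {e}\<close> still generates.\<close>
    assume "\<not> ?thesis"
    then obtain u v where uv: "u \<in> corner R e f" "v \<in> corner R f e" "u \<otimes> v = e"
      unfolding corner_radical_def by blast
    have uvc: "u \<in> carrier R" "v \<in> carrier R" "u \<otimes> f = u" "e \<in> carrier R" "f \<in> carrier R"
      using uv local_idempotentD(1)[OF loc] ef by (auto simp: corner_def)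
    have ufv: "u \<otimes> f \<otimes> v = e" using uvc uv by simp
    define c' where "c' l = (if c l = e then f else c l)" for l
    define a' where "a' l = (if c l = e then a l \<otimes> u else a l)" for l
    define b' where "b' l = (if c l = e then v \<otimes> b l else b l)" for l
    have cc: "c l \<in> carrier R" if "l < n" for l using loc[OF 2(1)[OF that]] local_idempotentD(1) by blast
    have "a l \<otimes> c l \<otimes> b l = a' l \<otimes> c' l \<otimes> b' l" if l: "l < n" for l
    proof (cases "c l = e")
      case True
      have "a l \<otimes> (u \<otimes> f \<otimes> v) \<otimes> b l = a l \<otimes> u \<otimes> f \<otimes> (v \<otimes> b l)"
        using 2(2,3)[OF l] uvc(1,2,5) by (simp add: m_assoc)
      then show ?thesis using True ufv by (simp add: a'_def b'_def c'_def)
    qed (simp add: a'_def b'_def c'_def)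
    then have "(\<Oplus>l\<in>{..<n}. a l \<otimes> c l \<otimes> b l) = (\<Oplus>l\<in>{..<n}. a' l \<otimes> c' l \<otimes> b' l)"
      using 2(2,3) cc uvc by (intro finsum_cong') (auto simp: a'_def b'_def c'_def)
    moreover have "c' l \<in> E - {e}" "a' l \<in> carrier R" "b' l \<in> carrier R" if "l < n" for l
      using 2(1-3)[OF that] ef uvc by (auto simp: a'_def b'_def c'_def)
    ultimately have "\<one> \<in> generated_by (E - {e})"
      unfolding generated_by_def using 2(4)
      by (intro CollectI exI[of _ n] exI[of _ c'] exI[of _ a'] exI[of _ b']) simp
    then have "ok (E - {e})" using fin loc by (simp add: ok_def)
    from least[OF this] show False using card_Diff1_less[OF fin ef(1)] by linarith
  qed
  moreover have "\<exists>(n::nat) c a b. (\<forall>l<n. c l \<in> E \<and> a l \<in> carrier R \<and> b l \<in> carrier R) \<and>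
      \<one> = (\<Oplus>l\<in>{..<n}. a l \<otimes> c l \<otimes> b l)"
    using gen unfolding generated_by_def by (rule CollectD)
  ultimately have "basic_set R E"
    by (intro basic_set.intro basic_set_axioms.intro ring_axioms fin loc)
  then show ?thesis ..
qed

end

lemma (in basic_set) basic_set_opp_ring: "basic_set (opp_ring R) E"
proof -
  have corner: "corner (opp_ring R) e f = corner R f e" for e f by (auto simp: corner_def)
  have inv: "\<ominus>\<^bsub>opp_ring R\<^esub> x = \<ominus> x" for x by (simp add: a_inv_def opp_ring_def)
  have minus: "x \<ominus>\<^bsub>opp_ring R\<^esub> z = x \<ominus> z" for x z by (simp add: a_minus_def inv)
  have fs: "finsum (opp_ring R) h I = finsum R h I" for h :: "nat \<Rightarrow> 'a" and I
    by (simp add: finsum_def opp_ring_def)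
  show ?thesis
  proof (intro basic_set.intro basic_set_axioms.intro ring_opp_ring ring_axioms finite_E)
    show "local_idempotent (opp_ring R) e" if "e \<in> E" for e
      using local_E[OF that] unfolding local_idempotent_def corner opp_ring_simps minus by blast
    show "corner (opp_ring R) e f \<subseteq> corner_radical (opp_ring R) e f" if "e \<in> E" "f \<in> E" "e \<noteq> f" for e f
      using not_iso_E[OF that] unfolding corner_radical_def corner opp_ring_simps by blast
    obtain n :: nat and c a b where 1: "\<And>l. l < n \<Longrightarrow> c l \<in> E" "\<And>l. l < n \<Longrightarrow> a l \<in> carrier R"
      "\<And>l. l < n \<Longrightarrow> b l \<in> carrier R" "\<one> = (\<Oplus>l\<in>{..<n}. a l \<otimes> c l \<otimes> b l)"
      using generating_E by blast
    have "(\<Oplus>l\<in>{..<n}. a l \<otimes> c l \<otimes> b l) = (\<Oplus>l\<in>{..<n}. a l \<otimes> (c l \<otimes> b l))"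
      using 1(1-3) by (intro finsum_cong') (auto simp: m_assoc)
    then show "\<exists>(n::nat) c a b. (\<forall>l<n. c l \<in> E \<and> a l \<in> carrier (opp_ring R) \<and> b l \<in> carrier (opp_ring R)) \<and>
      \<one>\<^bsub>opp_ring R\<^esub> = (\<Oplus>\<^bsub>opp_ring R\<^esub>l\<in>{..<n}. a l \<otimes>\<^bsub>opp_ring R\<^esub> c l \<otimes>\<^bsub>opp_ring R\<^esub> b l)"
      unfolding fs using 1
      by (intro exI[of _ n] exI[of _ c] exI[of _ b] exI[of _ a]) simp
  qed
qed


section \<open>Quotient modules and trace ideals\<close>

context
  fixes R :: "('a, 'r) ring_scheme" and M :: "('a, 'm) module" and N :: "'m set"
  assumes M: "right_module R M" and N: "submodule N R M"
begin

interpretation M: right_module R M by (rule M)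

interpretation N: abelian_subgroup N M
  using N by (intro abelian_subgroupI3 additive_subgroup.intro submodule.axioms(1)[of N R M] M.M.abelian_group_axioms)

private lemma quotient_facts:
  shows "x \<in> carrier M \<Longrightarrow> N +>\<^bsub>M\<^esub> x \<in> carrier (quotient_module M N)"
    and "X \<in> carrier (quotient_module M N) \<Longrightarrow> \<exists>x\<in>carrier M. X = N +>\<^bsub>M\<^esub> x"
    and "x \<in> carrier M \<Longrightarrow> y \<in> carrier M \<Longrightarrow>
      (N +>\<^bsub>M\<^esub> x) \<oplus>\<^bsub>quotient_module M N\<^esub> (N +>\<^bsub>M\<^esub> y) = N +>\<^bsub>M\<^esub> (x \<oplus>\<^bsub>M\<^esub> y)"
    and "\<zero>\<^bsub>quotient_module M N\<^esub> = N +>\<^bsub>M\<^esub> \<zero>\<^bsub>M\<^esub>"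
    and "a \<in> carrier R \<Longrightarrow> x \<in> carrier M \<Longrightarrow>
      a \<odot>\<^bsub>quotient_module M N\<^esub> (N +>\<^bsub>M\<^esub> x) = N +>\<^bsub>M\<^esub> (a \<odot>\<^bsub>M\<^esub> x)"
    and "x \<in> carrier M \<Longrightarrow> y \<in> carrier M \<Longrightarrow> N +>\<^bsub>M\<^esub> x = N +>\<^bsub>M\<^esub> y \<Longrightarrow> \<exists>n\<in>N. x = n \<oplus>\<^bsub>M\<^esub> y"
    and "n \<in> N \<Longrightarrow> N +>\<^bsub>M\<^esub> n = N +>\<^bsub>M\<^esub> \<zero>\<^bsub>M\<^esub>"
proof -
  have Nd: "N \<subseteq> carrier M" "\<zero>\<^bsub>M\<^esub> \<in> N" "\<And>a n. a \<in> carrier R \<Longrightarrow> n \<in> N \<Longrightarrow> a \<odot>\<^bsub>M\<^esub> n \<in> N"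
    using N unfolding M.submodule_iff by auto
  show "N +>\<^bsub>M\<^esub> x \<in> carrier (quotient_module M N)" if "x \<in> carrier M"
    using M.M.a_rcosetsI[OF Nd(1) that] by (simp add: quotient_module_def)
  show "\<exists>x\<in>carrier M. X = N +>\<^bsub>M\<^esub> x" if "X \<in> carrier (quotient_module M N)"
    using that unfolding quotient_module_def A_RCOSETS_defs a_r_coset_def by simp
  show "(N +>\<^bsub>M\<^esub> x) \<oplus>\<^bsub>quotient_module M N\<^esub> (N +>\<^bsub>M\<^esub> y) = N +>\<^bsub>M\<^esub> (x \<oplus>\<^bsub>M\<^esub> y)"
    if "x \<in> carrier M" "y \<in> carrier M"
    using N.a_rcos_sum[OF that] by (simp add: quotient_module_def)
  show zero: "N +>\<^bsub>M\<^esub> n = N +>\<^bsub>M\<^esub> \<zero>\<^bsub>M\<^esub>" if "n \<in> N" for n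
    using N.a_rcos_const[OF that] N.a_rcos_const[OF Nd(2)] by simp
  show "\<zero>\<^bsub>quotient_module M N\<^esub> = N +>\<^bsub>M\<^esub> \<zero>\<^bsub>M\<^esub>"
    using N.a_rcos_const[OF Nd(2)] by (simp add: quotient_module_def)
  have mem: "z \<in> N +>\<^bsub>M\<^esub> x \<longleftrightarrow> (\<exists>n\<in>N. z = n \<oplus>\<^bsub>M\<^esub> x)" for z x
    by (simp add: a_r_coset_def r_coset_def)
  show "a \<odot>\<^bsub>quotient_module M N\<^esub> (N +>\<^bsub>M\<^esub> x) = N +>\<^bsub>M\<^esub> (a \<odot>\<^bsub>M\<^esub> x)" if a: "a \<in> carrier R" and x: "x \<in> carrier M"
  proof -
    have eq: "N +>\<^bsub>M\<^esub> (a \<odot>\<^bsub>M\<^esub> z) = N +>\<^bsub>M\<^esub> (a \<odot>\<^bsub>M\<^esub> x)" if z: "z \<in> N +>\<^bsub>M\<^esub> x" for z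
    proof -
      obtain n where n: "n \<in> N" "z = n \<oplus>\<^bsub>M\<^esub> x" using z mem by blast
      have nc: "n \<in> carrier M" using n(1) Nd(1) by blast
      have "a \<odot>\<^bsub>M\<^esub> z = a \<odot>\<^bsub>M\<^esub> n \<oplus>\<^bsub>M\<^esub> a \<odot>\<^bsub>M\<^esub> x" using a x nc n(2) by (simp add: M.smult_r_distr)
      then have "a \<odot>\<^bsub>M\<^esub> z \<in> N +>\<^bsub>M\<^esub> (a \<odot>\<^bsub>M\<^esub> x)" using mem Nd(3)[OF a n(1)] by blast
      then show ?thesis using N.a_repr_independence' a x by simp
    qed
    have "N +>\<^bsub>M\<^esub> x \<noteq> {}" using N.a_rcos_self[OF x] by blast
    moreover have "a \<odot>\<^bsub>quotient_module M N\<^esub> (N +>\<^bsub>M\<^esub> x) = (\<Union>z\<in>N +>\<^bsub>M\<^esub> x. N +>\<^bsub>M\<^esub> (a \<odot>\<^bsub>M\<^esub> z))"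
      by (simp add: quotient_module_def)
    ultimately show ?thesis using SUP_eq_const[OF _ eq] by simp
  qed
  show "\<exists>n\<in>N. x = n \<oplus>\<^bsub>M\<^esub> y" if "x \<in> carrier M" "y \<in> carrier M" "N +>\<^bsub>M\<^esub> x = N +>\<^bsub>M\<^esub> y"
    using N.a_rcos_self[OF that(1)] mem unfolding that(3) by blast
qed

lemma right_module_quotient_module: "right_module R (quotient_module M N)"
proof -
  let ?Q = "quotient_module M N"
  have abel: "abelian_group ?Q"
  proof (rule abelian_groupI)
    show "\<zero>\<^bsub>?Q\<^esub> \<in> carrier ?Q" using quotient_facts(1,4) by simp
    fix X assume "X \<in> carrier ?Q"
    then obtain x where x: "x \<in> carrier M" "X = N +>\<^bsub>M\<^esub> x" using quotient_facts(2) by blast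
    show "\<zero>\<^bsub>?Q\<^esub> \<oplus>\<^bsub>?Q\<^esub> X = X" using x quotient_facts(3,4) by simp
    have "(N +>\<^bsub>M\<^esub> (\<ominus>\<^bsub>M\<^esub> x)) \<oplus>\<^bsub>?Q\<^esub> X = \<zero>\<^bsub>?Q\<^esub>" using x quotient_facts(3,4) by (simp add: M.M.l_neg)
    then show "\<exists>Y\<in>carrier ?Q. Y \<oplus>\<^bsub>?Q\<^esub> X = \<zero>\<^bsub>?Q\<^esub>" using quotient_facts(1) x by blast
    fix Y assume "Y \<in> carrier ?Q"
    then obtain y where y: "y \<in> carrier M" "Y = N +>\<^bsub>M\<^esub> y" using quotient_facts(2) by blast
    show "X \<oplus>\<^bsub>?Q\<^esub> Y \<in> carrier ?Q" using x y quotient_facts(1,3) by simp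
    show "X \<oplus>\<^bsub>?Q\<^esub> Y = Y \<oplus>\<^bsub>?Q\<^esub> X" using x y quotient_facts(3) by (simp add: M.M.a_comm)
    fix Z assume "Z \<in> carrier ?Q"
    then obtain z where z: "z \<in> carrier M" "Z = N +>\<^bsub>M\<^esub> z" using quotient_facts(2) by blast
    show "X \<oplus>\<^bsub>?Q\<^esub> Y \<oplus>\<^bsub>?Q\<^esub> Z = X \<oplus>\<^bsub>?Q\<^esub> (Y \<oplus>\<^bsub>?Q\<^esub> Z)"
      using x y z quotient_facts(3) by (simp add: M.M.a_assoc)
  qed
  show ?thesis
  proof (rule right_moduleI[OF M.R.ring_axioms abel])
    fix X assume "X \<in> carrier ?Q"
    then obtain x where x: "x \<in> carrier M" "X = N +>\<^bsub>M\<^esub> x" using quotient_facts(2) by blast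
    show "\<one>\<^bsub>R\<^esub> \<odot>\<^bsub>?Q\<^esub> X = X" using x quotient_facts(5) by simp
    fix a assume a: "a \<in> carrier R"
    show "a \<odot>\<^bsub>?Q\<^esub> X \<in> carrier ?Q" using x a quotient_facts(1,5) by simp
    show "(a \<oplus>\<^bsub>R\<^esub> b) \<odot>\<^bsub>?Q\<^esub> X = a \<odot>\<^bsub>?Q\<^esub> X \<oplus>\<^bsub>?Q\<^esub> b \<odot>\<^bsub>?Q\<^esub> X" if "b \<in> carrier R" for b
      using x a that quotient_facts(3,5) by (simp add: M.smult_l_distr)
    show "(a \<otimes>\<^bsub>R\<^esub> b) \<odot>\<^bsub>?Q\<^esub> X = b \<odot>\<^bsub>?Q\<^esub> (a \<odot>\<^bsub>?Q\<^esub> X)" if "b \<in> carrier R" for b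
      using x a that quotient_facts(5) by (simp add: M.smult_assoc)
    fix Y assume "Y \<in> carrier ?Q"
    then obtain y where y: "y \<in> carrier M" "Y = N +>\<^bsub>M\<^esub> y" using quotient_facts(2) by blast
    show "a \<odot>\<^bsub>?Q\<^esub> (X \<oplus>\<^bsub>?Q\<^esub> Y) = a \<odot>\<^bsub>?Q\<^esub> X \<oplus>\<^bsub>?Q\<^esub> a \<odot>\<^bsub>?Q\<^esub> Y"
      using x y a quotient_facts(3,5) by (simp add: M.smult_r_distr)
  qed
qed

text \<open>
  Submodules of \<open>M/N\<close> correspond to submodules of \<open>M\<close> that contain \<open>N\<close>.
\<close>

lemma finitely_generated_quotient_iff:
  "finitely_generated R (quotient_module M N) \<longleftrightarrow> (\<exists>F. finite F \<and> F \<subseteq> carrier M \<and>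
    (\<forall>W. submodule W R M \<longrightarrow> F \<subseteq> W \<longrightarrow> N \<subseteq> W \<longrightarrow> W = carrier M))"
proof
  let ?Q = "quotient_module M N"
  interpret Q: right_module R ?Q by (rule right_module_quotient_module)
  have Nc: "N \<subseteq> carrier M" using N unfolding M.submodule_iff by blast
  {
    assume "finitely_generated R ?Q"
    then obtain S where S: "S \<subseteq> carrier ?Q" "finite S" "module_span R ?Q S = carrier ?Q"
      unfolding finitely_generated_def by blast
    have "S \<subseteq> (\<lambda>x. N +>\<^bsub>M\<^esub> x) ` carrier M" using S(1) quotient_facts(2) by blast
    then obtain F where F: "F \<subseteq> carrier M" "finite F" "S = (\<lambda>x. N +>\<^bsub>M\<^esub> x) ` F"
      using finite_subset_image[OF S(2)] by metis
    have "W = carrier M" if W: "submodule W R M" "F \<subseteq> W" "N \<subseteq> W" for W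
    proof -
      have Wd: "W \<subseteq> carrier M" "\<zero>\<^bsub>M\<^esub> \<in> W" "\<And>x y. x \<in> W \<Longrightarrow> y \<in> W \<Longrightarrow> x \<oplus>\<^bsub>M\<^esub> y \<in> W"
        "\<And>a x. a \<in> carrier R \<Longrightarrow> x \<in> W \<Longrightarrow> a \<odot>\<^bsub>M\<^esub> x \<in> W"
        using W(1) unfolding M.submodule_iff by auto
      have Wc: "x \<in> carrier M" if "x \<in> W" for x using Wd(1) that by blast
      have "submodule ((\<lambda>x. N +>\<^bsub>M\<^esub> x) ` W) R ?Q"
        unfolding Q.submodule_iff
      proof (intro conjI ballI)
        show "(\<lambda>x. N +>\<^bsub>M\<^esub> x) ` W \<subseteq> carrier ?Q" using quotient_facts(1) Wc by blast
        show "\<zero>\<^bsub>?Q\<^esub> \<in> (\<lambda>x. N +>\<^bsub>M\<^esub> x) ` W" unfolding quotient_facts(4) using Wd(2) by (rule imageI)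
        show "X \<oplus>\<^bsub>?Q\<^esub> Y \<in> (\<lambda>x. N +>\<^bsub>M\<^esub> x) ` W"
          if XY: "X \<in> (\<lambda>x. N +>\<^bsub>M\<^esub> x) ` W" "Y \<in> (\<lambda>x. N +>\<^bsub>M\<^esub> x) ` W" for X Y
        proof -
          obtain x y where xy: "x \<in> W" "y \<in> W" "X = N +>\<^bsub>M\<^esub> x" "Y = N +>\<^bsub>M\<^esub> y" using XY by blast
          then have "X \<oplus>\<^bsub>?Q\<^esub> Y = N +>\<^bsub>M\<^esub> (x \<oplus>\<^bsub>M\<^esub> y)" using quotient_facts(3) Wc by simp
          then show ?thesis using Wd(3)[OF xy(1,2)] by (rule image_eqI)
        qed
        show "a \<odot>\<^bsub>?Q\<^esub> X \<in> (\<lambda>x. N +>\<^bsub>M\<^esub> x) ` W"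
          if a: "a \<in> carrier R" and X: "X \<in> (\<lambda>x. N +>\<^bsub>M\<^esub> x) ` W" for a X
        proof -
          obtain x where x: "x \<in> W" "X = N +>\<^bsub>M\<^esub> x" using X by blast
          then have "a \<odot>\<^bsub>?Q\<^esub> X = N +>\<^bsub>M\<^esub> (a \<odot>\<^bsub>M\<^esub> x)" using quotient_facts(5)[OF a] Wc by simp
          then show ?thesis using Wd(4)[OF a x(1)] by (rule image_eqI)
        qed
      qed
      from module_span_minimal[OF _ this] have all: "carrier ?Q \<subseteq> (\<lambda>x. N +>\<^bsub>M\<^esub> x) ` W"
        using W(2) unfolding S(3)[symmetric] F(3) by blast
      have "x \<in> W" if x: "x \<in> carrier M" for x
      proof -
        obtain w where w: "w \<in> W" "N +>\<^bsub>M\<^esub> x = N +>\<^bsub>M\<^esub> w" using all quotient_facts(1)[OF x] by blast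
        obtain n where "n \<in> N" "x = n \<oplus>\<^bsub>M\<^esub> w" using quotient_facts(6)[OF x Wc[OF w(1)] w(2)] by blast
        then show ?thesis using Wd(3) w(1) W(3) by blast
      qed
      then show ?thesis using Wd(1) by blast
    qed
    then show "\<exists>F. finite F \<and> F \<subseteq> carrier M \<and>
      (\<forall>W. submodule W R M \<longrightarrow> F \<subseteq> W \<longrightarrow> N \<subseteq> W \<longrightarrow> W = carrier M)"
      using F(1,2) by blast
  next
    assume "\<exists>F. finite F \<and> F \<subseteq> carrier M \<and>
      (\<forall>W. submodule W R M \<longrightarrow> F \<subseteq> W \<longrightarrow> N \<subseteq> W \<longrightarrow> W = carrier M)"
    then obtain F where F: "finite F" "F \<subseteq> carrier M"
      and gen: "\<And>W. submodule W R M \<Longrightarrow> F \<subseteq> W \<Longrightarrow> N \<subseteq> W \<Longrightarrow> W = carrier M" by blast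
    let ?S = "(\<lambda>x. N +>\<^bsub>M\<^esub> x) ` F"
    have S: "?S \<subseteq> carrier ?Q" using quotient_facts(1) F(2) by blast
    have "H = carrier ?Q" if H: "submodule H R ?Q" "?S \<subseteq> H" for H
    proof -
      have Hd: "H \<subseteq> carrier ?Q" "\<zero>\<^bsub>?Q\<^esub> \<in> H" "\<And>X Y. X \<in> H \<Longrightarrow> Y \<in> H \<Longrightarrow> X \<oplus>\<^bsub>?Q\<^esub> Y \<in> H"
        "\<And>a X. a \<in> carrier R \<Longrightarrow> X \<in> H \<Longrightarrow> a \<odot>\<^bsub>?Q\<^esub> X \<in> H"
        using H(1) unfolding Q.submodule_iff by auto
      let ?W = "{x \<in> carrier M. N +>\<^bsub>M\<^esub> x \<in> H}"
      have "submodule ?W R M"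
        unfolding M.submodule_iff
      proof (intro conjI ballI)
        show "\<zero>\<^bsub>M\<^esub> \<in> ?W" using Hd(2) quotient_facts(4) by simp
        show "x \<oplus>\<^bsub>M\<^esub> y \<in> ?W" if "x \<in> ?W" "y \<in> ?W" for x y
          using that Hd(3)[of "N +>\<^bsub>M\<^esub> x" "N +>\<^bsub>M\<^esub> y"] quotient_facts(3) by simp
        show "a \<odot>\<^bsub>M\<^esub> x \<in> ?W" if "a \<in> carrier R" "x \<in> ?W" for a x
          using that Hd(4)[of a "N +>\<^bsub>M\<^esub> x"] quotient_facts(5) by simp
      qed blast
      moreover have "F \<subseteq> ?W" using F(2) H(2) by blast
      moreover have "N \<subseteq> ?W"
      proof
        fix n assume n: "n \<in> N"
        have "N +>\<^bsub>M\<^esub> n \<in> H"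
          unfolding quotient_facts(7)[OF n] quotient_facts(4)[symmetric] by (rule Hd(2))
        then show "n \<in> ?W" using n Nc by blast
      qed
      ultimately have "?W = carrier M" by (rule gen)
      then have "carrier ?Q \<subseteq> H" using quotient_facts(2) by blast
      then show ?thesis using Hd(1) by blast
    qed
    then have "module_span R ?Q ?S = carrier ?Q"
      using module_span_eq_carrier_iff[OF Q.right_module_axioms S] by blast
    then show "finitely_generated R ?Q"
      unfolding finitely_generated_def using F(1) S by blast
  }
qed

end

context right_module
begin

lemma preimage_ideal_submodule:
  assumes "ideal J R" "f \<in> functionals R M"
  shows "submodule {x \<in> carrier M. f x \<in> J} R M"
proof -
  interpret J: ideal J R by fact
  show ?thesis
    unfolding submodule_iff using assms(2) J.a_closed J.I_r_closed
    by (auto simp: functional_zero functional_add functional_smult)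
qed

lemma ideal_right_ideal: "ideal J R \<Longrightarrow> submodule J R (regular_module R)"
proof -
  assume "ideal J R"
  then interpret J: ideal J R .
  show ?thesis unfolding right_ideal_iff using J.a_closed J.I_r_closed J.a_Hcarr by auto
qed

end

lemma module_mult_ideal_submodule:
  assumes "right_module R M" "I \<subseteq> carrier R"
  shows "submodule (module_mult_ideal R M I) R M"
proof -
  interpret right_module R M by fact
  show ?thesis unfolding module_mult_ideal_def using assms(2)
    by (intro submodule_module_span right_module_axioms) auto
qed

lemma module_mult_ideal_mem: "a \<in> I \<Longrightarrow> x \<in> carrier M \<Longrightarrow> a \<odot>\<^bsub>M\<^esub> x \<in> module_mult_ideal R M I"
  unfolding module_mult_ideal_def by (rule subsetD[OF module_span_superset]) blast

lemma functional_module_mult_ideal: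
  assumes "right_module R M" "ideal J R" "f \<in> functionals R M"
  shows "module_mult_ideal R M J \<subseteq> {x \<in> carrier M. f x \<in> J}"
proof -
  interpret right_module R M by fact
  interpret J: ideal J R by fact
  show ?thesis
    unfolding module_mult_ideal_def
  proof (rule module_span_minimal[OF _ preimage_ideal_submodule[OF assms(2,3)]])
    show "{a \<odot>\<^bsub>M\<^esub> x | a x. a \<in> J \<and> x \<in> carrier M} \<subseteq> {x \<in> carrier M. f x \<in> J}"
      using J.a_Hcarr J.I_l_closed assms(3) by (auto simp: functional_smult)
  qed
qed

text \<open>
  Closure under multiplication from the left holds because \<open>r f\<close> is a functional if \<open>f\<close> is.
\<close>

lemma trace_ideal_ideal:
  fixes M :: "('a, 'm) module"
  assumes "right_module R M" shows "ideal (trace_ideal R M) R"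
proof -
  interpret M: right_module R M by fact
  interpret Reg: right_module R "regular_module R" by (rule right_module_regular_module[OF M.R.ring_axioms])
  let ?G = "\<Union>f\<in>functionals R M. f ` carrier M"
  have "?G \<subseteq> carrier (regular_module R)" by auto
  then have sub: "submodule (trace_ideal R M) R (regular_module R)"
    unfolding trace_ideal_def by (intro submodule_module_span Reg.right_module_axioms)
  note T = M.right_idealD[OF sub]
  show ?thesis
  proof (rule idealI[OF M.R.ring_axioms])
    show "subgroup (trace_ideal R M) (add_monoid R)"
      using T by (intro subgroup.intro) (auto simp flip: a_inv_def)
    show "a \<otimes>\<^bsub>R\<^esub> x \<in> trace_ideal R M" if "a \<in> trace_ideal R M" "x \<in> carrier R" for a x
      using that by (intro T(4))
    fix a r assume a: "a \<in> trace_ideal R M" and r: "r \<in> carrier R"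
    let ?H = "{x \<in> carrier R. r \<otimes>\<^bsub>R\<^esub> x \<in> trace_ideal R M}"
    have "submodule ?H R (regular_module R)"
      unfolding M.right_ideal_iff
    proof (intro conjI ballI)
      show "x \<oplus>\<^bsub>R\<^esub> y \<in> ?H" if "x \<in> ?H" "y \<in> ?H" for x y
        using that r T(3) by (simp add: M.r_distr)
      show "x \<otimes>\<^bsub>R\<^esub> c \<in> ?H" if "c \<in> carrier R" "x \<in> ?H" for x c
        using that r T(4) by (simp flip: M.m_assoc)
    qed (use r T(2) in auto)
    moreover have "?G \<subseteq> ?H"
    proof (intro UN_least image_subsetI)
      fix f x assume f: "f \<in> functionals R M" and x: "x \<in> carrier M"
      have "(\<lambda>x. r \<otimes>\<^bsub>R\<^esub> f x) \<in> functionals R M" using f r by (rule M.functional_scale)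
      then have "r \<otimes>\<^bsub>R\<^esub> f x \<in> ?G" using x by blast
      then have "r \<otimes>\<^bsub>R\<^esub> f x \<in> trace_ideal R M"
        unfolding trace_ideal_def by (rule subsetD[OF module_span_superset])
      then show "f x \<in> ?H" using f x by simp
    qed
    ultimately have "trace_ideal R M \<subseteq> ?H" unfolding trace_ideal_def by (intro module_span_minimal)
    then show "r \<otimes>\<^bsub>R\<^esub> a \<in> trace_ideal R M" using a by blast
  qed
qed

context frame
begin

lemma e_in_trace_ideal:
  assumes "s \<in> A" shows "e s \<in> trace_ideal R M"
proof -
  have "e s \<in> g s ` carrier M" using g_y_same[OF assms] y_closed[OF assms] by (metis imageI)
  then have "e s \<in> (\<Union>f\<in>functionals R M. f ` carrier M)" using functional_g[OF assms] by blast
  then show ?thesis unfolding trace_ideal_def by (rule subsetD[OF module_span_superset])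
qed

lemma trace_ideal_minimal:
  assumes J: "ideal J R" "\<And>s. s \<in> A \<Longrightarrow> e s \<in> J"
  shows "trace_ideal R M \<subseteq> J"
  unfolding trace_ideal_def
proof (rule module_span_minimal[OF _ ideal_right_ideal[OF J(1)]], rule UN_least)
  interpret J: ideal J R by fact
  fix f assume f: "f \<in> functionals R M"
  have "f (y s) \<in> J" if "s \<in> A" for s
  proof -
    have "f (y s) = f (y s) \<otimes> e s" using functional_smult[OF f, of "e s" "y s"] that by (simp add: smult_e_y)
    moreover have "f (y s) \<otimes> e s \<in> J" using J.I_l_closed[OF J(2)[OF that]] f that by simp
    ultimately show ?thesis by simp
  qed
  then have "{x \<in> carrier M. f x \<in> J} = carrier M"
    by (intro submodule_eq_carrier preimage_ideal_submodule J(1) f) auto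
  then show "f ` carrier M \<subseteq> J" by blast
qed

end

context basic_set
begin

text \<open>
  The numbers of members with an idempotent of finite multiplicity are bounded in finite biorthogonal
  families, so there is a largest family \<open>S\<close> with such idempotents only. If a family \<open>S' \<supseteq> S\<close> captures
  \<open>x\<close>, then each further member has an idempotent \<open>e \<in> I\<close> and its element \<open>y = y e\<close> lies in \<open>P I\<close>. So
  the elements of \<open>S\<close> generate \<open>P\<close> modulo \<open>P I\<close>.
\<close>

lemma finitely_generated_modulo_ideal:
  fixes P :: "('a, 'm) module"
  assumes P: "projective R P" and I: "I \<subseteq> carrier R" "\<And>e. e \<in> E \<Longrightarrow> multiplicity R P e = \<infinity> \<Longrightarrow> e \<in> I"
  shows "finitely_generated R (quotient_module P (module_mult_ideal R P I))"
proof -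
  interpret P: right_module R P using P by (rule projective_right_module)
  define D where "D = {e \<in> E. multiplicity R P e \<noteq> \<infinity>}"
  have finD: "finite D" using finite_E by (simp add: D_def)
  define ok where "ok S \<longleftrightarrow> finite S \<and> biorthogonal_set R P S \<and> fst ` S \<subseteq> D" for S
  have bound: "card S \<le> (\<Sum>e\<in>D. the_enat (multiplicity R P e))" if S: "ok S" for S
  proof -
    have fin: "finite S" and bi: "biorthogonal_set R P S" and SD: "fst ` S \<subseteq> D" using S by (auto simp: ok_def)
    have "S = (\<Union>e\<in>D. {s \<in> S. fst s = e})" using SD by auto
    then have "card S = card (\<Union>e\<in>D. {s \<in> S. fst s = e})" by (rule arg_cong)
    also have "\<dots> \<le> (\<Sum>e\<in>D. card {s \<in> S. fst s = e})" using finD by (rule card_UN_le)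
    also have "\<dots> \<le> (\<Sum>e\<in>D. the_enat (multiplicity R P e))"
    proof (rule sum_mono)
      fix e assume e: "e \<in> D"
      have "biorthogonal_set R P {s \<in> S. fst s = e}"
        using biorthogonal_reindex[OF bi, of "\<lambda>s. s" "{s \<in> S. fst s = e}"] by auto
      then have "enat (card {s \<in> S. fst s = e}) \<le> multiplicity R P e"
        by (rule biorthogonal_card_le_multiplicity) (use fin in simp_all)
      then show "card {s \<in> S. fst s = e} \<le> the_enat (multiplicity R P e)"
        using e by (auto simp: D_def)
    qed
    finally show ?thesis .
  qed
  have "biorthogonal_set R P {}"
    by (intro biorthogonal.intro biorthogonal_axioms.intro P.right_module_axioms) auto
  then have "ok {}" by (simp add: ok_def)
  moreover have "\<forall>S. ok S \<longrightarrow> card S < Suc (\<Sum>e\<in>D. the_enat (multiplicity R P e))"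
    using bound by (simp add: less_Suc_eq_le)
  ultimately have "\<exists>S. ok S \<and> (\<forall>S'. ok S' \<longrightarrow> card S' \<le> card S)"
    by (rule ex_has_greatest_nat)
  then obtain S where "ok S \<and> (\<forall>S'. ok S' \<longrightarrow> card S' \<le> card S)" ..
  then have S: "ok S" and greatest: "\<And>S'. ok S' \<Longrightarrow> card S' \<le> card S" by simp_all
  have fin: "finite S" and bi: "biorthogonal_set R P S" and SD: "fst ` S \<subseteq> D" using S by (auto simp: ok_def)
  have SE: "fst ` S \<subseteq> E" using SD by (auto simp: D_def)
  interpret S: biorthogonal R P S fst "\<lambda>s. fst (snd s)" "\<lambda>s. snd (snd s)" by (rule bi)
  have "W = carrier P"
    if W: "submodule W R P" "(\<lambda>s. fst (snd s)) ` S \<subseteq> W" "module_mult_ideal R P I \<subseteq> W" for W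
  proof -
    have "x \<in> W" if x: "x \<in> carrier P" for x
    proof -
      obtain S' where S': "S \<subseteq> S'" "finite S'" "biorthogonal_set R P S'" "fst ` S' \<subseteq> E"
        "set_component P S' x = x"
        using biorthogonal_set_extend_spanning[OF P fin bi SE x] by blast
      interpret S': biorthogonal R P S' fst "\<lambda>s. fst (snd s)" "\<lambda>s. snd (snd s)" by (rule S'(3))
      \<comment> \<open>By maximality the members of \<open>S'\<close> with idempotent in \<open>D\<close> are those of \<open>S\<close>.\<close>
      let ?T = "{s \<in> S'. fst s \<in> D}"
      have "biorthogonal_set R P ?T"
        using biorthogonal_reindex[OF S'(3), of "\<lambda>s. s" ?T] by auto
      then have "ok ?T" using S'(2) by (auto simp: ok_def)
      then have "card ?T \<le> card S" by (rule greatest)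
      moreover have "S \<subseteq> ?T" using S'(1) SD by blast
      ultimately have T: "?T = S" using card_seteq[of ?T S] S'(2) by simp
      have "snd (snd s) x \<odot>\<^bsub>P\<^esub> fst (snd s) \<in> W" if s: "s \<in> S'" for s
      proof -
        have "fst (snd s) \<in> W"
        proof (cases "fst s \<in> D")
          case True
          then have "s \<in> S" using s T by blast
          then show ?thesis using W(2) by blast
        next
          case False
          then have "fst s \<in> I" using s S'(4) I(2) by (auto simp: D_def)
          then have "fst s \<odot>\<^bsub>P\<^esub> fst (snd s) \<in> module_mult_ideal R P I"
            using S'.y_closed[OF s] by (rule module_mult_ideal_mem)
          then show ?thesis using W(3) S'.smult_e_y[OF s] by auto
        qed
        then show ?thesis using W(1) S'.g_closed[OF s x] unfolding P.submodule_iff by blast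
      qed
      then have "set_component P S' x \<in> W"
        unfolding S'.component_def by (intro P.submodule_finsum_closed[OF W(1)]) auto
      then show ?thesis using S'(5) by simp
    qed
    then show ?thesis using W(1) unfolding P.submodule_iff by blast
  qed
  moreover have "(\<lambda>s. fst (snd s)) ` S \<subseteq> carrier P" using S.y_closed by blast
  ultimately show ?thesis
    unfolding finitely_generated_quotient_iff[OF P.right_module_axioms module_mult_ideal_submodule[OF P.right_module_axioms I(1)]]
    using fin by (intro exI[of _ "(\<lambda>s. fst (snd s)) ` S"]) blast
qed

text \<open>
  A finite family \<open>S\<close> captures the generators of \<open>P\<close> modulo \<open>P J\<close> and is extended by a further member
  with idempotent \<open>e\<close>. The functional of the new member vanishes on these generators, hence takes
  values in \<open>J\<close> only, and one of its values is \<open>e\<close>.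
\<close>

lemma infinite_multiplicity_in_ideal:
  fixes P :: "('a, 'm) module"
  assumes P: "projective R P" and J: "ideal J R"
    and fg: "finitely_generated R (quotient_module P (module_mult_ideal R P J))"
    and e: "e \<in> E" "multiplicity R P e = \<infinity>"
  shows "e \<in> J"
proof -
  interpret P: right_module R P using P by (rule projective_right_module)
  interpret J: ideal J R by fact
  have Jc: "J \<subseteq> carrier R" using J.a_Hcarr by blast
  obtain F where F: "finite F" "F \<subseteq> carrier P"
    "\<And>W. submodule W R P \<Longrightarrow> F \<subseteq> W \<Longrightarrow> module_mult_ideal R P J \<subseteq> W \<Longrightarrow> W = carrier P"
    using fg finitely_generated_quotient_iff[OF P.right_module_axioms module_mult_ideal_submodule[OF P.right_module_axioms Jc]]
    by blast
  have "\<exists>S. finite S \<and> biorthogonal_set R P S \<and> fst ` S \<subseteq> E \<and> (\<forall>x\<in>F. set_component P S x = x)"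
    using F(1,2)
  proof (induction F rule: finite_induct)
    case empty
    have "biorthogonal_set R P {}"
      by (intro biorthogonal.intro biorthogonal_axioms.intro P.right_module_axioms) auto
    then show ?case by (intro exI[of _ "{}"]) simp
  next
    case (insert x F)
    then obtain S where "finite S \<and> biorthogonal_set R P S \<and> fst ` S \<subseteq> E \<and>
      (\<forall>x\<in>F. set_component P S x = x)" by auto
    then have S: "finite S" "biorthogonal_set R P S" "fst ` S \<subseteq> E"
      "\<And>z. z \<in> F \<Longrightarrow> set_component P S z = z" by simp_all
    obtain S' where S': "S \<subseteq> S'" "finite S'" "biorthogonal_set R P S'" "fst ` S' \<subseteq> E"
      "set_component P S' x = x"
      using biorthogonal_set_extend_spanning[OF P S(1-3), of x] insert.prems by blast
    interpret S': biorthogonal R P S' fst "\<lambda>s. fst (snd s)" "\<lambda>s. snd (snd s)" by (rule S'(3))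
    have "set_component P S' z = z" if "z \<in> F" for z
      using insert.prems that by (intro S'.component_mono[OF S'(2,1) subset_refl _ S(4)]) auto
    then show ?case using S' by (intro exI[of _ S']) simp
  qed
  then obtain S where S: "finite S" "biorthogonal_set R P S" "fst ` S \<subseteq> E"
    "\<And>x. x \<in> F \<Longrightarrow> set_component P S x = x" by blast
  interpret S: biorthogonal R P S fst "\<lambda>s. fst (snd s)" "\<lambda>s. snd (snd s)" by (rule S(2))
  define n where "n = Suc (card {s \<in> S. fst s = e})"
  have "enat n \<le> multiplicity R P e" using e(2) by simp
  then obtain y f where yf: "biorthogonal R P {..<n} (\<lambda>_. e) y f"
    using biorthogonal_if_le_multiplicity[OF _ P.right_module_axioms] by blast
  interpret K: biorthogonal R P "{..<n}" "\<lambda>_. e" y f by (rule yf)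
  \<comment> \<open>There are more copies of \<open>e R\<close> available than \<open>S\<close> can absorb.\<close>
  have "\<exists>k\<in>{..<n}. \<exists>j\<in>{..<n}. f k (set_residual P S (y j)) \<notin> corner_radical R e e"
  proof (rule ccontr)
    assume "\<not> ?thesis"
    then have "card {..<n} \<le> card {s \<in> S. fst s = e}"
      using S(3) by (intro card_le_if_residuals_radical[OF S(2,1) _ e(1) yf]) auto
    then show False by (simp add: n_def)
  qed
  then obtain k j where kj: "k \<in> {..<n}" "j \<in> {..<n}" "f k (set_residual P S (y j)) \<notin> corner_radical R e e"
    by blast
  obtain u where u: "(e, set_residual P S (y j), \<lambda>z. u \<otimes> f k (set_residual P S z)) \<notin> S"
    "biorthogonal_set R P (insert (e, set_residual P S (y j), \<lambda>z. u \<otimes> f k (set_residual P S z)) S)"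
    using biorthogonal_set_extend_by_one[OF S(1,2) local_E[OF e(1)] K.y_closed[OF kj(2)] K.smult_e_y[OF kj(2)]
        K.functional_g[OF kj(1)] K.mult_e_g[OF kj(1)] kj(3)] by metis
  define s where "s = (e, set_residual P S (y j), \<lambda>z. u \<otimes> f k (set_residual P S z))"
  note u = u[folded s_def]
  interpret T: biorthogonal R P "insert s S" fst "\<lambda>s. fst (snd s)" "\<lambda>s. snd (snd s)" by (rule u(2))
  have "s \<in> insert s S" by simp
  note s = T.functional_g[OF this] T.y_closed[OF this] T.g_y_same[OF this]
  let ?W = "{x \<in> carrier P. snd (snd s) x \<in> J}"
  have "?W = carrier P"
  proof (rule F(3))
    show "submodule ?W R P" using J s(1) by (rule P.preimage_ideal_submodule)
    show "F \<subseteq> ?W"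
    proof
      fix x assume x: "x \<in> F"
      then have "snd (snd s) (set_component P S x) = \<zero>"
        using T.g_component[OF S(1), of s x] u(1) F(2) by auto
      then show "x \<in> ?W" using S(4)[OF x] F(2) x by auto
    qed
    show "module_mult_ideal R P J \<subseteq> ?W"
      using P.right_module_axioms J s(1) by (rule functional_module_mult_ideal)
  qed
  then have "snd (snd s) (fst (snd s)) \<in> J" using s(2) by blast
  then show ?thesis unfolding s(3) by (simp add: s_def)
qed

end


section \<open>Countably generated projective modules\<close>

lemma finitely_generated_imp_countably_generated:
  assumes "finitely_generated R M" shows "countably_generated R M"
proof -
  obtain S where "S \<subseteq> carrier M" "finite S" "module_span R M S = carrier M"
    using assms unfolding finitely_generated_def by (elim exE conjE)
  then show ?thesis unfolding countably_generated_def by (intro exI[of _ S] conjI countable_finite)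
qed

lemma ecard_eq_0_iff: "ecard X = 0 \<longleftrightarrow> X = {}"
  by (auto simp: ecard_def zero_enat_def)

lemma ecard_UNIV_Times: "ecard ((UNIV :: nat set) \<times> X) = (if X = {} then 0 else \<infinity>)"
proof (cases "X = {}")
  case False
  then have "infinite ((UNIV :: nat set) \<times> X)"
    using finite_cartesian_productD1[of "UNIV :: nat set" X] by auto
  with False show ?thesis by (simp add: ecard_def)
qed (simp add: ecard_def zero_enat_def)

context basic_set
begin

text \<open>
  The index set consists of natural numbers for every type of \<open>M\<close>, so that modules of different
  types can be treated alike.
\<close>

definition framed :: "('a, 'm) module \<Rightarrow> bool"
  where "framed M \<longleftrightarrow> (\<exists>(B :: nat set) d z h. frame R M B d z h \<and> d ` B \<subseteq> E)"

lemma framedI: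
  assumes "frame R M A c y g" "countable A" "\<And>s. s \<in> A \<Longrightarrow> c s \<in> E"
  shows "framed M"
proof -
  have inj: "inj_on (to_nat_on A) A" using assms(2) by (rule inj_on_to_nat_on)
  define \<sigma> where "\<sigma> = inv_into A (to_nat_on A)"
  have \<sigma>: "bij_betw \<sigma> (to_nat_on A ` A) A"
    unfolding \<sigma>_def using inj by (intro bij_betw_inv_into inj_on_imp_bij_betw)
  have "\<sigma> k \<in> A" if "k \<in> to_nat_on A ` A" for k using bij_betwE[OF \<sigma>] that by blast
  then have "(\<lambda>k. c (\<sigma> k)) ` (to_nat_on A ` A) \<subseteq> E" using assms(3) by blast
  with frame_reindex[OF assms(1) \<sigma>] show ?thesis unfolding framed_def by blast
qed

lemma framedE:
  assumes "framed M"
  obtains B :: "nat set" and d z h where "frame R M B d z h" "\<And>s. s \<in> B \<Longrightarrow> d s \<in> E"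
proof -
  obtain B :: "nat set" and d z h where "frame R M B d z h" "d ` B \<subseteq> E"
    using assms unfolding framed_def by blast
  then show thesis by (intro that) blast+
qed

lemma framed_iff: "framed M \<longleftrightarrow> projective R M \<and> countably_generated R M"
proof
  assume "framed M"
  then obtain B :: "nat set" and d z h where fr: "frame R M B d z h" by (rule framedE)
  then interpret frame R M B d z h .
  show "projective R M \<and> countably_generated R M" using projective countably_generated by simp
next
  assume "projective R M \<and> countably_generated R M"
  then obtain S where S: "countable S" "frame R M S fst (\<lambda>s. fst (snd s)) (\<lambda>s. snd (snd s))" "fst ` S \<subseteq> E"
    using ex_countable_frame by blast
  show "framed M" using S(3) by (intro framedI[OF S(2,1)]) blast
qed

lemma framed_right_module: "framed M \<Longrightarrow> right_module R M"
  using framed_iff projective_right_module by blast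

lemma framed_isomorphic_iff:
  assumes "framed M" "framed N"
  shows "module_isomorphic R M N \<longleftrightarrow> (\<forall>e\<in>E. multiplicity R M e = multiplicity R N e)"
proof
  obtain A :: "nat set" and c y g where M: "frame R M A c y g" "\<And>s. s \<in> A \<Longrightarrow> c s \<in> E"
    using framedE[OF assms(1)] by blast
  obtain B :: "nat set" and d z h where N: "frame R N B d z h" "\<And>s. s \<in> B \<Longrightarrow> d s \<in> E"
    using framedE[OF assms(2)] by blast
  show "module_isomorphic R M N" if "\<forall>e\<in>E. multiplicity R M e = multiplicity R N e"
    using that by (intro frames_isomorphic_if_multiplicity_eq[OF M _ N]) auto
  assume "module_isomorphic R M N"
  then obtain z' h' where N': "frame R N A c z' h'"
    using frame_transfer[OF M(1) framed_right_module[OF assms(2)]] by blast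
  show "\<forall>e\<in>E. multiplicity R M e = multiplicity R N e"
    using multiplicity_frame[OF M] multiplicity_frame[OF N' M(2)] by simp
qed

lemma framed_isomorphic:
  assumes "framed M" "right_module R N" "module_isomorphic R M N"
  shows "framed N"
proof -
  obtain A :: "nat set" and c y g where M: "frame R M A c y g" "\<And>s. s \<in> A \<Longrightarrow> c s \<in> E"
    using framedE[OF assms(1)] by blast
  obtain z h where "frame R N A c z h" using frame_transfer[OF M(1) assms(2,3)] .
  then show ?thesis by (rule framedI) (use M(2) in auto)
qed

lemma framed_finitely_generated_iff:
  "framed M \<Longrightarrow> finitely_generated R M \<longleftrightarrow> (\<forall>e\<in>E. multiplicity R M e \<noteq> \<infinity>)"
  using finitely_generated_iff_multiplicity by (metis framedE)

lemma framed_module_sum: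
  assumes "framed M" "framed N"
  shows "framed (module_sum M N)"
    and "e \<in> E \<Longrightarrow> multiplicity R (module_sum M N) e = multiplicity R M e + multiplicity R N e"
proof -
  obtain A :: "nat set" and c y g where M: "frame R M A c y g" "\<And>s. s \<in> A \<Longrightarrow> c s \<in> E"
    using framedE[OF assms(1)] by blast
  obtain B :: "nat set" and d z h where N: "frame R N B d z h" "\<And>s. s \<in> B \<Longrightarrow> d s \<in> E"
    using framedE[OF assms(2)] by blast
  note fr = frame_module_sum[OF M(1) N(1)]
  have E: "case_sum c d s \<in> E" if "s \<in> A <+> B" for s using M(2) N(2) that by (auto split: sum.split)
  show "framed (module_sum M N)" using E by (intro framedI[OF fr]) auto
  show "multiplicity R (module_sum M N) e = multiplicity R M e + multiplicity R N e" if e: "e \<in> E"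
    using multiplicity_frame[OF fr E e] multiplicity_frame[OF M e] multiplicity_frame[OF N e]
    by (simp add: ecard_Plus)
qed

lemma framed_module_power:
  assumes "framed M"
  shows "framed (module_power (UNIV :: nat set) M)"
    and "e \<in> E \<Longrightarrow> multiplicity R (module_power (UNIV :: nat set) M) e
      = (if multiplicity R M e = 0 then 0 else \<infinity>)"
proof -
  obtain A :: "nat set" and c y g where M: "frame R M A c y g" "\<And>s. s \<in> A \<Longrightarrow> c s \<in> E"
    using framedE[OF assms(1)] by blast
  note fr = frame_module_power[OF M(1), of "UNIV :: nat set"]
  have E: "(case p of (i, s) \<Rightarrow> c s) \<in> E" if "p \<in> (UNIV :: nat set) \<times> A" for p
    using M(2) that by (cases p) auto
  show "framed (module_power (UNIV :: nat set) M)" using E by (intro framedI[OF fr]) auto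
  assume e: "e \<in> E"
  have "{p \<in> (UNIV :: nat set) \<times> A. (case p of (i, s) \<Rightarrow> c s) = e} = UNIV \<times> {s \<in> A. c s = e}" by auto
  then show "multiplicity R (module_power (UNIV :: nat set) M) e
      = (if multiplicity R M e = 0 then 0 else \<infinity>)"
    using multiplicity_frame[OF fr E e] multiplicity_frame[OF M e]
    by (simp add: ecard_UNIV_Times ecard_eq_0_iff)
qed

lemma ex_framed_with_multiplicities:
  obtains N :: "('a, nat \<Rightarrow> 'a) module"
  where "framed N" "\<And>e. e \<in> E \<Longrightarrow> multiplicity R N e = n e"
proof -
  obtain N :: "('a, nat \<Rightarrow> 'a) module" and B :: "nat set" and d z h
    where N: "frame R N B d z h" "\<And>s. s \<in> B \<Longrightarrow> d s \<in> E" "\<And>e. e \<in> E \<Longrightarrow> multiplicity R N e = n e"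
    using ex_module_with_multiplicities[of n] by blast
  have "framed N" using N(2) by (intro framedI[OF N(1)]) auto
  then show thesis using N(3) by (rule that)
qed

section \<open>The minimal ideal with finitely generated quotient\<close>

lemma ex_projective_with_trace:
  assumes "D \<subseteq> E"
  obtains Q :: "('a, nat \<Rightarrow> 'a) module"
  where "framed Q" "finitely_generated R Q" "\<And>e. e \<in> E \<Longrightarrow> multiplicity R Q e = 0 \<longleftrightarrow> e \<notin> D"
    "D \<subseteq> trace_ideal R Q" "\<And>J. ideal J R \<Longrightarrow> D \<subseteq> J \<Longrightarrow> trace_ideal R Q \<subseteq> J"
proof -
  obtain Q :: "('a, nat \<Rightarrow> 'a) module" and B :: "nat set" and d z h
    where Q: "frame R Q B d z h" "\<And>s. s \<in> B \<Longrightarrow> d s \<in> E"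
      and m: "\<And>e. e \<in> E \<Longrightarrow> multiplicity R Q e = (if e \<in> D then 1 else 0)"
    using ex_module_with_multiplicities[of "\<lambda>e. if e \<in> D then 1 else 0"] by blast
  interpret Q: frame R Q B d z h by (rule Q(1))
  have "framed Q" using Q(2) by (intro framedI[OF Q(1)]) auto
  moreover from this have "finitely_generated R Q"
    by (subst framed_finitely_generated_iff) (auto simp: m one_enat_def zero_enat_def)
  moreover have dD: "e \<in> D \<longleftrightarrow> {s \<in> B. d s = e} \<noteq> {}" if "e \<in> E" for e
    using multiplicity_frame[OF Q that] m[OF that] ecard_eq_0_iff[of "{s \<in> B. d s = e}"]
    by (auto split: if_splits)
  have "D \<subseteq> trace_ideal R Q"
  proof
    fix e assume "e \<in> D"
    then obtain s where "s \<in> B" "d s = e" using dD assms by blast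
    then show "e \<in> trace_ideal R Q" using Q.e_in_trace_ideal by blast
  qed
  moreover have "trace_ideal R Q \<subseteq> J" if "ideal J R" "D \<subseteq> J" for J
  proof (rule Q.trace_ideal_minimal[OF that(1)])
    show "d s \<in> J" if s: "s \<in> B" for s using dD[OF Q(2)[OF s]] s \<open>D \<subseteq> J\<close> by blast
  qed
  ultimately show thesis using m by (intro that[of Q]) auto
qed

text \<open>
  The module \<open>Q\<close> is the sum of the \<open>e R\<close> with \<open>e\<close> of infinite multiplicity in \<open>P\<close>. Its trace is the
  least ideal that contains these \<open>e\<close>, and every ideal \<open>J\<close> with \<open>P/P J\<close> finitely generated does.
\<close>

lemma ideal_trace_of_infinite_part:
  fixes P :: "('a, 'm) module"
  assumes "projective R P"
  obtains Q :: "('a, nat \<Rightarrow> 'a) module"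
  where "framed Q" "finitely_generated R Q" "fg_mod_ideal R P (trace_ideal R Q)"
    "\<And>J. fg_mod_ideal R P J \<Longrightarrow> trace_ideal R Q \<subseteq> J"
    "\<And>e. e \<in> E \<Longrightarrow> multiplicity R Q e = 0 \<longleftrightarrow> multiplicity R P e \<noteq> \<infinity>"
proof -
  define D where "D = {e \<in> E. multiplicity R P e = \<infinity>}"
  obtain Q :: "('a, nat \<Rightarrow> 'a) module" where Q: "framed Q" "finitely_generated R Q"
    "\<And>e. e \<in> E \<Longrightarrow> multiplicity R Q e = 0 \<longleftrightarrow> e \<notin> D"
    "D \<subseteq> trace_ideal R Q" "\<And>J. ideal J R \<Longrightarrow> D \<subseteq> J \<Longrightarrow> trace_ideal R Q \<subseteq> J"
    by (rule ex_projective_with_trace[of D]) (auto simp: D_def)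
  have id: "ideal (trace_ideal R Q) R" using framed_right_module[OF Q(1)] by (rule trace_ideal_ideal)
  interpret I: ideal "trace_ideal R Q" R by (rule id)
  have "finitely_generated R (quotient_module P (module_mult_ideal R P (trace_ideal R Q)))"
    using Q(4) I.a_Hcarr by (intro finitely_generated_modulo_ideal[OF assms]) (auto simp: D_def)
  then have "fg_mod_ideal R P (trace_ideal R Q)" using id by (simp add: fg_mod_ideal_def)
  moreover have "trace_ideal R Q \<subseteq> J" if "fg_mod_ideal R P J" for J
  proof (rule Q(5))
    show "ideal J R" using that by (simp add: fg_mod_ideal_def)
    show "D \<subseteq> J" using infinite_multiplicity_in_ideal[OF assms] that by (auto simp: D_def fg_mod_ideal_def)
  qed
  ultimately show thesis using Q(1-3) by (intro that[of Q]) (auto simp: D_def)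
qed

text \<open>
  Adding infinitely many copies of a module that involves only the \<open>e R\<close> of infinite multiplicity
  leaves all multiplicities of \<open>P\<close> unchanged.
\<close>

lemma countably_generated_projective_relatively_big:
  fixes P :: "('a, 'm) module"
  assumes "projective R P" "countably_generated R P"
  shows "relatively_big R P"
proof -
  have P: "framed P" using assms by (simp add: framed_iff)
  obtain Q :: "('a, nat \<Rightarrow> 'a) module" where Q: "framed Q" "fg_mod_ideal R P (trace_ideal R Q)"
    "\<And>e. e \<in> E \<Longrightarrow> multiplicity R Q e = 0 \<longleftrightarrow> multiplicity R P e \<noteq> \<infinity>"
    using ideal_trace_of_infinite_part[OF assms(1)] by metis
  note power = framed_module_power[OF Q(1)]
  have "module_isomorphic R (module_sum P (module_power (UNIV :: nat set) Q)) P"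
    using framed_module_sum[OF P power(1)] power(2) Q(3) P
    by (subst framed_isomorphic_iff) auto
  moreover have "projective R Q" "countably_generated R Q" using Q(1) by (simp_all add: framed_iff)
  ultimately show ?thesis
    using assms Q(2) unfolding relatively_big_def fg_mod_ideal_def by blast
qed

section \<open>Indecomposable projective modules\<close>

text \<open>The module \<open>e R\<close>, with its elements coded as functions.\<close>

definition principal :: "'a \<Rightarrow> ('a, nat \<Rightarrow> 'a) module"
  where "principal e = idem_sum R {0} (\<lambda>_. e)"

lemma frame_principal:
  assumes "e \<in> E"
  shows "frame R (principal e) {0} (\<lambda>_. e) (\<lambda>s. \<lambda>t\<in>{0}. if t = s then e else \<zero>) (\<lambda>s x. x s)"
  unfolding principal_def using assms E_idem by (intro frame_idem_sum ring_axioms) auto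

lemma framed_principal: "e \<in> E \<Longrightarrow> framed (principal e)"
  by (rule framedI[OF frame_principal]) auto

lemma multiplicity_principal:
  assumes "e \<in> E" "f \<in> E"
  shows "multiplicity R (principal e) f = (if e = f then 1 else 0)"
  using multiplicity_frame[OF frame_principal[OF assms(1)] _ assms(2)] assms(1)
  by (simp add: ecard_def one_enat_def zero_enat_def)

text \<open>
  The element \<open>a\<close> generates \<open>M\<close>, because \<open>a u\<close> has the same coordinate as \<open>y k\<close>.
\<close>

lemma singleton_frame_summand:
  assumes fr: "frame R M {k} c y g" and ck: "c k \<in> E" and AB: "internal_direct_sum R M A B"
    and a: "a \<in> A" "g k a \<in> corner R (c k) (c k)" and u: "u \<in> carrier R" "g k a \<otimes> u = c k"
  shows "B = {\<zero>\<^bsub>M\<^esub>}"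
proof -
  note c_neg = r_neg[OF E_closed[OF ck]]
  interpret frame R M "{k}" c y g by (rule fr)
  have A: "submodule A R M" and B: "submodule B R M" and int: "A \<inter> B = {\<zero>\<^bsub>M\<^esub>}"
    using AB by (simp_all add: internal_direct_sum_def)
  have Ad: "A \<subseteq> carrier M" "\<And>a x. a \<in> carrier R \<Longrightarrow> x \<in> A \<Longrightarrow> a \<odot>\<^bsub>M\<^esub> x \<in> A"
    using A unfolding submodule_iff by auto
  have ac: "a \<in> carrier M" using Ad(1) a(1) by blast
  have "u \<odot>\<^bsub>M\<^esub> a \<ominus>\<^bsub>M\<^esub> y k = \<zero>\<^bsub>M\<^esub>"
  proof (rule zero_if_g_zero)
    fix s assume "s \<in> {k}"
    then show "g s (u \<odot>\<^bsub>M\<^esub> a \<ominus>\<^bsub>M\<^esub> y k) = \<zero>"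
      using ac u ck by (simp add: functional_g functional_minus functional_smult g_y_same)
        (simp add: a_minus_def c_neg)
  qed (use ac u(1) in simp)
  moreover have "u \<odot>\<^bsub>M\<^esub> a \<ominus>\<^bsub>M\<^esub> y k \<oplus>\<^bsub>M\<^esub> y k = u \<odot>\<^bsub>M\<^esub> a"
    using ac u(1) by (simp add: a_minus_def M.a_assoc M.l_neg)
  ultimately have "y k = u \<odot>\<^bsub>M\<^esub> a" by simp
  then have "y k \<in> A" using Ad(2) a(1) u(1) by simp
  then have "A = carrier M" using A by (intro submodule_eq_carrier) auto
  moreover have "B \<subseteq> carrier M" using B unfolding submodule_iff by blast
  ultimately show ?thesis using int by blast
qed

text \<open>
  The generator is a sum \<open>a + b\<close> with \<open>a \<in> A\<close> and \<open>b \<in> B\<close>, and its coordinate \<open>e\<close> is the sum of those of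
  \<open>a\<close> and \<open>b\<close>. After multiplication by \<open>e\<close> from the right these lie in the local ring \<open>e R e\<close>, where one
  of them is a unit.
\<close>

lemma indecomposable_principal:
  assumes e: "e \<in> E" shows "indecomposable R (principal e)"
proof -
  let ?M = "principal e" and ?y = "\<lambda>s::nat. \<lambda>t\<in>{0}. if t = s then e else \<zero>" and ?g = "\<lambda>s x. x s"
  interpret M: frame R ?M "{0}" "\<lambda>_. e" ?y ?g using e by (rule frame_principal)
  have y: "?y 0 \<in> carrier ?M" using M.y_closed[of 0] by simp
  have "?y 0 \<noteq> \<zero>\<^bsub>?M\<^esub>"
  proof
    assume "?y 0 = \<zero>\<^bsub>?M\<^esub>"
    then have "?g 0 (?y 0) = \<zero>" using M.functional_zero[OF M.functional_g[of 0]] by simp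
    then show False using E_nonzero[OF e] by simp
  qed
  then have nz: "carrier ?M \<noteq> {\<zero>\<^bsub>?M\<^esub>}" using y by blast
  have "A = {\<zero>\<^bsub>?M\<^esub>} \<or> B = {\<zero>\<^bsub>?M\<^esub>}" if AB: "internal_direct_sum R ?M A B" for A B
  proof -
    have A: "submodule A R ?M" and B: "submodule B R ?M" and int: "A \<inter> B = {\<zero>\<^bsub>?M\<^esub>}"
      and sum: "A <+>\<^bsub>?M\<^esub> B = carrier ?M"
      using AB by (simp_all add: internal_direct_sum_def)
    have Ad: "A \<subseteq> carrier ?M" "\<And>a x. a \<in> carrier R \<Longrightarrow> x \<in> A \<Longrightarrow> a \<odot>\<^bsub>?M\<^esub> x \<in> A"
      using A unfolding M.submodule_iff by auto
    have Bd: "B \<subseteq> carrier ?M" "\<And>a x. a \<in> carrier R \<Longrightarrow> x \<in> B \<Longrightarrow> a \<odot>\<^bsub>?M\<^esub> x \<in> B"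
      using B unfolding M.submodule_iff by auto
    have BA: "internal_direct_sum R ?M B A"
    proof -
      have "B <+>\<^bsub>?M\<^esub> A = A <+>\<^bsub>?M\<^esub> B"
      proof -
        have "b \<oplus>\<^bsub>?M\<^esub> a = a \<oplus>\<^bsub>?M\<^esub> b" if "a \<in> A" "b \<in> B" for a b
          using that Ad(1) Bd(1) by (intro M.M.a_comm) auto
        then have "(\<exists>b\<in>B. \<exists>a\<in>A. x = b \<oplus>\<^bsub>?M\<^esub> a) \<longleftrightarrow> (\<exists>a\<in>A. \<exists>b\<in>B. x = a \<oplus>\<^bsub>?M\<^esub> b)" for x
          by metis
        then have "x \<in> B <+>\<^bsub>?M\<^esub> A \<longleftrightarrow> x \<in> A <+>\<^bsub>?M\<^esub> B" for x
          by (simp add: set_add_def set_mult_def)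
        then show ?thesis by blast
      qed
      then show ?thesis using A B int sum by (auto simp: internal_direct_sum_def)
    qed
    have "?y 0 \<in> A <+>\<^bsub>?M\<^esub> B" unfolding sum by (rule y)
    then obtain a0 b0 where ab0: "a0 \<in> A" "b0 \<in> B" "?y 0 = a0 \<oplus>\<^bsub>?M\<^esub> b0"
      unfolding set_add_def set_mult_def by auto
    define a where "a = e \<odot>\<^bsub>?M\<^esub> a0"
    define b where "b = e \<odot>\<^bsub>?M\<^esub> b0"
    have c0: "a0 \<in> carrier ?M" "b0 \<in> carrier ?M" using ab0 Ad(1) Bd(1) by auto
    have ab: "a \<in> A" "b \<in> B" "a \<in> carrier ?M" "b \<in> carrier ?M"
      unfolding a_def b_def using Ad(2) Bd(2) ab0 e c0 by auto
    have "?y 0 = e \<odot>\<^bsub>?M\<^esub> (a0 \<oplus>\<^bsub>?M\<^esub> b0)" using M.smult_e_y[of 0] ab0(3) by simp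
    also have "\<dots> = a \<oplus>\<^bsub>?M\<^esub> b" unfolding a_def b_def using c0 e by (simp add: M.smult_r_distr)
    finally have yab: "?y 0 = a \<oplus>\<^bsub>?M\<^esub> b" .
    have corner: "z 0 \<in> corner R e e" if "z = e \<odot>\<^bsub>?M\<^esub> z0" "z0 \<in> carrier ?M" for z z0
    proof -
      have "z 0 = z0 0 \<otimes> e" using M.functional_smult[OF M.functional_g[of 0], of e z0] that e by simp
      moreover have "z0 0 \<in> carrier R" "e \<otimes> z0 0 = z0 0" using M.g_closed[of 0 z0] M.mult_e_g[of 0 z0] that by auto
      ultimately show ?thesis using e E_idem[OF e] by (simp add: corner_def m_assoc flip: m_assoc[of e])
    qed
    have ga: "a 0 \<in> corner R e e" using a_def c0(1) by (rule corner)
    have gb: "b 0 \<in> corner R e e" using b_def c0(2) by (rule corner)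
    have "a 0 \<oplus> b 0 = ?y 0 0" unfolding yab using M.functional_add[OF M.functional_g[of 0] ab(3,4)] by simp
    then have sum_e: "a 0 \<oplus> b 0 = e" by simp
    have "e \<ominus> a 0 = b 0"
      unfolding sum_e[symmetric] using corner_closed[OF ga] corner_closed[OF gb]
      by (simp add: a_minus_def a_comm[of "a 0"] a_assoc r_neg)
    then obtain u where u: "u \<in> corner R e e" "a 0 \<otimes> u = e \<or> b 0 \<otimes> u = e"
      using local_E[OF e] ga unfolding local_idempotent_def by metis
    have uc: "u \<in> carrier R" using u(1) by (rule corner_closed)
    from u(2) show ?thesis
    proof
      assume "a 0 \<otimes> u = e"
      then show ?thesis
        using singleton_frame_summand[OF frame_principal[OF e] e AB ab(1) _ uc] ga by simp
    next
      assume "b 0 \<otimes> u = e"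
      then show ?thesis
        using singleton_frame_summand[OF frame_principal[OF e] e BA ab(2) _ uc] gb by simp
    qed
  qed
  with nz show ?thesis unfolding indecomposable_def by blast
qed

text \<open>
  A member of a family that captures some nonzero element splits off \<open>y R \<cong> e R\<close>, with the kernel of \<open>g\<close>
  as complement.
\<close>

lemma indecomposable_projective_isomorphic_principal:
  fixes P :: "('a, nat \<Rightarrow> 'a) module"
  assumes P: "projective R P" "indecomposable R P"
  obtains e where "e \<in> E" "module_isomorphic R (principal e) P"
proof -
  interpret P: right_module R P using P(1) by (rule projective_right_module)
  have "\<zero>\<^bsub>P\<^esub> \<in> carrier P" by simp
  then obtain x where x: "x \<in> carrier P" "x \<noteq> \<zero>\<^bsub>P\<^esub>"
    using P(2) unfolding indecomposable_def by blast
  have "biorthogonal_set R P {}"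
    by (intro biorthogonal.intro biorthogonal_axioms.intro P.right_module_axioms) auto
  then obtain S where S: "finite S" "biorthogonal_set R P S" "fst ` S \<subseteq> E" "set_component P S x = x"
    using biorthogonal_set_extend_spanning[OF P(1) _ _ _ x(1), of "{}"] by auto
  interpret S: biorthogonal R P S fst "\<lambda>s. fst (snd s)" "\<lambda>s. snd (snd s)" by (rule S(2))
  have "S \<noteq> {}" using S(4) x(2) by (auto simp: S.component_def)
  then obtain s where s: "s \<in> S" by blast
  define e y g where "e = fst s" and "y = fst (snd s)" and "g = snd (snd s)"
  have e: "e \<in> E" using S(3) s by (auto simp: e_def)
  have y: "y \<in> carrier P" "e \<odot>\<^bsub>P\<^esub> y = y" using S.y_closed[OF s] S.smult_e_y[OF s] by (simp_all add: e_def y_def)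
  have g: "g \<in> functionals R P" "\<And>z. z \<in> carrier P \<Longrightarrow> e \<otimes> g z = g z" "g y = e"
    using S.functional_g[OF s] S.mult_e_g[OF s] S.g_y_same[OF s] by (simp_all add: e_def y_def g_def)
  define A where "A = {r \<odot>\<^bsub>P\<^esub> y | r. r \<in> carrier R}"
  define B where "B = {z \<in> carrier P. g z = \<zero>}"
  have Asub: "submodule A R P"
    unfolding P.submodule_iff
  proof (intro conjI ballI)
    show "A \<subseteq> carrier P" using y by (auto simp: A_def)
    show "\<zero>\<^bsub>P\<^esub> \<in> A" unfolding A_def using y by (intro CollectI exI[of _ \<zero>]) simp
    fix z assume "z \<in> A"
    then obtain r where r: "z = r \<odot>\<^bsub>P\<^esub> y" "r \<in> carrier R" by (auto simp: A_def)
    show "z \<oplus>\<^bsub>P\<^esub> z' \<in> A" if z': "z' \<in> A" for z'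
    proof -
      obtain r' where r': "z' = r' \<odot>\<^bsub>P\<^esub> y" "r' \<in> carrier R" using z' by (auto simp: A_def)
      have "z \<oplus>\<^bsub>P\<^esub> z' = (r \<oplus> r') \<odot>\<^bsub>P\<^esub> y" using r r' y by (simp add: P.smult_l_distr)
      then show ?thesis unfolding A_def using r r' by blast
    qed
    show "a \<odot>\<^bsub>P\<^esub> z \<in> A" if "a \<in> carrier R" for a
    proof -
      have "a \<odot>\<^bsub>P\<^esub> z = (r \<otimes> a) \<odot>\<^bsub>P\<^esub> y" using r y that by (simp add: P.smult_assoc)
      then show ?thesis unfolding A_def using r that by blast
    qed
  qed
  have Bsub: "submodule B R P"
    unfolding P.submodule_iff B_def using g(1)
    by (auto simp: P.functional_zero P.functional_add P.functional_smult)
  have split: "z = g z \<odot>\<^bsub>P\<^esub> y \<oplus>\<^bsub>P\<^esub> (z \<ominus>\<^bsub>P\<^esub> g z \<odot>\<^bsub>P\<^esub> y)" "z \<ominus>\<^bsub>P\<^esub> g z \<odot>\<^bsub>P\<^esub> y \<in> B"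
    if z: "z \<in> carrier P" for z
  proof -
    have gz: "g z \<in> carrier R" using g(1) z by simp
    show "z = g z \<odot>\<^bsub>P\<^esub> y \<oplus>\<^bsub>P\<^esub> (z \<ominus>\<^bsub>P\<^esub> g z \<odot>\<^bsub>P\<^esub> y)"
      using z y gz by (simp add: a_minus_def P.M.a_comm[of z] P.M.r_neg2)
    have "g (z \<ominus>\<^bsub>P\<^esub> g z \<odot>\<^bsub>P\<^esub> y) = g z \<ominus> g y \<otimes> g z"
      using z y gz g(1) by (simp add: P.functional_minus P.functional_smult)
    also have "\<dots> = \<zero>" using g(2)[OF z] g(3) gz by (simp add: a_minus_def r_neg)
    finally show "z \<ominus>\<^bsub>P\<^esub> g z \<odot>\<^bsub>P\<^esub> y \<in> B" using z y gz by (simp add: B_def)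
  qed
  have "A \<inter> B = {\<zero>\<^bsub>P\<^esub>}"
  proof
    show "A \<inter> B \<subseteq> {\<zero>\<^bsub>P\<^esub>}"
    proof
      fix z assume "z \<in> A \<inter> B"
      then obtain r where r: "z = r \<odot>\<^bsub>P\<^esub> y" "r \<in> carrier R" "g z = \<zero>" by (auto simp: A_def B_def)
      then have "e \<otimes> r = \<zero>" using P.functional_smult[OF g(1) r(2) y(1)] g(3) by simp
      then have "(e \<otimes> r) \<odot>\<^bsub>P\<^esub> y = \<zero>\<^bsub>P\<^esub>" using y by simp
      then have "z = \<zero>\<^bsub>P\<^esub>" using P.smult_assoc[of e r y] e r y by simp
      then show "z \<in> {\<zero>\<^bsub>P\<^esub>}" by simp
    qed
    show "{\<zero>\<^bsub>P\<^esub>} \<subseteq> A \<inter> B" using Asub Bsub unfolding P.submodule_iff by blast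
  qed
  moreover have "A <+>\<^bsub>P\<^esub> B = carrier P"
  proof
    show "A <+>\<^bsub>P\<^esub> B \<subseteq> carrier P"
      using Asub Bsub unfolding P.submodule_iff set_add_def set_mult_def by auto
    show "carrier P \<subseteq> A <+>\<^bsub>P\<^esub> B"
    proof
      fix z assume z: "z \<in> carrier P"
      have "g z \<odot>\<^bsub>P\<^esub> y \<in> A" unfolding A_def using g(1) z by auto
      then have "g z \<odot>\<^bsub>P\<^esub> y \<oplus>\<^bsub>P\<^esub> (z \<ominus>\<^bsub>P\<^esub> g z \<odot>\<^bsub>P\<^esub> y) \<in> A <+>\<^bsub>P\<^esub> B"
        using split(2)[OF z] unfolding set_add_def set_mult_def by auto
      then show "z \<in> A <+>\<^bsub>P\<^esub> B" using split(1)[OF z] by simp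
    qed
  qed
  ultimately have "internal_direct_sum R P A B" using Asub Bsub by (simp add: internal_direct_sum_def)
  then have "A = {\<zero>\<^bsub>P\<^esub>} \<or> B = {\<zero>\<^bsub>P\<^esub>}" using P(2) unfolding indecomposable_def by blast
  moreover have "A \<noteq> {\<zero>\<^bsub>P\<^esub>}"
  proof
    assume A0: "A = {\<zero>\<^bsub>P\<^esub>}"
    have "y \<in> A" unfolding A_def using y(2) e by (intro CollectI exI[of _ e]) simp
    then have "g y = \<zero>" using A0 P.functional_zero[OF g(1)] by simp
    then show False using g(3) E_nonzero[OF e] by simp
  qed
  ultimately have B0: "B = {\<zero>\<^bsub>P\<^esub>}" by blast
  have fr: "frame R P {0::nat} (\<lambda>_. e) (\<lambda>_. y) (\<lambda>_. g)"
  proof (rule frameI)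
    show "biorthogonal R P {0::nat} (\<lambda>_. e) (\<lambda>_. y) (\<lambda>_. g)"
      using e y g by (intro biorthogonal.intro biorthogonal_axioms.intro P.right_module_axioms) auto
    fix H assume H: "submodule H R P" "(\<lambda>_. y) ` {0::nat} \<subseteq> H"
    show "carrier P \<subseteq> H"
    proof
      fix z assume z: "z \<in> carrier P"
      have "z \<ominus>\<^bsub>P\<^esub> g z \<odot>\<^bsub>P\<^esub> y = \<zero>\<^bsub>P\<^esub>" using split(2)[OF z] B0 by simp
      then have "z = g z \<odot>\<^bsub>P\<^esub> y" using split(1)[OF z] g(1) z y by simp
      moreover have "g z \<odot>\<^bsub>P\<^esub> y \<in> H" using H g(1) z unfolding P.submodule_iff by simp
      ultimately show "z \<in> H" by simp
    qed
  qed
  have "module_isomorphic R (principal e) P"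
    by (rule frames_isomorphic[OF frame_principal[OF e] fr, of "\<lambda>s. s"]) (auto simp: bij_betw_def)
  with e show thesis by (rule that)
qed

end

lemma iso_class_eq_iff:
  fixes M :: "('a, nat \<Rightarrow> 'a) module" and N :: "('a, 'm) module"
  assumes "right_module R M" "right_module R N"
  shows "iso_class R M = iso_class R N \<longleftrightarrow> module_isomorphic R M N"
proof
  assume "iso_class R M = iso_class R N"
  moreover have "M \<in> iso_class R M" using assms(1) by (simp add: iso_class_def module_isomorphic_refl)
  ultimately have "module_isomorphic R N M" by (simp add: iso_class_def)
  then show "module_isomorphic R M N" by (rule module_isomorphic_sym[OF assms(2)])
next
  assume "module_isomorphic R M N"
  moreover from this have "module_isomorphic R N M" by (rule module_isomorphic_sym[OF assms(1)])
  ultimately have "module_isomorphic R M K \<longleftrightarrow> module_isomorphic R N K" for K :: "('a, nat \<Rightarrow> 'a) module"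
    using module_isomorphic_trans[of R M N K] module_isomorphic_trans[of R N M K] by blast
  then show "iso_class R M = iso_class R N" by (simp add: iso_class_def)
qed

context basic_set
begin

lemma bij_betw_indecomposable_projectives:
  "bij_betw (\<lambda>e. iso_class R (principal e)) E (indecomposable_projectives R)"
proof (rule bij_betw_imageI)
  have rm: "right_module R (principal e)" if "e \<in> E" for e
    using framed_principal[OF that] by (rule framed_right_module)
  show "inj_on (\<lambda>e. iso_class R (principal e)) E"
  proof (rule inj_onI)
    fix e f assume ef: "e \<in> E" "f \<in> E" and "iso_class R (principal e) = iso_class R (principal f)"
    then have "module_isomorphic R (principal e) (principal f)" using iso_class_eq_iff rm by blast
    then have "multiplicity R (principal e) e = multiplicity R (principal f) e"
      using framed_isomorphic_iff framed_principal ef by blast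
    then show "e = f" using ef by (simp add: multiplicity_principal split: if_splits)
  qed
  show "(\<lambda>e. iso_class R (principal e)) ` E = indecomposable_projectives R"
  proof
    show "(\<lambda>e. iso_class R (principal e)) ` E \<subseteq> indecomposable_projectives R"
      using framed_principal indecomposable_principal
      unfolding indecomposable_projectives_def by (auto simp: framed_iff)
    show "indecomposable_projectives R \<subseteq> (\<lambda>e. iso_class R (principal e)) ` E"
    proof
      fix C assume "C \<in> indecomposable_projectives R"
      then obtain P :: "('a, nat \<Rightarrow> 'a) module" where P: "projective R P" "indecomposable R P" "C = iso_class R P"
        unfolding indecomposable_projectives_def by blast
      obtain e where e: "e \<in> E" "module_isomorphic R (principal e) P"
        using P(1,2) by (rule indecomposable_projective_isomorphic_principal)
      have "C = iso_class R (principal e)"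
        using iso_class_eq_iff[OF rm[OF e(1)] projective_right_module[OF P(1)]] e(2) P(3) by simp
      then show "C \<in> (\<lambda>e. iso_class R (principal e)) ` E" using e(1) by (rule image_eqI)
    qed
  qed
qed

section \<open>The monoids of isomorphism classes\<close>

text \<open>The function \<open>h\<close> enumerates a basic set.\<close>

definition class_multiplicities :: "(nat \<Rightarrow> 'a) \<Rightarrow> nat \<Rightarrow> ('a, nat \<Rightarrow> 'a) module set \<Rightarrow> nat \<Rightarrow> enat"
  where "class_multiplicities h t C = (\<lambda>i\<in>{..<t}. multiplicity R (SOME P. P \<in> C) (h i))"

text \<open>The class of a module of any type has a member of the type used for classes.\<close>

lemma representative:
  assumes M: "framed M"
  shows "framed (SOME P. P \<in> iso_class R M)"
    and "module_isomorphic R M (SOME P. P \<in> iso_class R M)"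
    and "iso_class R M \<in> carrier (V_cg R)"
proof -
  obtain N :: "('a, nat \<Rightarrow> 'a) module" where N: "framed N" "\<And>e. e \<in> E \<Longrightarrow> multiplicity R N e = multiplicity R M e"
    using ex_framed_with_multiplicities[of "multiplicity R M"] by blast
  have MN: "module_isomorphic R M N" "module_isomorphic R N M"
    using framed_isomorphic_iff[OF M N(1)] framed_isomorphic_iff[OF N(1) M] N(2) by simp_all
  have "N \<in> iso_class R M" using MN(1) framed_right_module[OF N(1)] by (simp add: iso_class_def)
  then have "(SOME P. P \<in> iso_class R M) \<in> iso_class R M" by (rule someI)
  then show 1: "framed (SOME P. P \<in> iso_class R M)" "module_isomorphic R M (SOME P. P \<in> iso_class R M)"
    using framed_isomorphic[OF M] unfolding iso_class_def by auto
  have "iso_class R M = iso_class R N"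
    using iso_class_eq_iff[OF framed_right_module[OF N(1)] framed_right_module[OF M]] MN(2) by simp
  then show "iso_class R M \<in> carrier (V_cg R)"
    using N(1) unfolding V_cg_def framed_iff by auto
qed

lemma V_cg_carrierE:
  assumes "C \<in> carrier (V_cg R)"
  obtains P :: "('a, nat \<Rightarrow> 'a) module" where "framed P" "C = iso_class R P"
  using assms unfolding V_cg_def framed_iff by auto

lemma V_cg_mult_closed:
  assumes "C \<in> carrier (V_cg R)" "D \<in> carrier (V_cg R)"
  shows "C \<otimes>\<^bsub>V_cg R\<^esub> D \<in> carrier (V_cg R)"
proof -
  have "framed (SOME P. P \<in> C)" "framed (SOME Q. Q \<in> D)"
    using assms representative(1) by (metis V_cg_carrierE)+
  then have "iso_class R (module_sum (SOME P. P \<in> C) (SOME Q. Q \<in> D)) \<in> carrier (V_cg R)"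
    by (intro representative(3) framed_module_sum(1))
  then show ?thesis by (simp add: V_cg_def)
qed

context
  fixes h :: "nat \<Rightarrow> 'a" and t :: nat
  assumes h: "bij_betw h {..<t} E"
begin

lemma h_E: "i < t \<Longrightarrow> h i \<in> E"
  using bij_betwE[OF h] by simp

lemma class_multiplicities_iso_class:
  assumes "framed M"
  shows "class_multiplicities h t (iso_class R M) = (\<lambda>i\<in>{..<t}. multiplicity R M (h i))"
proof -
  have "multiplicity R (SOME P. P \<in> iso_class R M) (h i) = multiplicity R M (h i)" if "i < t" for i
    using framed_isomorphic_iff[OF assms representative(1)[OF assms]] representative(2)[OF assms] h_E[OF that]
    by simp
  then show ?thesis unfolding class_multiplicities_def by (intro restrict_ext) simp
qed

lemma class_multiplicities_iso:
  "class_multiplicities h t \<in> iso (V_cg R) (product_group {..<t} (\<lambda>_. additive_monoid :: enat monoid))"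
proof -
  let ?\<psi> = "class_multiplicities h t"
  have "?\<psi> (C \<otimes>\<^bsub>V_cg R\<^esub> D) = ?\<psi> C \<otimes>\<^bsub>product_group {..<t} (\<lambda>_. additive_monoid)\<^esub> ?\<psi> D"
    if CD: "C \<in> carrier (V_cg R)" "D \<in> carrier (V_cg R)" for C D
  proof -
    have fr: "framed (SOME P. P \<in> C)" "framed (SOME Q. Q \<in> D)"
      using CD representative(1) by (metis V_cg_carrierE)+
    have "?\<psi> (C \<otimes>\<^bsub>V_cg R\<^esub> D) = (\<lambda>i\<in>{..<t}. multiplicity R (module_sum (SOME P. P \<in> C) (SOME Q. Q \<in> D)) (h i))"
      using class_multiplicities_iso_class[OF framed_module_sum(1)[OF fr]] by (simp add: V_cg_def)
    also have "\<dots> = (\<lambda>i\<in>{..<t}. multiplicity R (SOME P. P \<in> C) (h i) + multiplicity R (SOME Q. Q \<in> D) (h i))"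
      using framed_module_sum(2)[OF fr h_E] by (intro restrict_ext) simp
    finally show ?thesis
      by (simp add: class_multiplicities_def additive_monoid_def cong: restrict_cong)
  qed
  moreover have "?\<psi> C \<in> carrier (product_group {..<t} (\<lambda>_. additive_monoid :: enat monoid))" for C
    by (simp add: class_multiplicities_def additive_monoid_def)
  moreover have "inj_on ?\<psi> (carrier (V_cg R))"
  proof (rule inj_onI)
    fix C D assume C: "C \<in> carrier (V_cg R)" and D: "D \<in> carrier (V_cg R)" and eq: "?\<psi> C = ?\<psi> D"
    obtain P :: "('a, nat \<Rightarrow> 'a) module" where P: "framed P" "C = iso_class R P" using C by (rule V_cg_carrierE)
    obtain Q :: "('a, nat \<Rightarrow> 'a) module" where Q: "framed Q" "D = iso_class R Q" using D by (rule V_cg_carrierE)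
    have "multiplicity R P e = multiplicity R Q e" if "e \<in> E" for e
    proof -
      obtain i where i: "i < t" "e = h i" using h \<open>e \<in> E\<close> by (auto simp: bij_betw_def)
      then show ?thesis
        using fun_cong[OF eq, of i] class_multiplicities_iso_class[OF P(1)] class_multiplicities_iso_class[OF Q(1)]
        by (simp add: P(2) Q(2))
    qed
    then have "module_isomorphic R P Q" using framed_isomorphic_iff[OF P(1) Q(1)] by blast
    then show "C = D"
      unfolding P(2) Q(2) using iso_class_eq_iff[OF framed_right_module[OF P(1)] framed_right_module[OF Q(1)]] by simp
  qed
  moreover have "v \<in> ?\<psi> ` carrier (V_cg R)" if v: "v \<in> carrier (product_group {..<t} (\<lambda>_. additive_monoid :: enat monoid))" for v
  proof -
    obtain N :: "('a, nat \<Rightarrow> 'a) module" where N: "framed N"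
      "\<And>e. e \<in> E \<Longrightarrow> multiplicity R N e = v (inv_into {..<t} h e)"
      using ex_framed_with_multiplicities[of "\<lambda>e. v (inv_into {..<t} h e)"] by blast
    have "multiplicity R N (h i) = v i" if "i < t" for i
      using N(2)[OF h_E[OF that]] bij_betw_inv_into_left[OF h, of i] that by simp
    then have "?\<psi> (iso_class R N) = v"
      unfolding class_multiplicities_iso_class[OF N(1)] using v by (auto simp: PiE_iff extensional_def)
    then show ?thesis using representative(3)[OF N(1)] by (metis imageI)
  qed
  ultimately show ?thesis
    unfolding iso_def hom_def bij_betw_def by blast
qed

lemma V_fg_carrier:
  "carrier (V_fg R) = {C \<in> carrier (V_cg R). \<forall>i<t. class_multiplicities h t C i \<noteq> \<infinity>}"
proof -
  have fg: "finitely_generated R P \<longleftrightarrow> (\<forall>i<t. class_multiplicities h t (iso_class R P) i \<noteq> \<infinity>)"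
    if P: "framed P" for P :: "('a, nat \<Rightarrow> 'a) module"
  proof -
    have "h ` {..<t} = E" using h by (simp add: bij_betw_def)
    then have "finitely_generated R P \<longleftrightarrow> (\<forall>e\<in>h ` {..<t}. multiplicity R P e \<noteq> \<infinity>)"
      using framed_finitely_generated_iff[OF P] by simp
    also have "\<dots> \<longleftrightarrow> (\<forall>i<t. multiplicity R P (h i) \<noteq> \<infinity>)"
      by (metis imageE imageI lessThan_iff)
    also have "\<dots> \<longleftrightarrow> (\<forall>i<t. class_multiplicities h t (iso_class R P) i \<noteq> \<infinity>)"
      unfolding class_multiplicities_iso_class[OF P] by simp
    finally show ?thesis .
  qed
  have "projective R P \<and> finitely_generated R P \<longleftrightarrow> framed P \<and> finitely_generated R P" for P :: "('a, nat \<Rightarrow> 'a) module"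
    using finitely_generated_imp_countably_generated[of R P] by (auto simp: framed_iff)
  then have V: "carrier (V_fg R) = {iso_class R P | P :: ('a, nat \<Rightarrow> 'a) module. framed P \<and> finitely_generated R P}"
    by (simp add: V_fg_def)
  show ?thesis
  proof (intro equalityI subsetI)
    fix C assume "C \<in> carrier (V_fg R)"
    then obtain P :: "('a, nat \<Rightarrow> 'a) module" where "framed P" "finitely_generated R P" "C = iso_class R P"
      unfolding V by blast
    then show "C \<in> {C \<in> carrier (V_cg R). \<forall>i<t. class_multiplicities h t C i \<noteq> \<infinity>}"
      using fg representative(3) by simp
  next
    fix C assume C: "C \<in> {C \<in> carrier (V_cg R). \<forall>i<t. class_multiplicities h t C i \<noteq> \<infinity>}"
    then obtain P :: "('a, nat \<Rightarrow> 'a) module" where "framed P" "C = iso_class R P"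
      using V_cg_carrierE by blast
    then show "C \<in> carrier (V_fg R)" unfolding V using C fg by blast
  qed
qed

end

end


context basic_set
begin

context
  fixes h :: "nat \<Rightarrow> 'a" and t :: nat
  assumes h: "bij_betw h {..<t} E"
begin

lemma finite_class_multiplicities_iso:
  "(\<lambda>C. \<lambda>i\<in>{..<t}. the_enat (class_multiplicities h t C i))
    \<in> iso (V_fg R) (product_group {..<t} (\<lambda>_. additive_monoid :: nat monoid))"
proof -
  let ?\<psi> = "class_multiplicities h t" and ?K = "product_group {..<t} (\<lambda>_. additive_monoid :: enat monoid)"
  let ?\<nu> = "\<lambda>C. \<lambda>i\<in>{..<t}. the_enat (?\<psi> C i)"
  note \<psi> = class_multiplicities_iso[OF h]
  have hom: "?\<psi> (C \<otimes>\<^bsub>V_cg R\<^esub> D) = ?\<psi> C \<otimes>\<^bsub>?K\<^esub> ?\<psi> D" if "C \<in> carrier (V_cg R)" "D \<in> carrier (V_cg R)" for C D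
    using \<psi> that by (simp add: iso_def hom_def)
  have inj: "inj_on ?\<psi> (carrier (V_cg R))" and surj: "?\<psi> ` carrier (V_cg R) = carrier ?K"
    using \<psi> by (simp_all add: iso_def bij_betw_def)
  note fg = V_fg_carrier[OF h]
  have fin: "?\<psi> C i = enat (the_enat (?\<psi> C i))" if "C \<in> carrier (V_fg R)" "i < t" for C i
    using that unfolding fg by auto
  have "?\<nu> (C \<otimes>\<^bsub>V_fg R\<^esub> D) = ?\<nu> C \<otimes>\<^bsub>product_group {..<t} (\<lambda>_. additive_monoid :: nat monoid)\<^esub> ?\<nu> D"
    if C: "C \<in> carrier (V_fg R)" and D: "D \<in> carrier (V_fg R)" for C D
  proof -
    have "?\<psi> (C \<otimes>\<^bsub>V_fg R\<^esub> D) i = ?\<psi> C i + ?\<psi> D i" if "i < t" for i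
      using hom[of C D] C D that unfolding fg by (simp add: V_fg_def additive_monoid_def)
    moreover have "the_enat (?\<psi> C i + ?\<psi> D i) = the_enat (?\<psi> C i) + the_enat (?\<psi> D i)" if "i < t" for i
      using fin[OF C that] fin[OF D that] by (metis plus_enat_simps(1) the_enat.simps)
    ultimately show ?thesis by (auto simp: additive_monoid_def)
  qed
  moreover have "?\<nu> C \<in> carrier (product_group {..<t} (\<lambda>_. additive_monoid :: nat monoid))" for C
    by (simp add: additive_monoid_def)
  moreover have "inj_on ?\<nu> (carrier (V_fg R))"
  proof (rule inj_onI)
    fix C D assume C: "C \<in> carrier (V_fg R)" and D: "D \<in> carrier (V_fg R)" and eq: "?\<nu> C = ?\<nu> D"
    have "?\<psi> C i = ?\<psi> D i" if "i < t" for i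
    proof -
      have "the_enat (?\<psi> C i) = the_enat (?\<psi> D i)" using fun_cong[OF eq, of i] that by simp
      then show ?thesis using fin[OF C that] fin[OF D that] by simp
    qed
    then have "?\<psi> C = ?\<psi> D" by (auto simp: class_multiplicities_def restrict_def)
    then show "C = D" using inj C D unfolding fg by (auto dest: inj_onD)
  qed
  moreover have "v \<in> ?\<nu> ` carrier (V_fg R)"
    if v: "v \<in> carrier (product_group {..<t} (\<lambda>_. additive_monoid :: nat monoid))" for v
  proof -
    have "(\<lambda>i\<in>{..<t}. enat (v i)) \<in> carrier ?K" by (simp add: additive_monoid_def)
    then have "(\<lambda>i\<in>{..<t}. enat (v i)) \<in> ?\<psi> ` carrier (V_cg R)" unfolding surj .
    then obtain C where C: "C \<in> carrier (V_cg R)" "?\<psi> C = (\<lambda>i\<in>{..<t}. enat (v i))" by force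
    have "C \<in> carrier (V_fg R)" unfolding fg using C by simp
    moreover have "?\<nu> C = v" using v unfolding C(2) by (auto simp: PiE_iff extensional_def)
    ultimately show ?thesis by (metis imageI)
  qed
  ultimately show ?thesis unfolding iso_def hom_def bij_betw_def by blast
qed

end

end

lemma iso_comp_inv_into:
  assumes f: "f \<in> iso G K" and f': "f' \<in> iso H K"
    and closed: "\<And>x y. x \<in> carrier H \<Longrightarrow> y \<in> carrier H \<Longrightarrow> x \<otimes>\<^bsub>H\<^esub> y \<in> carrier H"
  shows "(\<lambda>x. inv_into (carrier H) f' (f x)) \<in> iso G H"
proof -
  have b: "bij_betw f (carrier G) (carrier K)" and b': "bij_betw f' (carrier H) (carrier K)"
    using f f' by (simp_all add: iso_def)
  let ?g = "inv_into (carrier H) f'"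
  have bg: "bij_betw ?g (carrier K) (carrier H)" using b' by (rule bij_betw_inv_into)
  have g: "?g z \<in> carrier H" "f' (?g z) = z" if "z \<in> carrier K" for z
    using bij_betwE[OF bg] bij_betw_inv_into_right[OF b'] that by auto
  have "bij_betw (\<lambda>x. ?g (f x)) (carrier G) (carrier H)"
    using bij_betw_trans[OF b bg] by (simp add: comp_def)
  moreover have "?g (f (x \<otimes>\<^bsub>G\<^esub> y)) = ?g (f x) \<otimes>\<^bsub>H\<^esub> ?g (f y)" if xy: "x \<in> carrier G" "y \<in> carrier G" for x y
  proof -
    have fx: "f x \<in> carrier K" "f y \<in> carrier K" using bij_betwE[OF b] xy by auto
    have "f (x \<otimes>\<^bsub>G\<^esub> y) = f x \<otimes>\<^bsub>K\<^esub> f y" using f xy by (simp add: iso_def hom_def)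
    also have "\<dots> = f' (?g (f x)) \<otimes>\<^bsub>K\<^esub> f' (?g (f y))" using g(2) fx by simp
    also have "\<dots> = f' (?g (f x) \<otimes>\<^bsub>H\<^esub> ?g (f y))" using f' g(1) fx by (simp add: iso_def hom_def)
    finally show ?thesis
      using closed[OF g(1)[OF fx(1)] g(1)[OF fx(2)]] bij_betw_inv_into_left[OF b'] by simp
  qed
  moreover have "?g (f x) \<in> carrier H" if "x \<in> carrier G" for x
    using g(1) bij_betwE[OF b] that by blast
  ultimately show ?thesis by (simp add: iso_def hom_def)
qed

text \<open>
  The isomorphism matches multiplicities for \<open>R\<close> with multiplicities for the opposite ring. It sends
  the class of a finitely generated \<open>P\<close> to that of its dual, since a finite frame of \<open>P\<close> gives one of
  the dual with the same idempotents.
\<close>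

lemma (in basic_set) duality_iso:
  fixes h :: "nat \<Rightarrow> 'a"
  assumes h: "bij_betw h {..<t} E"
  shows "\<exists>\<phi> \<in> iso (V_cg R) (V_cg (opp_ring R)). \<phi> \<in> iso (V_fg R) (V_fg (opp_ring R)) \<and>
    (\<forall>P :: ('a, nat \<Rightarrow> 'a) module. projective R P \<and> finitely_generated R P \<longrightarrow>
       \<phi> (iso_class R P) = iso_class (opp_ring R) (dual_module R P))"
proof -
  interpret O: basic_set "opp_ring R" E by (rule basic_set_opp_ring)
  let ?\<psi> = "class_multiplicities h t" and ?\<psi>' = "O.class_multiplicities h t"
  let ?K = "product_group {..<t} (\<lambda>_. additive_monoid :: enat monoid)"
  define \<phi> where "\<phi> C = inv_into (carrier (V_cg (opp_ring R))) ?\<psi>' (?\<psi> C)" for C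
  note \<psi> = class_multiplicities_iso[OF h] and \<psi>' = O.class_multiplicities_iso[OF h]
  have \<phi>: "\<phi> \<in> iso (V_cg R) (V_cg (opp_ring R))"
    unfolding \<phi>_def using \<psi> \<psi>' O.V_cg_mult_closed by (rule iso_comp_inv_into)
  have bij: "bij_betw \<phi> (carrier (V_cg R)) (carrier (V_cg (opp_ring R)))" using \<phi> by (simp add: iso_def)
  have \<psi>'\<phi>: "?\<psi>' (\<phi> C) = ?\<psi> C" if "C \<in> carrier (V_cg R)" for C
  proof -
    have "?\<psi> C \<in> carrier ?K" using \<psi> that by (auto simp: iso_def bij_betw_def)
    then show ?thesis unfolding \<phi>_def using \<psi>' by (intro bij_betw_inv_into_right) (auto simp: iso_def)
  qed
  have img: "\<phi> ` carrier (V_fg R) = carrier (V_fg (opp_ring R))"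
  proof (intro equalityI subsetI)
    fix D assume "D \<in> \<phi> ` carrier (V_fg R)"
    then obtain C where C: "C \<in> carrier (V_cg R)" "\<forall>i<t. ?\<psi> C i \<noteq> \<infinity>" "D = \<phi> C"
      unfolding V_fg_carrier[OF h] by blast
    then show "D \<in> carrier (V_fg (opp_ring R))"
      unfolding O.V_fg_carrier[OF h] using bij_betwE[OF bij] \<psi>'\<phi>[OF C(1)] by simp
  next
    fix D assume "D \<in> carrier (V_fg (opp_ring R))"
    then have D: "D \<in> carrier (V_cg (opp_ring R))" "\<forall>i<t. ?\<psi>' D i \<noteq> \<infinity>"
      unfolding O.V_fg_carrier[OF h] by simp_all
    have "D \<in> \<phi> ` carrier (V_cg R)" using D(1) bij_betw_imp_surj_on[OF bij] by simp
    then obtain C where C: "C \<in> carrier (V_cg R)" "D = \<phi> C" by blast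
    then have "C \<in> carrier (V_fg R)" unfolding V_fg_carrier[OF h] using D(2) \<psi>'\<phi>[OF C(1)] by simp
    then show "D \<in> \<phi> ` carrier (V_fg R)" using C(2) by blast
  qed
  have sub: "carrier (V_fg R) \<subseteq> carrier (V_cg R)" unfolding V_fg_carrier[OF h] by blast
  have "bij_betw \<phi> (carrier (V_fg R)) (carrier (V_fg (opp_ring R)))"
    using bij_betw_subset[OF bij sub img] .
  moreover have "\<phi> (C \<otimes>\<^bsub>V_fg R\<^esub> D) = \<phi> C \<otimes>\<^bsub>V_fg (opp_ring R)\<^esub> \<phi> D"
    if "C \<in> carrier (V_fg R)" "D \<in> carrier (V_fg R)" for C D
  proof -
    have "\<phi> (C \<otimes>\<^bsub>V_cg R\<^esub> D) = \<phi> C \<otimes>\<^bsub>V_cg (opp_ring R)\<^esub> \<phi> D"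
      using \<phi> subsetD[OF sub that(1)] subsetD[OF sub that(2)] by (simp add: iso_def hom_def)
    then show ?thesis by (simp add: V_fg_def)
  qed
  moreover have "\<phi> \<in> carrier (V_fg R) \<rightarrow> carrier (V_fg (opp_ring R))" using img by blast
  ultimately have fg: "\<phi> \<in> iso (V_fg R) (V_fg (opp_ring R))" unfolding iso_def hom_def by blast
  have "\<phi> (iso_class R P) = iso_class (opp_ring R) (dual_module R P)"
    if P: "projective R P" "finitely_generated R P" for P :: "('a, nat \<Rightarrow> 'a) module"
  proof -
    have "countably_generated R P" using P(2) by (rule finitely_generated_imp_countably_generated)
    then have "framed P" using P(1) by (simp add: framed_iff)
    then obtain A :: "nat set" and c y g where fr: "frame R P A c y g" and c: "c ` A \<subseteq> E"
      unfolding framed_def by blast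
    have cE: "c s \<in> E" if "s \<in> A" for s using c that by blast
    have "finite A"
      using frame.finite_if_finitely_generated[OF fr P(2)] cE E_nonzero by blast
    note fr' = frame_dual_module[OF fr this]
    have dual: "O.framed (dual_module R P)" using cE by (intro O.framedI[OF fr']) auto
    have "multiplicity (opp_ring R) (dual_module R P) (h i) = multiplicity R P (h i)" if "i < t" for i
      using multiplicity_frame[OF fr cE h_E[OF h that]] O.multiplicity_frame[OF fr' cE h_E[OF h that]] by simp
    then have "?\<psi>' (iso_class (opp_ring R) (dual_module R P)) = ?\<psi> (iso_class R P)"
      unfolding O.class_multiplicities_iso_class[OF h dual] class_multiplicities_iso_class[OF h \<open>framed P\<close>]
      by (intro restrict_ext) simp
    then show ?thesis
      unfolding \<phi>_def using O.representative(3)[OF dual] \<psi>'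
      by (metis (no_types, lifting) bij_betw_inv_into_left iso_def mem_Collect_eq)
  qed
  with \<phi> fg show ?thesis by blast
qed

lemma (in basic_set) V_cg_eq_V_fg_Un_B_big:
  "carrier (V_cg R) = carrier (V_fg R) \<union> B_big R" "carrier (V_fg R) \<inter> B_big R = {}"
proof -
  note fgcg = finitely_generated_imp_countably_generated
  show "carrier (V_cg R) = carrier (V_fg R) \<union> B_big R"
  proof (intro equalityI subsetI)
    fix C assume "C \<in> carrier (V_cg R)"
    then obtain P :: "('a, nat \<Rightarrow> 'a) module" where P: "projective R P" "countably_generated R P" "C = iso_class R P"
      by (auto simp: V_cg_def)
    then have "relatively_big R P" by (intro countably_generated_projective_relatively_big)
    then show "C \<in> carrier (V_fg R) \<union> B_big R"
      using P by (cases "finitely_generated R P") (auto simp: V_fg_def B_big_def)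
  next
    fix C assume "C \<in> carrier (V_fg R) \<union> B_big R"
    then show "C \<in> carrier (V_cg R)"
      using fgcg by (auto simp: V_fg_def V_cg_def B_big_def relatively_big_def)
  qed
  show "carrier (V_fg R) \<inter> B_big R = {}"
  proof (rule equals0I)
    fix C assume "C \<in> carrier (V_fg R) \<inter> B_big R"
    then obtain P Q :: "('a, nat \<Rightarrow> 'a) module" where P: "projective R P" "finitely_generated R P" "C = iso_class R P"
      and Q: "relatively_big R Q" "\<not> finitely_generated R Q" "C = iso_class R Q"
      by (auto simp: V_fg_def B_big_def)
    have fr: "framed P" "framed Q" using P(1,2) Q(1) fgcg by (auto simp: framed_iff relatively_big_def)
    have "module_isomorphic R P Q"
      using iso_class_eq_iff[OF framed_right_module[OF fr(1)] framed_right_module[OF fr(2)]] P(3) Q(3) by simp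
    then have "finitely_generated R P \<longleftrightarrow> finitely_generated R Q"
      using framed_isomorphic_iff[OF fr] framed_finitely_generated_iff[OF fr(1)]
        framed_finitely_generated_iff[OF fr(2)] by simp
    then show False using P(2) Q(2) by simp
  qed
qed

theorem proposition6p4:
  fixes R :: "('a, 'r) ring_scheme"
    and t :: nat
  assumes "semiperfect R"
    and "t = card (indecomposable_projectives R)"
  shows
    "finite (indecomposable_projectives R) \<and>
     (\<exists>\<nu> \<in> iso (V_fg R) (product_group {..<t} (\<lambda>_. additive_monoid :: nat monoid)).
      \<exists>\<psi> \<in> iso (V_cg R) (product_group {..<t} (\<lambda>_. additive_monoid :: enat monoid)).
        \<forall>C \<in> carrier (V_fg R). \<psi> C = (\<lambda>i\<in>{..<t}. enat (\<nu> C i))) \<and>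
     (\<exists>\<phi> \<in> iso (V_cg R) (V_cg (opp_ring R)).
        \<phi> \<in> iso (V_fg R) (V_fg (opp_ring R)) \<and>
        (\<forall>P :: ('a, nat \<Rightarrow> 'a) module. projective R P \<and> finitely_generated R P \<longrightarrow>
           \<phi> (iso_class R P) = iso_class (opp_ring R) (dual_module R P))) \<and>
     (\<forall>P :: ('a, 'm) module. projective R P \<longrightarrow>
        (\<exists>I. fg_mod_ideal R P I \<and>
             (\<forall>J. fg_mod_ideal R P J \<and> J \<subseteq> I \<longrightarrow> J = I) \<and>
             (\<exists>Q :: ('a, nat \<Rightarrow> 'a) module.
                projective R Q \<and> finitely_generated R Q \<and> I = trace_ideal R Q))) \<and>
     (\<forall>P :: ('a, 'm) module. projective R P \<and> countably_generated R P \<longrightarrow> relatively_big R P) \<and>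
     carrier (V_cg R) = carrier (V_fg R) \<union> B_big R \<and>
     carrier (V_fg R) \<inter> B_big R = {}"
proof -
  interpret ring R using assms(1) by (simp add: semiperfect_def)
  obtain E where "basic_set R E" using semiperfect_basic_set[OF assms(1)] by blast
  then interpret basic_set R E .
  have finite: "finite (indecomposable_projectives R)"
    using bij_betw_finite[OF bij_betw_indecomposable_projectives] finite_E by simp
  have "card E = t"
    using bij_betw_same_card[OF bij_betw_indecomposable_projectives] assms(2) by simp
  then obtain h where h: "bij_betw h {..<t} E"
    using ex_bij_betw_nat_finite[OF finite_E] by (auto simp: atLeast0LessThan)
  have enat: "class_multiplicities h t C = (\<lambda>i\<in>{..<t}. enat ((\<lambda>i\<in>{..<t}. the_enat (class_multiplicities h t C i)) i))"
    if "C \<in> carrier (V_fg R)" for C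
  proof
    fix i
    show "class_multiplicities h t C i = (\<lambda>i\<in>{..<t}. enat ((\<lambda>i\<in>{..<t}. the_enat (class_multiplicities h t C i)) i)) i"
    proof (cases "i < t")
      case True
      then have "class_multiplicities h t C i \<noteq> \<infinity>" using \<open>C \<in> carrier (V_fg R)\<close> V_fg_carrier[OF h] by simp
      with True show ?thesis by auto
    qed (simp add: class_multiplicities_def)
  qed
  have minimal: "\<exists>I. fg_mod_ideal R P I \<and> (\<forall>J. fg_mod_ideal R P J \<and> J \<subseteq> I \<longrightarrow> J = I) \<and>
      (\<exists>Q :: ('a, nat \<Rightarrow> 'a) module. projective R Q \<and> finitely_generated R Q \<and> I = trace_ideal R Q)"
    if P: "projective R P" for P :: "('a, 'm) module"
  proof -
    obtain Q :: "('a, nat \<Rightarrow> 'a) module"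
      where Q: "framed Q" "finitely_generated R Q" "fg_mod_ideal R P (trace_ideal R Q)"
        "\<And>J. fg_mod_ideal R P J \<Longrightarrow> trace_ideal R Q \<subseteq> J"
      using ideal_trace_of_infinite_part[OF P] by metis
    have "projective R Q" using Q(1) by (simp add: framed_iff)
    then show ?thesis using Q(2-4) by (intro exI[of _ "trace_ideal R Q"]) blast
  qed
  have big: "relatively_big R P" if "projective R P \<and> countably_generated R P" for P :: "('a, 'm) module"
    using that by (intro countably_generated_projective_relatively_big) simp_all
  show ?thesis
    using finite class_multiplicities_iso[OF h] finite_class_multiplicities_iso[OF h] enat
      duality_iso[OF h] minimal big V_cg_eq_V_fg_Un_B_big
    by (intro conjI allI impI bexI[of _ "class_multiplicities h t"]
        bexI[of _ "\<lambda>C. \<lambda>i\<in>{..<t}. the_enat (class_multiplicities h t C i)"] ballI) simp_all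
qed

end
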